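(* Let $k\in\{1,2\}$ and consider the multi-sensor tessarine system with packet dropouts described in the context, under the $\mathbb{T}_k$-properness conditions stated there. Let $\hat{\mathbf{x}}^{\mathbb{T}_k}(t|t)$ be the $\mathbb{T}_k$-proper LLMS centralized fusion filter, i.e. the LLMS linear estimator of $\mathbf{x}(t)$ from $\{\mathbf{y}_k(1),\dots,\mathbf{y}_k(t)\}$, and let $\mathbf{P}^{\mathbb{T}_k}(t|t)=E[(\mathbf{x}(t)-\hat{\mathbf{x}}^{\mathbb{T}_k}(t|t))(\mathbf{x}(t)-\hat{\mathbf{x}}^{\mathbb{T}_k}(t|t))^{H}]$ be its error pseudo covariance matrix. Then $$\hat{\mathbf{x}}^{\mathbb{T}_1}(t|t)=\hat{\mathbf{x}}_1(t|t),\qquad \hat{\mathbf{x}}^{\mathbb{T}_2}(t|t)=[\mathbf{I}_n,\mathbf{0}_{n\times n}]\,\hat{\mathbf{x}}_2(t|t),$$ $$\mathbf{P}^{\mathbb{T}_1}(t|t)=\mathbf{P}_1(t|t),\qquad \mathbf{P}^{\mathbb{T}_2}(t|t)=[\mathbf{I}_n,\mathbf{0}_{n\times n}]\,\mathbf{P}_2(t|t)\,[\mathbf{I}_n,\mathbf{0}_{n\times n}]^{T},$$ where $\hat{\mathbf{x}}_k(t|t)$ and $\mathbf{P}_k(t|t)$ are computed by the following recursive algorithm. (1) Filter and predictor: $$\hat{\mathbf{x}}_k(t|t)=\hat{\mathbf{x}}_k(t|t-1)+\mathbf{L}_k(t)\boldsymbol{\epsilon}_k(t),\quad t\ge1,$$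 $$\hat{\mathbf{x}}_k(t+1|t)=\boldsymbol{\Phi}_k(t)\hat{\mathbf{x}}_k(t|t)+\mathbf{H}_k(t)\boldsymbol{\epsilon}_k(t),\quad t\ge1,$$ with $\hat{\mathbf{x}}_k(1|0)=\hat{\mathbf{x}}_k(0|0)=\mathbf{0}_{kn}$. (2) Innovations: $\boldsymbol{\epsilon}_k(1)=\mathbf{y}_k(1)$ and $$\boldsymbol{\epsilon}_k(t)=\mathbf{y}_k(t)-\boldsymbol{\Pi}_k(t)\boldsymbol{\mathcal{C}}_k\hat{\mathbf{x}}_k(t|t-1)-(\mathbf{I}_{knR}-\boldsymbol{\Pi}_k(t))\mathbf{y}_k(t-1),\quad t\ge2,$$ with $\boldsymbol{\mathcal{C}}_k=\mathbf{1}_R\otimes\mathbf{I}_{kn}$. (3) Gains: $\mathbf{H}_k(t)=\mathbf{S}_k(t)\boldsymbol{\Pi}_k(t)\boldsymbol{\Omega}_k^{-1}(t)$ and $\mathbf{L}_k(t)=\boldsymbol{\Theta}_k(t)\boldsymbol{\Omega}_k^{-1}(t)$, where $$\boldsymbol{\Theta}_k(t)=\mathbf{P}_k(t|t-1)\boldsymbol{\mathcal{C}}_k^{T}\boldsymbol{\Pi}_k(t),\ t\ge2;\qquad \boldsymbol{\Theta}_k(1)=\mathbf{1}_R^{T}\otimes\mathbf{D}_k(1),$$ $$\mathbf{D}_k(1)=[\mathbf{I}_{kn},\mathbf{0}_{kn\times(4-k)n}]\,\boldsymbol{\Gamma}_{\bar{\mathbf{x}}}(1,1)\,[\mathbf{I}_{kn},\mathbf{0}_{kn\times(4-k)n}]^{T},$$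 $$\boldsymbol{\Gamma}_{\bar{\mathbf{x}}}(t,t)=\bar{\boldsymbol{\Phi}}(t-1)\boldsymbol{\Gamma}_{\bar{\mathbf{x}}}(t-1,t-1)\bar{\boldsymbol{\Phi}}^{H}(t-1)+\bar{\mathbf{Q}}(t-1),\ t\ge1;\qquad \boldsymbol{\Gamma}_{\bar{\mathbf{x}}}(0,0)=\bar{\mathbf{P}}_0.$$ (4) Innovation pseudo covariances: $$\boldsymbol{\Omega}_k(t)=\boldsymbol{\Upsilon}_k\{\mathrm{Cov}(\vec{\boldsymbol{\gamma}}^r(t))\circ(\boldsymbol{\Psi}_1(t)-\boldsymbol{\Psi}_2(t)-\boldsymbol{\Psi}_2^{H}(t)+\boldsymbol{\Psi}_3(t))\}\boldsymbol{\Upsilon}_k^{H}+\boldsymbol{\Upsilon}_k\{\boldsymbol{\Gamma}_{\vec{\boldsymbol{\gamma}}^r}(t,t)\circ(\boldsymbol{\Upsilon}^{H}\vec{\mathbf{R}}(t)\boldsymbol{\Upsilon})\}\boldsymbol{\Upsilon}_k^{H}+\boldsymbol{\Pi}_k(t)\boldsymbol{\mathcal{C}}_k\mathbf{P}_k(t|t-1)\boldsymbol{\mathcal{C}}_k^{T}\boldsymbol{\Pi}_k(t)$$ (for $t=1$ the first term is read as zero, since $\mathrm{Cov}(\vec{\boldsymbol{\gamma}}^r(1))=0$), where $$\boldsymbol{\Psi}_1(t)=\boldsymbol{\Upsilon}^{H}\boldsymbol{\mathcal{C}}\boldsymbol{\Gamma}_{\bar{\mathbf{x}}}(t,t)\boldsymbol{\mathcal{C}}^{T}\boldsymbol{\Upsilon},$$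 $$\boldsymbol{\Psi}_2(t)=\boldsymbol{\Upsilon}^{H}\boldsymbol{\mathcal{C}}\big(\bar{\boldsymbol{\Phi}}(t-1)\boldsymbol{\Gamma}_{\bar{\mathbf{x}}\vec{\mathbf{y}}}(t-1,t-1)+\vec{\mathbf{S}}(t-1)\bar{\boldsymbol{\Pi}}^{\vec{\boldsymbol{\gamma}}}(t-1)\big)\boldsymbol{\Upsilon},$$ $$\boldsymbol{\Psi}_3(t)=\boldsymbol{\Upsilon}^{H}\boldsymbol{\Gamma}_{\vec{\mathbf{y}}}(t-1,t-1)\boldsymbol{\Upsilon},$$ and, for $t\ge 2$, $$\boldsymbol{\Gamma}_{\bar{\mathbf{x}}\vec{\mathbf{y}}}(t,t)=\boldsymbol{\Gamma}_{\bar{\mathbf{x}}}(t,t)\boldsymbol{\mathcal{C}}^{T}\bar{\boldsymbol{\Pi}}^{\vec{\boldsymbol{\gamma}}}(t)+\big(\bar{\boldsymbol{\Phi}}(t-1)\boldsymbol{\Gamma}_{\bar{\mathbf{x}}\vec{\mathbf{y}}}(t-1,t-1)+\vec{\mathbf{S}}(t-1)\bar{\boldsymbol{\Pi}}^{\vec{\boldsymbol{\gamma}}}(t-1)\big)\bar{\boldsymbol{\Pi}}^{\mathbf{1}-\vec{\boldsymbol{\gamma}}}(t),$$ $$\boldsymbol{\Gamma}_{\vec{\mathbf{y}}}(t,t)=\boldsymbol{\Upsilon}\{\boldsymbol{\Gamma}_{\vec{\boldsymbol{\gamma}}^r}(t,t)\circ(\boldsymbol{\Psi}_1(t)+\boldsymbol{\Upsilon}^{H}\vec{\mathbf{R}}(t)\boldsymbol{\Upsilon})+\boldsymbol{\Gamma}_{\vec{\boldsymbol{\gamma}}^r(\mathbf{1}-\vec{\boldsymbol{\gamma}}^r)}(t,t)\circ\boldsymbol{\Psi}_2(t)+\boldsymbol{\Gamma}^{T}_{\vec{\boldsymbol{\gamma}}^r(\mathbf{1}-\vec{\boldsymbol{\gamma}}^r)}(t,t)\circ\boldsymbol{\Psi}_2^{H}(t)+\boldsymbol{\Gamma}_{(\mathbf{1}-\vec{\boldsymbol{\gamma}}^r)}(t,t)\circ\boldsymbol{\Psi}_3(t)\}\boldsymbol{\Upsilon}^{H},$$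 with $\boldsymbol{\Gamma}_{\bar{\mathbf{x}}\vec{\mathbf{y}}}(1,1)=\boldsymbol{\Gamma}_{\bar{\mathbf{x}}}(1,1)\boldsymbol{\mathcal{C}}^{T}$ and $\boldsymbol{\Gamma}_{\vec{\mathbf{y}}}(1,1)=\boldsymbol{\mathcal{C}}\boldsymbol{\Gamma}_{\bar{\mathbf{x}}}(1,1)\boldsymbol{\mathcal{C}}^{T}+\vec{\mathbf{R}}(1)$. (5) Error pseudo covariances: $$\mathbf{P}_k(t|t)=\mathbf{P}_k(t|t-1)-\boldsymbol{\Theta}_k(t)\boldsymbol{\Omega}_k^{-1}(t)\boldsymbol{\Theta}_k^{H}(t),$$ $$\mathbf{P}_k(t+1|t)=\boldsymbol{\Phi}_k(t)\mathbf{P}_k(t|t)\boldsymbol{\Phi}_k^{H}(t)-\boldsymbol{\Phi}_k(t)\boldsymbol{\Theta}_k(t)\mathbf{H}_k^{H}(t)-\mathbf{H}_k(t)\boldsymbol{\Theta}_k^{H}(t)\boldsymbol{\Phi}_k^{H}(t)-\mathbf{H}_k(t)\boldsymbol{\Omega}_k(t)\mathbf{H}_k^{H}(t)+\mathbf{Q}_k(t),$$ with $\mathbf{P}_k(0|0)=\mathbf{P}_{0_k}$ and $\mathbf{P}_k(1|0)=\mathbf{D}_k(1)$.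
   Context: **Tessarines.** $\mathbb{T}$ is the commutative real algebra with basis $1,\eta,\eta',\eta''$ and $\eta\eta'=\eta''$, $\eta'\eta''=\eta$, $\eta''\eta=-\eta'$, $\eta^2=\eta''^2=-1$, $\eta'^2=1$. For $\mathbf{x}=\mathbf{x}_r+\eta\mathbf{x}_\eta+\eta'\mathbf{x}_{\eta'}+\eta''\mathbf{x}_{\eta''}$ (a vector or matrix, operations entrywise, real components $\mathbf{x}_\nu$) put $\mathbf{x}^*=\mathbf{x}_r-\eta\mathbf{x}_\eta+\eta'\mathbf{x}_{\eta'}-\eta''\mathbf{x}_{\eta''}$, $\mathbf{x}^\eta=\mathbf{x}_r+\eta\mathbf{x}_\eta-\eta'\mathbf{x}_{\eta'}-\eta''\mathbf{x}_{\eta''}$, $\mathbf{x}^{\eta''}=\mathbf{x}_r-\eta\mathbf{x}_\eta-\eta'\mathbf{x}_{\eta'}+\eta''\mathbf{x}_{\eta''}$. $(\cdot)^T$ is the transpose and $\mathbf{x}^H=(\mathbf{x}^* )^T$. For $\mathbf{x}\in\mathbb{T}^n$: $\bar{\mathbf{x}}=[\mathbf{x}^T,\mathbf{x}^{*T},\mathbf{x}^{\eta T},\mathbf{x}^{\eta''T}]^T\in\mathbb{T}^{4n}$ and $\mathbf{x}^r=[\mathbf{x}_r^T,\mathbf{x}_\eta^T,\mathbf{x}_{\eta'}^T,\mathbf{x}_{\eta''}^T]^T\in\mathbb{R}^{4n}$. Symbols: $\circ$ Hadamard product, $\otimes$ Kronecker product, $\mathbf{1}_m$ column vector of $m$ ones,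 $\mathbf{0}_m$ zero column vector, $\mathbf{I}_m$ identity matrix, $\delta_{t,s}$ Kronecker delta. The product $\star$ acts componentwise: $\mathbf{x}\star\mathbf{y}=\mathbf{x}_r\circ\mathbf{y}_r+\eta\,\mathbf{x}_\eta\circ\mathbf{y}_\eta+\eta'\,\mathbf{x}_{\eta'}\circ\mathbf{y}_{\eta'}+\eta''\,\mathbf{x}_{\eta''}\circ\mathbf{y}_{\eta''}$. In $\boldsymbol{\gamma}\star\mathbf z+(\mathbf 1_n-\boldsymbol\gamma)\star\mathbf y$ below, the "$1-\gamma$" is taken in each of the four real components, i.e. the $\nu$-component of the result is $\boldsymbol\gamma_\nu\circ\mathbf z_\nu+(\mathbf 1_n-\boldsymbol\gamma_\nu)\circ\mathbf y_\nu$, $\nu=r,\eta,\eta',\eta''$. **Correlations and properness.** Write $\boldsymbol{\Gamma}_{\mathbf{x}\mathbf{y}}(t,s)=E[\mathbf{x}(t)\mathbf{y}^H(s)]$ and $\boldsymbol{\Gamma}_{\mathbf{x}}=\boldsymbol{\Gamma}_{\mathbf{x}\mathbf{x}}$ (for real vectors this is $E[\mathbf{x}(t)\mathbf{y}^T(s)]$, without centering). $\mathbf{x}$ is $\mathbb{T}_1$-proper if $\boldsymbol{\Gamma}_{\mathbf{x}\mathbf{x}^\nu}(t,s)=0$ for all $t,s$ and $\nu=*,\eta,\eta''$, and $\mathbb{T}_2$-proper if this holds for $\nu=\eta,\eta''$. $\mathbf{x}$ and $\mathbf{y}$ are cross $\mathbb{T}_1$-proper (resp. cross $\mathbb{T}_2$-proper)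 if $\boldsymbol{\Gamma}_{\mathbf{x}\mathbf{y}^\nu}(t,s)=0$ for all $t,s$ and $\nu=*,\eta,\eta''$ (resp. $\nu=\eta,\eta''$). **System.** All random vectors except the Bernoulli ones have zero mean. With $R$ sensors and deterministic $\mathbf{F}_j(t)\in\mathbb{T}^{n\times n}$, $\mathbf{x}(t+1)=\mathbf{F}_1(t)\mathbf{x}(t)+\mathbf{F}_2(t)\mathbf{x}^*(t)+\mathbf{F}_3(t)\mathbf{x}^\eta(t)+\mathbf{F}_4(t)\mathbf{x}^{\eta''}(t)+\mathbf{u}(t)$, $t\ge0$; $\mathbf{z}^{(i)}(t)=\mathbf{x}(t)+\mathbf{v}^{(i)}(t)$, $t\ge1$, $i=1,\dots,R$; $\mathbf{y}^{(i)}(t)=\boldsymbol{\gamma}^{(i)}(t)\star\mathbf{z}^{(i)}(t)+(\mathbf{1}_n-\boldsymbol{\gamma}^{(i)}(t))\star\mathbf{y}^{(i)}(t-1)$, $t\ge2$; $\mathbf{y}^{(i)}(1)=\mathbf{z}^{(i)}(1)$. In augmented form $\bar{\mathbf{x}}(t+1)=\bar{\boldsymbol{\Phi}}(t)\bar{\mathbf{x}}(t)+\bar{\mathbf{u}}(t)$ with $$\bar{\boldsymbol{\Phi}}=\begin{bmatrix}\mathbf{F}_1&\mathbf{F}_2&\mathbf{F}_3&\mathbf{F}_4\\ \mathbf{F}_2^*&\mathbf{F}_1^*&\mathbf{F}_4^*&\mathbf{F}_3^*\\ \mathbf{F}_3^\eta&\mathbf{F}_4^\eta&\mathbf{F}_1^\eta&\mathbf{F}_2^\eta\\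 \mathbf{F}_4^{\eta''}&\mathbf{F}_3^{\eta''}&\mathbf{F}_2^{\eta''}&\mathbf{F}_1^{\eta''}\end{bmatrix}.$$ Stacked vectors: $\vec{\mathbf{y}}=[\bar{\mathbf{y}}^{(1)T},\dots,\bar{\mathbf{y}}^{(R)T}]^T$, and $\vec{\mathbf{v}}$ likewise. Noise assumptions: $\mathbf{u}(t)$ and $\mathbf{v}^{(i)}(t)$ are tessarine white noises with $\boldsymbol{\Gamma}_{\bar{\mathbf{u}}}(t,s)=\bar{\mathbf{Q}}(t)\delta_{t,s}$; $\boldsymbol{\Gamma}_{\bar{\mathbf{v}}^{(i)}}(t,s)=\bar{\mathbf{R}}^{(i)}(t)\delta_{t,s}$; $\boldsymbol{\Gamma}_{\bar{\mathbf{u}}\bar{\mathbf{v}}^{(i)}}(t,s)=\bar{\mathbf{S}}^{(i)}(t)\delta_{t,s}$; $\mathbf{v}^{(i)},\mathbf{v}^{(j)}$ are independent for $i\ne j$; $\mathbf{x}(0)$ is uncorrelated with $\mathbf{u}(t)$ and $\mathbf{v}^{(i)}(t)$ for $t\ge0$, $i=1,\dots,R$; $\bar{\mathbf{P}}_0=\boldsymbol{\Gamma}_{\bar{\mathbf{x}}}(0,0)$. Put $\vec{\mathbf{R}}(t)=\mathrm{diag}(\bar{\mathbf{R}}^{(1)}(t),\dots,\bar{\mathbf{R}}^{(R)}(t))$ and $\vec{\mathbf{S}}(t)=[\bar{\mathbf{S}}^{(1)}(t),\dots,\bar{\mathbf{S}}^{(R)}(t)]$. Bernoulli variables: $\boldsymbol{\gamma}^{(i)}(t)\in\mathbb{T}^n$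 has entries $\gamma_j^{(i)}=\gamma_{j,r}^{(i)}+\eta\gamma_{j,\eta}^{(i)}+\eta'\gamma_{j,\eta'}^{(i)}+\eta''\gamma_{j,\eta''}^{(i)}$, $j=1,\dots,n$, where the $\gamma_{j,\nu}^{(i)}(t)$ are independent Bernoulli variables with known parameters $p_{j,\nu}^{(i)}(t)$. Moreover $\boldsymbol{\gamma}^{(i)}(t)$ and $\boldsymbol{\gamma}^{(i)}(s)$ are independent for $t\neq s$, and $\boldsymbol{\gamma}^{(i)}(t)$ is independent of $\mathbf{x}(t)$, $\mathbf{u}(t)$, $\mathbf{v}^{(l)}(t)$, and of $\boldsymbol{\gamma}^{(l)}(t)$ for $l\neq i$, with $i,l=1,\dots,R$. At $t=1$, where $\mathbf{y}^{(i)}(1)=\mathbf{z}^{(i)}(1)$, one reads $\gamma_{j,\nu}^{(i)}(1)=1$, $p_{j,\nu}^{(i)}(1)=1$. Put $\vec{\boldsymbol{\gamma}}^r(t)=[(\boldsymbol{\gamma}^{(1)}(t))^{rT},\dots,(\boldsymbol{\gamma}^{(R)}(t))^{rT}]^T\in\mathbb{R}^{4nR}$; $\mathrm{Cov}(\vec{\boldsymbol{\gamma}}^r(t))$ is its covariance matrix, $\boldsymbol{\Gamma}_{\vec{\boldsymbol{\gamma}}^r}(t,t)=E[\vec{\boldsymbol{\gamma}}^r\vec{\boldsymbol{\gamma}}^{rT}]$, $\boldsymbol{\Gamma}_{\vec{\boldsymbol{\gamma}}^r(\mathbf{1}-\vec{\boldsymbol{\gamma}}^r)}(t,t)=E[\vec{\boldsymbol{\gamma}}^r(\mathbf{1}_{4nR}-\vec{\boldsymbol{\gamma}}^r)^T]$,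 $\boldsymbol{\Gamma}_{(\mathbf{1}-\vec{\boldsymbol{\gamma}}^r)}(t,t)=E[(\mathbf{1}_{4nR}-\vec{\boldsymbol{\gamma}}^r)(\mathbf{1}_{4nR}-\vec{\boldsymbol{\gamma}}^r)^T]$, all at time $t$. **$\mathbb{T}_k$-properness conditions.** $k=1$: $\mathbf{x}(0)$, $\mathbf{u}(t)$ and all $\mathbf{v}^{(i)}(t)$ are $\mathbb{T}_1$-proper; $\mathbf{u}$ and $\mathbf{v}^{(i)}$ are cross $\mathbb{T}_1$-proper; $\bar{\boldsymbol{\Phi}}(t)=\mathrm{diag}(\mathbf{F}_1(t),\mathbf{F}_1^*(t),\mathbf{F}_1^\eta(t),\mathbf{F}_1^{\eta''}(t))$; and $p_{j,r}^{(i)}(t)=p_{j,\eta}^{(i)}(t)=p_{j,\eta'}^{(i)}(t)=p_{j,\eta''}^{(i)}(t)$ for all $i,j,t$. $k=2$: $\mathbf{x}(0)$, $\mathbf{u}(t)$ and all $\mathbf{v}^{(i)}(t)$ are $\mathbb{T}_2$-proper; $\mathbf{u}$ and $\mathbf{v}^{(i)}$ are cross $\mathbb{T}_2$-proper; $\bar{\boldsymbol{\Phi}}(t)=\mathrm{diag}(\boldsymbol{\Phi}_2(t),\boldsymbol{\Phi}_2^\eta(t))$ with $\boldsymbol{\Phi}_2=\begin{bmatrix}\mathbf{F}_1&\mathbf{F}_2\\ \mathbf{F}_2^*&\mathbf{F}_1^*\end{bmatrix}$; and $p_{j,r}^{(i)}(t)=p_{j,\eta}^{(i)}(t)$, $p_{j,\eta'}^{(i)}(t)=p_{j,\eta''}^{(i)}(t)$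 for all $i,j,t$. **Reduced quantities.** For $\mathbf{w}\in\mathbb{T}^n$ let $\mathbf{w}_1=\mathbf{w}$ and $\mathbf{w}_2=[\mathbf{w}^T,\mathbf{w}^H]^T$ (the first $kn$ entries of $\bar{\mathbf{w}}$); this defines $\mathbf{x}_k,\mathbf{u}_k,\mathbf{v}_k^{(i)}$ and $\mathbf{y}_k^{(i)}$. The measurement vector is $\mathbf{y}_k(t)=[\mathbf{y}_k^{(1)T}(t),\dots,\mathbf{y}_k^{(R)T}(t)]^T\in\mathbb{T}^{knR}$. $\boldsymbol{\Phi}_1(t)=\mathbf{F}_1(t)$ and $\boldsymbol{\Phi}_2(t)=\begin{bmatrix}\mathbf{F}_1(t)&\mathbf{F}_2(t)\\ \mathbf{F}_2^*(t)&\mathbf{F}_1^*(t)\end{bmatrix}$. $\mathbf{Q}_k(t)=E[\mathbf{u}_k(t)\mathbf{u}_k^H(t)]$, $\mathbf{S}_k^{(i)}(t)=E[\mathbf{u}_k(t)\mathbf{v}_k^{(i)H}(t)]$, $\mathbf{S}_k(t)=[\mathbf{S}_k^{(1)}(t),\dots,\mathbf{S}_k^{(R)}(t)]$, $\mathbf{P}_{0_k}=E[\mathbf{x}_k(0)\mathbf{x}_k^H(0)]$. $\boldsymbol{\Pi}_k(t)=\mathrm{diag}(\boldsymbol{\Pi}_k^{(1)}(t),\dots,\boldsymbol{\Pi}_k^{(R)}(t))$ with $\boldsymbol{\Pi}_1^{(i)}(t)=\mathrm{diag}(p_{1,r}^{(i)}(t),\dots,p_{n,r}^{(i)}(t))$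 and $\boldsymbol{\Pi}_2^{(i)}(t)=\frac12\begin{bmatrix}\boldsymbol{\Pi}_a^{(i)}(t)&\boldsymbol{\Pi}_b^{(i)}(t)\\ \boldsymbol{\Pi}_b^{(i)}(t)&\boldsymbol{\Pi}_a^{(i)}(t)\end{bmatrix}$, where $\boldsymbol{\Pi}_a^{(i)}(t)=\mathrm{diag}(p_{1,r}^{(i)}(t)+p_{1,\eta'}^{(i)}(t),\dots,p_{n,r}^{(i)}(t)+p_{n,\eta'}^{(i)}(t))$ and $\boldsymbol{\Pi}_b^{(i)}(t)=\mathrm{diag}(p_{1,r}^{(i)}(t)-p_{1,\eta'}^{(i)}(t),\dots,p_{n,r}^{(i)}(t)-p_{n,\eta'}^{(i)}(t))$. **Matrices.** $\boldsymbol{\mathcal{C}}=\mathbf{1}_R\otimes\mathbf{I}_{4n}$; $\boldsymbol{\mathcal{T}}=\frac12\boldsymbol{\mathcal{A}}\otimes\mathbf{I}_n$ with $\boldsymbol{\mathcal{A}}=\begin{bmatrix}1&\eta&\eta'&\eta''\\1&-\eta&\eta'&-\eta''\\1&\eta&-\eta'&-\eta''\\1&-\eta&-\eta'&\eta''\end{bmatrix}$; $\boldsymbol{\Upsilon}=\mathbf{I}_R\otimes\boldsymbol{\mathcal{T}}$; $\boldsymbol{\Upsilon}_k=\mathbf{I}_R\otimes\boldsymbol{\mathcal{T}}_k$ with $\boldsymbol{\mathcal{T}}_k=\frac12\boldsymbol{\mathcal{B}}_k\otimes\mathbf{I}_n$, $\boldsymbol{\mathcal{B}}_k$ being the first $k$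 rows of $\boldsymbol{\mathcal{A}}$. $\bar{\boldsymbol{\Pi}}^{\vec{\boldsymbol{\gamma}}}(t)=\boldsymbol{\Upsilon}\,\mathrm{diag}(E[\vec{\boldsymbol{\gamma}}^r(t)])\,\boldsymbol{\Upsilon}^H$ and $\bar{\boldsymbol{\Pi}}^{\mathbf{1}-\vec{\boldsymbol{\gamma}}}(t)=\boldsymbol{\Upsilon}\,\mathrm{diag}(\mathbf{1}_{4nR}-E[\vec{\boldsymbol{\gamma}}^r(t)])\,\boldsymbol{\Upsilon}^H$. **LLMS estimator.** The linear least-mean-squares (LLMS) estimator of a tessarine random vector $\mathbf{w}$ from $\{\mathbf{y}_k(1),\dots,\mathbf{y}_k(t)\}$ is the projection $\hat{\mathbf{w}}=\sum_{s=1}^t\mathbf{K}_s\mathbf{y}_k(s)$, with tessarine matrices $\mathbf{K}_s$, such that $E[(\mathbf{w}-\hat{\mathbf{w}})\mathbf{y}_k^H(s)]=0$ for $s=1,\dots,t$.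
   Formalization: For k=2 the Bernoulli condition is corrected to p_r=p_η', p_η=p_η'' and Π_a, Π_b to p_r±p_η (as printed the claim fails); all Bernoulli variables are taken mutually independent and jointly independent of x(0) and all noises; Ω_k(s) is assumed invertible for s≤t. *)

theory Defs
  imports "HOL-Probability.Probability"
begin

section \<open>The algebra of tessarines\<close>

text \<open>\<open>Tess a b c d\<close> is $a + b\eta + c\eta' + d\eta''$.\<close>

datatype tess = Tess (tr: real) (te: real) (te1: real) (te2: real)

instantiation tess :: comm_ring_1
begin

definition "0 = Tess 0 0 0 0"
definition "1 = Tess 1 0 0 0"
definition "x + y = Tess (tr x + tr y) (te x + te y) (te1 x + te1 y) (te2 x + te2 y)"
definition "x - y = Tess (tr x - tr y) (te x - te y) (te1 x - te1 y) (te2 x - te2 y)"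
definition "- x = Tess (- tr x) (- te x) (- te1 x) (- te2 x)"
definition "x * y = Tess
  (tr x * tr y - te x * te y + te1 x * te1 y - te2 x * te2 y)
  (tr x * te y + te x * tr y + te1 x * te2 y + te2 x * te1 y)
  (tr x * te1 y + te1 x * tr y - te x * te2 y - te2 x * te y)
  (tr x * te2 y + te2 x * tr y + te x * te1 y + te1 x * te y)"

instance
  by standard
    (auto simp: zero_tess_def one_tess_def plus_tess_def minus_tess_def uminus_tess_def
      times_tess_def algebra_simps)

end

instantiation tess :: real_algebra_1
begin

definition "r *\<^sub>R x = Tess (r * tr x) (r * te x) (r * te1 x) (r * te2 x)"

instance
  by standard (auto simp: scaleR_tess_def plus_tess_def times_tess_def algebra_simps)

end

definition eta :: tess where "eta = Tess 0 1 0 0"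
definition eta1 :: tess where "eta1 = Tess 0 0 1 0"
definition eta2 :: tess where "eta2 = Tess 0 0 0 1"

lemma tess_multiplication_table:
  "eta * eta1 = eta2" "eta1 * eta2 = eta" "eta2 * eta = - eta1"
  "eta * eta = - 1" "eta1 * eta1 = 1" "eta2 * eta2 = - 1"
  by (simp_all add: eta_def eta1_def eta2_def times_tess_def uminus_tess_def one_tess_def)

lemma tess_basis:
  "Tess a b c d = of_real a + b *\<^sub>R eta + c *\<^sub>R eta1 + d *\<^sub>R eta2"
  by (simp add: eta_def eta1_def eta2_def of_real_def scaleR_tess_def plus_tess_def one_tess_def)

definition tcnj :: "tess \<Rightarrow> tess" where
  "tcnj x = Tess (tr x) (- te x) (te1 x) (- te2 x)"
definition teta :: "tess \<Rightarrow> tess" where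
  "teta x = Tess (tr x) (te x) (- te1 x) (- te2 x)"
definition teta2 :: "tess \<Rightarrow> tess" where
  "teta2 x = Tess (tr x) (- te x) (- te1 x) (te2 x)"

definition tstar :: "tess \<Rightarrow> tess \<Rightarrow> tess" (infixl "\<star>" 70) where
  "x \<star> y = Tess (tr x * tr y) (te x * te y) (te1 x * te1 y) (te2 x * te2 y)"

text \<open>The tessarine all of whose four real components are 1; it is the unit of \<open>\<star>\<close>, and the
  ``1'' of \<open>1 - \<gamma>\<close> in the measurement model.\<close>

definition tones :: tess where "tones = Tess 1 1 1 1"

datatype part = PR | PEta | PEta1 | PEta2
datatype invol = CId | CStar | CEta | CEta2

instance part :: finite
proof
  have "(UNIV :: part set) = {PR, PEta, PEta1, PEta2}"
    using part.exhaust by blast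
  then show "finite (UNIV :: part set)" by (metis finite.emptyI finite_insert)
qed

instance invol :: finite
proof
  have "(UNIV :: invol set) = {CId, CStar, CEta, CEta2}"
    using invol.exhaust by blast
  then show "finite (UNIV :: invol set)" by (metis finite.emptyI finite_insert)
qed

fun tpart :: "part \<Rightarrow> tess \<Rightarrow> real" where
  "tpart PR x = tr x"
| "tpart PEta x = te x"
| "tpart PEta1 x = te1 x"
| "tpart PEta2 x = te2 x"

fun capp :: "invol \<Rightarrow> tess \<Rightarrow> tess" where
  "capp CId x = x"
| "capp CStar x = tcnj x"
| "capp CEta x = teta x"
| "capp CEta2 x = teta2 x"

section \<open>Matrices\<close>

text \<open>A vector or matrix stacked from blocks is indexed by pairs (block, position inside the
  block). So \<open>invol \<times> 'n\<close> indexes an augmented vector, \<open>part \<times> 'n\<close> the vector of its real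
  components, and \<open>'r \<times> _\<close> a stack over the sensors.\<close>

definition map_vec :: "(tess \<Rightarrow> tess) \<Rightarrow> tess^'n \<Rightarrow> tess^'n" where
  "map_vec f v = (\<chi> i. f (v $ i))"

definition map_mat :: "(tess \<Rightarrow> tess) \<Rightarrow> tess^'n^'m \<Rightarrow> tess^'n^'m" where
  "map_mat f A = (\<chi> i j. f (A $ i $ j))"

definition herm :: "tess^'n^'m \<Rightarrow> tess^'m^'n" where
  "herm A = transpose (map_mat tcnj A)"

definition aug :: "tess^'n::finite \<Rightarrow> tess^(invol \<times> 'n)" where
  "aug x = (\<chi> a. capp (fst a) (x $ snd a))"

definition block_mat ::
  "('a::finite \<Rightarrow> 'b::finite \<Rightarrow> 'c^'n::finite^'m::finite) \<Rightarrow> 'c^('b \<times> 'n)^('a \<times> 'm)" where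
  "block_mat B = (\<chi> p q. B (fst p) (fst q) $ snd p $ snd q)"

definition block_diag ::
  "('a::finite \<Rightarrow> tess^'n::finite^'n) \<Rightarrow> tess^('a \<times> 'n)^('a \<times> 'n)" where
  "block_diag B = block_mat (\<lambda>i j. if i = j then B i else 0)"

definition block_row ::
  "('b::finite \<Rightarrow> 'c^'n::finite^'m) \<Rightarrow> 'c^('b \<times> 'n)^'m" where
  "block_row B = (\<chi> p q. B (fst q) $ p $ snd q)"

definition diag_mat :: "real^'n \<Rightarrow> tess^'n^'n" where
  "diag_mat v = (\<chi> i j. if i = j then of_real (v $ i) else 0)"

definition hadamard :: "real^'n^'m \<Rightarrow> tess^'n^'m \<Rightarrow> tess^'n^'m" (infixl "\<odot>" 70) where
  "A \<odot> B = (\<chi> i j. (A $ i $ j) *\<^sub>R (B $ i $ j))"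

definition kron ::
  "tess^'n::finite^'m::finite \<Rightarrow> tess^'q::finite^'p::finite \<Rightarrow> tess^('n \<times> 'q)^('m \<times> 'p)" where
  "kron A B = (\<chi> a b. A $ fst a $ fst b * B $ snd a $ snd b)"

text \<open>\<open>ones_kron\<close> is $\mathbf 1_R \otimes \mathbf I$, with the one-element factor of its column
  index dropped.\<close>

definition ones_kron :: "tess^'m::finite^('r::finite \<times> 'm)" where
  "ones_kron = (\<chi> a b. if snd a = b then 1 else 0)"

fun calA_entry :: "invol \<Rightarrow> part \<Rightarrow> tess" where
  "calA_entry CId PR = 1"
| "calA_entry CId PEta = eta"
| "calA_entry CId PEta1 = eta1"
| "calA_entry CId PEta2 = eta2"
| "calA_entry CStar PR = 1"
| "calA_entry CStar PEta = - eta"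
| "calA_entry CStar PEta1 = eta1"
| "calA_entry CStar PEta2 = - eta2"
| "calA_entry CEta PR = 1"
| "calA_entry CEta PEta = eta"
| "calA_entry CEta PEta1 = - eta1"
| "calA_entry CEta PEta2 = - eta2"
| "calA_entry CEta2 PR = 1"
| "calA_entry CEta2 PEta = - eta"
| "calA_entry CEta2 PEta1 = - eta1"
| "calA_entry CEta2 PEta2 = eta2"

definition calA :: "tess^part^invol" where
  "calA = (\<chi> c \<nu>. calA_entry c \<nu>)"

definition calT :: "tess^(part \<times> 'n::finite)^(invol \<times> 'n)" where
  "calT = kron ((1 / 2) *\<^sub>R calA) (mat 1)"

definition Ups :: "tess^('r::finite \<times> part \<times> 'n::finite)^('r \<times> invol \<times> 'n)" where
  "Ups = kron (mat 1) calT"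

section \<open>Expectations, correlations, properness, LLMS estimators\<close>

definition texp :: "'w measure \<Rightarrow> ('w \<Rightarrow> tess) \<Rightarrow> tess" where
  "texp M X = Tess (\<integral>\<omega>. tr (X \<omega>) \<partial>M) (\<integral>\<omega>. te (X \<omega>) \<partial>M)
                   (\<integral>\<omega>. te1 (X \<omega>) \<partial>M) (\<integral>\<omega>. te2 (X \<omega>) \<partial>M)"

text \<open>\<open>Gam M X Y\<close> is $E[X Y^H]$ and \<open>rGam M X Y\<close> is $E[X Y^T]$ for real vectors.\<close>

definition Gam :: "'w measure \<Rightarrow> ('w \<Rightarrow> tess^'m) \<Rightarrow> ('w \<Rightarrow> tess^'n) \<Rightarrow> tess^'n^'m" where
  "Gam M X Y = (\<chi> i j. texp M (\<lambda>\<omega>. X \<omega> $ i * tcnj (Y \<omega> $ j)))"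

definition rGam :: "'w measure \<Rightarrow> ('w \<Rightarrow> real^'m) \<Rightarrow> ('w \<Rightarrow> real^'n) \<Rightarrow> real^'n^'m" where
  "rGam M X Y = (\<chi> i j. \<integral>\<omega>. X \<omega> $ i * Y \<omega> $ j \<partial>M)"

definition square_integrable_vec :: "'w measure \<Rightarrow> ('w \<Rightarrow> tess^'n) \<Rightarrow> bool" where
  "square_integrable_vec M X \<longleftrightarrow>
     (\<forall>j \<nu>. (\<lambda>\<omega>. tpart \<nu> (X \<omega> $ j)) \<in> borel_measurable M \<and>
            integrable M (\<lambda>\<omega>. (tpart \<nu> (X \<omega> $ j))\<^sup>2))"

definition zero_mean :: "'w measure \<Rightarrow> ('w \<Rightarrow> tess^'n) \<Rightarrow> bool" where
  "zero_mean M X \<longleftrightarrow> (\<forall>j. texp M (\<lambda>\<omega>. X \<omega> $ j) = 0)"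

text \<open>A single random vector is treated as a process over the one-point time set \<open>unit\<close>.\<close>

definition cross_T1_proper ::
  "'w measure \<Rightarrow> ('t \<Rightarrow> 'w \<Rightarrow> tess^'m) \<Rightarrow> ('t \<Rightarrow> 'w \<Rightarrow> tess^'n) \<Rightarrow> bool" where
  "cross_T1_proper M X Y \<longleftrightarrow>
     (\<forall>t s. \<forall>c\<in>{CStar, CEta, CEta2}. Gam M (X t) (\<lambda>\<omega>. map_vec (capp c) (Y s \<omega>)) = 0)"

definition cross_T2_proper ::
  "'w measure \<Rightarrow> ('t \<Rightarrow> 'w \<Rightarrow> tess^'m) \<Rightarrow> ('t \<Rightarrow> 'w \<Rightarrow> tess^'n) \<Rightarrow> bool" where
  "cross_T2_proper M X Y \<longleftrightarrow>
     (\<forall>t s. \<forall>c\<in>{CEta, CEta2}. Gam M (X t) (\<lambda>\<omega>. map_vec (capp c) (Y s \<omega>)) = 0)"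

definition T1_proper :: "'w measure \<Rightarrow> ('t \<Rightarrow> 'w \<Rightarrow> tess^'n) \<Rightarrow> bool" where
  "T1_proper M X \<longleftrightarrow> cross_T1_proper M X X"

definition T2_proper :: "'w measure \<Rightarrow> ('t \<Rightarrow> 'w \<Rightarrow> tess^'n) \<Rightarrow> bool" where
  "T2_proper M X \<longleftrightarrow> cross_T2_proper M X X"

text \<open>\<open>what\<close> is the LLMS estimator of \<open>w\<close> from \<open>y 1, \<dots>, y t\<close>; the orthogonality condition
  determines it up to a null set.\<close>

definition LLMS_estimator ::
  "'w measure \<Rightarrow> ('w \<Rightarrow> tess^'m) \<Rightarrow> (nat \<Rightarrow> 'w \<Rightarrow> tess^'q) \<Rightarrow> nat \<Rightarrow> ('w \<Rightarrow> tess^'m) \<Rightarrow> bool" where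
  "LLMS_estimator M w y t what \<longleftrightarrow>
     (\<exists>K :: nat \<Rightarrow> tess^'q^'m. what = (\<lambda>\<omega>. \<Sum>s = 1..t. K s *v y s \<omega>)) \<and>
     (\<forall>s\<in>{1..t}. Gam M (\<lambda>\<omega>. w \<omega> - what \<omega>) (y s) = 0)"

section \<open>The multi-sensor system with packet dropouts\<close>

record ('w, 'n, 'r) dropout_system =
  pspace :: "'w measure"
  F1 :: "nat \<Rightarrow> tess^'n^'n"
  F2 :: "nat \<Rightarrow> tess^'n^'n"
  F3 :: "nat \<Rightarrow> tess^'n^'n"
  F4 :: "nat \<Rightarrow> tess^'n^'n"
  st :: "nat \<Rightarrow> 'w \<Rightarrow> tess^'n"                   \<comment> \<open>state $\mathbf x(t)$\<close>
  un :: "nat \<Rightarrow> 'w \<Rightarrow> tess^'n"                   \<comment> \<open>state noise $\mathbf u(t)$\<close>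
  vn :: "'r \<Rightarrow> nat \<Rightarrow> 'w \<Rightarrow> tess^'n"             \<comment> \<open>sensor noise $\mathbf v^{(i)}(t)$\<close>
  gam :: "'r \<Rightarrow> nat \<Rightarrow> 'w \<Rightarrow> tess^'n"            \<comment> \<open>Bernoulli vectors $\gamma^{(i)}(t)$\<close>
  ym :: "'r \<Rightarrow> nat \<Rightarrow> 'w \<Rightarrow> tess^'n"             \<comment> \<open>available measurement $\mathbf y^{(i)}(t)$\<close>
  pr :: "'r \<Rightarrow> nat \<Rightarrow> 'n \<Rightarrow> part \<Rightarrow> real"        \<comment> \<open>Bernoulli parameters $p_{j,\nu}^{(i)}(t)$\<close>

definition zm :: "('w, 'n::finite, 'r::finite) dropout_system \<Rightarrow> 'r \<Rightarrow> nat \<Rightarrow> 'w \<Rightarrow> tess^'n" where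
  "zm S i t \<omega> = st S t \<omega> + vn S i t \<omega>"

definition Qbar :: "('w, 'n::finite, 'r::finite) dropout_system \<Rightarrow> nat \<Rightarrow> tess^(invol \<times> 'n)^(invol \<times> 'n)"
  where "Qbar S t = Gam (pspace S) (\<lambda>\<omega>. aug (un S t \<omega>)) (\<lambda>\<omega>. aug (un S t \<omega>))"

definition Rbar ::
  "('w, 'n::finite, 'r::finite) dropout_system \<Rightarrow> 'r \<Rightarrow> nat \<Rightarrow> tess^(invol \<times> 'n)^(invol \<times> 'n)"
  where "Rbar S i t = Gam (pspace S) (\<lambda>\<omega>. aug (vn S i t \<omega>)) (\<lambda>\<omega>. aug (vn S i t \<omega>))"

definition Sbar ::
  "('w, 'n::finite, 'r::finite) dropout_system \<Rightarrow> 'r \<Rightarrow> nat \<Rightarrow> tess^(invol \<times> 'n)^(invol \<times> 'n)"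
  where "Sbar S i t = Gam (pspace S) (\<lambda>\<omega>. aug (un S t \<omega>)) (\<lambda>\<omega>. aug (vn S i t \<omega>))"

definition P0bar :: "('w, 'n::finite, 'r::finite) dropout_system \<Rightarrow> tess^(invol \<times> 'n)^(invol \<times> 'n)"
  where "P0bar S = Gam (pspace S) (\<lambda>\<omega>. aug (st S 0 \<omega>)) (\<lambda>\<omega>. aug (st S 0 \<omega>))"

definition gam_part ::
  "('w, 'n::finite, 'r::finite) dropout_system \<Rightarrow> 'r \<times> nat \<times> 'n \<times> part \<Rightarrow> 'w \<Rightarrow> real" where
  "gam_part S = (\<lambda>(i, t, j, \<nu>) \<omega>. tpart \<nu> (gam S i t \<omega> $ j))"

definition gam_index :: "('r \<times> nat \<times> 'n \<times> part) set" where
  "gam_index = {(i, t, j, \<nu>). 1 \<le> t}"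

datatype 'r source = SrcX0 | SrcU nat | SrcV 'r nat

fun source_vec ::
  "('w, 'n::finite, 'r::finite) dropout_system \<Rightarrow> 'r source \<Rightarrow> 'w \<Rightarrow> tess^'n" where
  "source_vec S SrcX0 = st S 0"
| "source_vec S (SrcU t) = un S t"
| "source_vec S (SrcV i t) = vn S i t"

definition source_part ::
  "('w, 'n::finite, 'r::finite) dropout_system \<Rightarrow> 'r source \<times> 'n \<times> part \<Rightarrow> 'w \<Rightarrow> real" where
  "source_part S = (\<lambda>(a, j, \<nu>) \<omega>. tpart \<nu> (source_vec S a \<omega> $ j))"

text \<open>Independence of processes is independence of the generated sigma-algebras, expressed
  through the map into the product space of all real components. In \<open>gam_indep_sources\<close> the states
  \<open>st S t\<close> need not be listed, being functions of \<open>st S 0\<close> and of the noise \<open>un S\<close>.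
  ``Uncorrelated'' refers to the augmented vectors, that is, to all real components.\<close>

locale tessarine_system = prob_space "pspace S"
  for S :: "('w, 'n::finite, 'r::finite) dropout_system" +
  assumes state_eq: "\<And>t \<omega>. \<omega> \<in> space (pspace S) \<Longrightarrow>
      st S (Suc t) \<omega> = F1 S t *v st S t \<omega> + F2 S t *v map_vec tcnj (st S t \<omega>)
        + F3 S t *v map_vec teta (st S t \<omega>) + F4 S t *v map_vec teta2 (st S t \<omega>) + un S t \<omega>"
    and meas_1: "\<And>i \<omega>. \<omega> \<in> space (pspace S) \<Longrightarrow> ym S i 1 \<omega> = zm S i 1 \<omega>"
    and meas_eq: "\<And>i t \<omega>. 2 \<le> t \<Longrightarrow> \<omega> \<in> space (pspace S) \<Longrightarrow>
      ym S i t \<omega> = (\<chi> j. gam S i t \<omega> $ j \<star> zm S i t \<omega> $ j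
                        + (tones - gam S i t \<omega> $ j) \<star> ym S i (t - 1) \<omega> $ j)"
    and x0_square_integrable: "square_integrable_vec (pspace S) (st S 0)"
    and u_square_integrable: "\<And>t. square_integrable_vec (pspace S) (un S t)"
    and v_square_integrable: "\<And>i t. square_integrable_vec (pspace S) (vn S i t)"
    and x0_zero_mean: "zero_mean (pspace S) (st S 0)"
    and u_zero_mean: "\<And>t. zero_mean (pspace S) (un S t)"
    and v_zero_mean: "\<And>i t. zero_mean (pspace S) (vn S i t)"
    and u_white: "\<And>t s. Gam (pspace S) (\<lambda>\<omega>. aug (un S t \<omega>)) (\<lambda>\<omega>. aug (un S s \<omega>))
                         = (if t = s then Qbar S t else 0)"
    and v_white: "\<And>i t s. Gam (pspace S) (\<lambda>\<omega>. aug (vn S i t \<omega>)) (\<lambda>\<omega>. aug (vn S i s \<omega>))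
                         = (if t = s then Rbar S i t else 0)"
    and u_v_corr: "\<And>i t s. Gam (pspace S) (\<lambda>\<omega>. aug (un S t \<omega>)) (\<lambda>\<omega>. aug (vn S i s \<omega>))
                         = (if t = s then Sbar S i t else 0)"
    and v_indep: "\<And>i l. i \<noteq> l \<Longrightarrow>
      indep_var (\<Pi>\<^sub>M k\<in>UNIV. borel) (\<lambda>\<omega> (t, j, \<nu>). tpart \<nu> (vn S i t \<omega> $ j))
                (\<Pi>\<^sub>M k\<in>UNIV. borel) (\<lambda>\<omega> (t, j, \<nu>). tpart \<nu> (vn S l t \<omega> $ j))"
    and x0_u_uncorr: "\<And>t. Gam (pspace S) (\<lambda>\<omega>. aug (st S 0 \<omega>)) (\<lambda>\<omega>. aug (un S t \<omega>)) = 0"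
    and x0_v_uncorr: "\<And>i t. Gam (pspace S) (\<lambda>\<omega>. aug (st S 0 \<omega>)) (\<lambda>\<omega>. aug (vn S i t \<omega>)) = 0"
    and gam_measurable: "\<And>i t j \<nu>. 1 \<le> t \<Longrightarrow>
      (\<lambda>\<omega>. tpart \<nu> (gam S i t \<omega> $ j)) \<in> borel_measurable (pspace S)"
    and gam_01: "\<And>i t j \<nu>. 1 \<le> t \<Longrightarrow> AE \<omega> in pspace S. tpart \<nu> (gam S i t \<omega> $ j) \<in> {0, 1}"
    and gam_prob: "\<And>i t j \<nu>. 1 \<le> t \<Longrightarrow>
      measure (pspace S) {\<omega> \<in> space (pspace S). tpart \<nu> (gam S i t \<omega> $ j) = 1} = pr S i t j \<nu>"
    and gam_1: "\<And>i j \<nu> \<omega>. \<omega> \<in> space (pspace S) \<Longrightarrow> tpart \<nu> (gam S i 1 \<omega> $ j) = 1"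
    and pr_1: "\<And>i j \<nu>. pr S i 1 j \<nu> = 1"
    and gam_indep: "indep_vars (\<lambda>_. borel) (gam_part S) gam_index"
    and gam_indep_sources:
      "indep_set
         (sets (vimage_algebra (space (pspace S))
                  (\<lambda>\<omega>. \<lambda>k\<in>gam_index. gam_part S k \<omega>) (\<Pi>\<^sub>M k\<in>gam_index. borel)))
         (sets (vimage_algebra (space (pspace S))
                  (\<lambda>\<omega> k. source_part S k \<omega>) (\<Pi>\<^sub>M k\<in>UNIV. borel)))"

fun Phibar_block ::
  "('w, 'n::finite, 'r::finite) dropout_system \<Rightarrow> nat \<Rightarrow> invol \<Rightarrow> invol \<Rightarrow> tess^'n^'n" where
  "Phibar_block S t CId CId = F1 S t"
| "Phibar_block S t CId CStar = F2 S t"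
| "Phibar_block S t CId CEta = F3 S t"
| "Phibar_block S t CId CEta2 = F4 S t"
| "Phibar_block S t CStar CId = map_mat tcnj (F2 S t)"
| "Phibar_block S t CStar CStar = map_mat tcnj (F1 S t)"
| "Phibar_block S t CStar CEta = map_mat tcnj (F4 S t)"
| "Phibar_block S t CStar CEta2 = map_mat tcnj (F3 S t)"
| "Phibar_block S t CEta CId = map_mat teta (F3 S t)"
| "Phibar_block S t CEta CStar = map_mat teta (F4 S t)"
| "Phibar_block S t CEta CEta = map_mat teta (F1 S t)"
| "Phibar_block S t CEta CEta2 = map_mat teta (F2 S t)"
| "Phibar_block S t CEta2 CId = map_mat teta2 (F4 S t)"
| "Phibar_block S t CEta2 CStar = map_mat teta2 (F3 S t)"
| "Phibar_block S t CEta2 CEta = map_mat teta2 (F2 S t)"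
| "Phibar_block S t CEta2 CEta2 = map_mat teta2 (F1 S t)"

definition Phibar ::
  "('w, 'n::finite, 'r::finite) dropout_system \<Rightarrow> nat \<Rightarrow> tess^(invol \<times> 'n)^(invol \<times> 'n)" where
  "Phibar S t = block_mat (Phibar_block S t)"

text \<open>In the types \<open>1\<close> and \<open>2\<close> the blocks are numbered from 1, so the second element of
  \<open>2\<close> is \<open>2\<close> (which equals \<open>0\<close>).\<close>

definition Phi1 :: "('w, 'n::finite, 'r::finite) dropout_system \<Rightarrow> nat \<Rightarrow> tess^(1 \<times> 'n)^(1 \<times> 'n)"
  where "Phi1 S t = block_mat (\<lambda>a b. F1 S t)"

definition Phi2 :: "('w, 'n::finite, 'r::finite) dropout_system \<Rightarrow> nat \<Rightarrow> tess^(2 \<times> 'n)^(2 \<times> 'n)"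
  where "Phi2 S t = block_mat (\<lambda>a b.
    if a = 1 then (if b = 1 then F1 S t else F2 S t)
    else (if b = 1 then map_mat tcnj (F2 S t) else map_mat tcnj (F1 S t)))"

text \<open>\<open>CId, CStar\<close> are the first and second position in the first half of an augmented vector,
  \<open>CEta, CEta2\<close> those in the second half.\<close>

definition upper_half :: "invol \<Rightarrow> bool" where "upper_half c \<longleftrightarrow> c \<in> {CId, CStar}"
definition half_pos :: "invol \<Rightarrow> 2" where "half_pos c = (if c \<in> {CId, CEta} then 1 else 2)"

definition diag_halves ::
  "tess^(2 \<times> 'n::finite)^(2 \<times> 'n) \<Rightarrow> tess^(2 \<times> 'n)^(2 \<times> 'n) \<Rightarrow> tess^(invol \<times> 'n)^(invol \<times> 'n)" where
  "diag_halves A B = (\<chi> p q.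
     if upper_half (fst p) \<and> upper_half (fst q)
       then A $ (half_pos (fst p), snd p) $ (half_pos (fst q), snd q)
     else if \<not> upper_half (fst p) \<and> \<not> upper_half (fst q)
       then B $ (half_pos (fst p), snd p) $ (half_pos (fst q), snd q)
     else 0)"

definition T1_conditions :: "('w, 'n::finite, 'r::finite) dropout_system \<Rightarrow> bool" where
  "T1_conditions S \<longleftrightarrow>
     T1_proper (pspace S) (\<lambda>_ :: unit. st S 0) \<and>
     T1_proper (pspace S) (un S) \<and>
     (\<forall>i. T1_proper (pspace S) (vn S i)) \<and>
     (\<forall>i. cross_T1_proper (pspace S) (un S) (vn S i)) \<and>
     (\<forall>t. Phibar S t = block_diag (\<lambda>c. map_mat (capp c) (F1 S t))) \<and>
     (\<forall>i j. \<forall>t\<ge>1. pr S i t j PR = pr S i t j PEta \<and> pr S i t j PEta = pr S i t j PEta1 \<and>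
                   pr S i t j PEta1 = pr S i t j PEta2)"

text \<open>With the present conventions $\mathbf z_r + \eta'\mathbf z_{\eta'} =
  \frac12(\mathbf z + \mathbf z^*)$, while $\mathbf z_r + \eta\mathbf z_\eta =
  \frac12(\mathbf z + \mathbf z^\eta)$. So the mean dropout matrix decouples
  $(\mathbf z, \mathbf z^*)$ from $(\mathbf z^\eta, \mathbf z^{\eta''})$ exactly when the Bernoulli
  parameters of the parts $r, \eta'$ agree and those of $\eta, \eta''$ agree. This is the pairing
  used below (and in \<open>Pi2_block\<close>); with the roles of $\eta$ and $\eta'$ interchanged in these two
  places the innovations of the algorithm are in general not orthogonal to the past.\<close>

definition T2_conditions :: "('w, 'n::finite, 'r::finite) dropout_system \<Rightarrow> bool" where
  "T2_conditions S \<longleftrightarrow>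
     T2_proper (pspace S) (\<lambda>_ :: unit. st S 0) \<and>
     T2_proper (pspace S) (un S) \<and>
     (\<forall>i. T2_proper (pspace S) (vn S i)) \<and>
     (\<forall>i. cross_T2_proper (pspace S) (un S) (vn S i)) \<and>
     (\<forall>t. Phibar S t = diag_halves (Phi2 S t) (map_mat teta (Phi2 S t))) \<and>
     (\<forall>i j. \<forall>t\<ge>1. pr S i t j PR = pr S i t j PEta1 \<and> pr S i t j PEta = pr S i t j PEta2)"

section \<open>Second-order quantities of the augmented system\<close>

definition Rvec ::
  "('w, 'n::finite, 'r::finite) dropout_system \<Rightarrow> nat
     \<Rightarrow> tess^('r \<times> invol \<times> 'n)^('r \<times> invol \<times> 'n)" where
  "Rvec S t = block_diag (\<lambda>i. Rbar S i t)"

definition Svec ::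
  "('w, 'n::finite, 'r::finite) dropout_system \<Rightarrow> nat \<Rightarrow> tess^('r \<times> invol \<times> 'n)^(invol \<times> 'n)" where
  "Svec S t = block_row (\<lambda>i. Sbar S i t)"

definition gvec ::
  "('w, 'n::finite, 'r::finite) dropout_system \<Rightarrow> nat \<Rightarrow> 'w \<Rightarrow> real^('r \<times> part \<times> 'n)" where
  "gvec S t \<omega> = (\<chi> a. tpart (fst (snd a)) (gam S (fst a) t \<omega> $ snd (snd a)))"

definition Eg :: "('w, 'n::finite, 'r::finite) dropout_system \<Rightarrow> nat \<Rightarrow> real^('r \<times> part \<times> 'n)" where
  "Eg S t = (\<chi> a. \<integral>\<omega>. gvec S t \<omega> $ a \<partial>pspace S)"

definition Cov_g ::
  "('w, 'n::finite, 'r::finite) dropout_system \<Rightarrow> nat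
     \<Rightarrow> real^('r \<times> part \<times> 'n)^('r \<times> part \<times> 'n)" where
  "Cov_g S t = rGam (pspace S) (\<lambda>\<omega>. gvec S t \<omega> - Eg S t) (\<lambda>\<omega>. gvec S t \<omega> - Eg S t)"

definition Gam_g ::
  "('w, 'n::finite, 'r::finite) dropout_system \<Rightarrow> nat
     \<Rightarrow> real^('r \<times> part \<times> 'n)^('r \<times> part \<times> 'n)" where
  "Gam_g S t = rGam (pspace S) (gvec S t) (gvec S t)"

definition Gam_g1 ::
  "('w, 'n::finite, 'r::finite) dropout_system \<Rightarrow> nat
     \<Rightarrow> real^('r \<times> part \<times> 'n)^('r \<times> part \<times> 'n)" where
  "Gam_g1 S t = rGam (pspace S) (gvec S t) (\<lambda>\<omega>. (\<chi> a. 1) - gvec S t \<omega>)"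

definition Gam_11 ::
  "('w, 'n::finite, 'r::finite) dropout_system \<Rightarrow> nat
     \<Rightarrow> real^('r \<times> part \<times> 'n)^('r \<times> part \<times> 'n)" where
  "Gam_11 S t = rGam (pspace S) (\<lambda>\<omega>. (\<chi> a. 1) - gvec S t \<omega>) (\<lambda>\<omega>. (\<chi> a. 1) - gvec S t \<omega>)"

definition Pibar_g ::
  "('w, 'n::finite, 'r::finite) dropout_system \<Rightarrow> nat
     \<Rightarrow> tess^('r \<times> invol \<times> 'n)^('r \<times> invol \<times> 'n)" where
  "Pibar_g S t = Ups ** diag_mat (Eg S t) ** herm Ups"

definition Pibar_1g ::
  "('w, 'n::finite, 'r::finite) dropout_system \<Rightarrow> nat
     \<Rightarrow> tess^('r \<times> invol \<times> 'n)^('r \<times> invol \<times> 'n)" where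
  "Pibar_1g S t = Ups ** diag_mat ((\<chi> a. 1) - Eg S t) ** herm Ups"

text \<open>\<open>Gx S t\<close>, \<open>Gxy S t\<close> and \<open>Gy S t\<close> are the recursively computed
  $\Gamma_{\bar{\mathbf x}}(t,t)$, $\Gamma_{\bar{\mathbf x}\vec{\mathbf y}}(t,t)$ and
  $\Gamma_{\vec{\mathbf y}}(t,t)$. The last two start at time 1; their values at 0 are dummies.\<close>

primrec Gx ::
  "('w, 'n::finite, 'r::finite) dropout_system \<Rightarrow> nat \<Rightarrow> tess^(invol \<times> 'n)^(invol \<times> 'n)" where
  "Gx S 0 = P0bar S"
| "Gx S (Suc t) = Phibar S t ** Gx S t ** herm (Phibar S t) + Qbar S t"

fun Gxy ::
  "('w, 'n::finite, 'r::finite) dropout_system \<Rightarrow> nat \<Rightarrow> tess^('r \<times> invol \<times> 'n)^(invol \<times> 'n)" where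
  "Gxy S 0 = 0"
| "Gxy S (Suc 0) = Gx S 1 ** transpose ones_kron"
| "Gxy S (Suc (Suc t)) =
     Gx S (Suc (Suc t)) ** transpose ones_kron ** Pibar_g S (Suc (Suc t))
     + (Phibar S (Suc t) ** Gxy S (Suc t) + Svec S (Suc t) ** Pibar_g S (Suc t))
       ** Pibar_1g S (Suc (Suc t))"

definition Psi1 ::
  "('w, 'n::finite, 'r::finite) dropout_system \<Rightarrow> nat
     \<Rightarrow> tess^('r \<times> part \<times> 'n)^('r \<times> part \<times> 'n)" where
  "Psi1 S t = herm Ups ** ones_kron ** Gx S t ** transpose ones_kron ** Ups"

definition Psi2 ::
  "('w, 'n::finite, 'r::finite) dropout_system \<Rightarrow> nat
     \<Rightarrow> tess^('r \<times> part \<times> 'n)^('r \<times> part \<times> 'n)" where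
  "Psi2 S t = herm Ups ** ones_kron
     ** (Phibar S (t - 1) ** Gxy S (t - 1) + Svec S (t - 1) ** Pibar_g S (t - 1)) ** Ups"

fun Gy ::
  "('w, 'n::finite, 'r::finite) dropout_system \<Rightarrow> nat
     \<Rightarrow> tess^('r \<times> invol \<times> 'n)^('r \<times> invol \<times> 'n)" where
  "Gy S 0 = 0"
| "Gy S (Suc 0) = ones_kron ** Gx S 1 ** transpose ones_kron + Rvec S 1"
| "Gy S (Suc (Suc t)) = (let t' = Suc (Suc t) in
     Ups ** (Gam_g S t' \<odot> (Psi1 S t' + herm Ups ** Rvec S t' ** Ups)
             + Gam_g1 S t' \<odot> Psi2 S t'
             + transpose (Gam_g1 S t') \<odot> herm (Psi2 S t')
             + Gam_11 S t' \<odot> (herm Ups ** Gy S (Suc t) ** Ups)) ** herm Ups)"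

definition Psi3 ::
  "('w, 'n::finite, 'r::finite) dropout_system \<Rightarrow> nat
     \<Rightarrow> tess^('r \<times> part \<times> 'n)^('r \<times> part \<times> 'n)" where
  "Psi3 S t = herm Ups ** Gy S (t - 1) ** Ups"

section \<open>The filtering algorithm\<close>

text \<open>The index type \<open>'k\<close> stands for the $k$ leading blocks of an augmented vector: it is
  \<open>1\<close> for $k = 1$ and \<open>2\<close> for $k = 2$. A \<open>reduction\<close> collects the three ingredients of the
  algorithm that depend on $k$: which blocks are kept, $\Phi_k$ and $\Pi_k$.\<close>

record ('k, 'n, 'r) reduction =
  blk :: "'k \<Rightarrow> invol"
  Phik :: "nat \<Rightarrow> tess^('k \<times> 'n)^('k \<times> 'n)"
  Pik :: "nat \<Rightarrow> tess^('r \<times> 'k \<times> 'n)^('r \<times> 'k \<times> 'n)"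

definition Pi1_block ::
  "('w, 'n::finite, 'r::finite) dropout_system \<Rightarrow> 'r \<Rightarrow> nat \<Rightarrow> tess^(1 \<times> 'n)^(1 \<times> 'n)" where
  "Pi1_block S i t = block_mat (\<lambda>a b. diag_mat (\<chi> j. pr S i t j PR))"

definition Pi2_block ::
  "('w, 'n::finite, 'r::finite) dropout_system \<Rightarrow> 'r \<Rightarrow> nat \<Rightarrow> tess^(2 \<times> 'n)^(2 \<times> 'n)" where
  "Pi2_block S i t = (1 / 2) *\<^sub>R block_mat (\<lambda>a b.
     if a = b then diag_mat (\<chi> j. pr S i t j PR + pr S i t j PEta)
     else diag_mat (\<chi> j. pr S i t j PR - pr S i t j PEta))"

definition T1_reduction ::
  "('w, 'n::finite, 'r::finite) dropout_system \<Rightarrow> (1, 'n, 'r) reduction" where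
  "T1_reduction S = \<lparr> blk = (\<lambda>a. CId), Phik = Phi1 S,
                     Pik = (\<lambda>t. block_diag (\<lambda>i. Pi1_block S i t)) \<rparr>"

definition T2_reduction ::
  "('w, 'n::finite, 'r::finite) dropout_system \<Rightarrow> (2, 'n, 'r) reduction" where
  "T2_reduction S = \<lparr> blk = (\<lambda>a. if a = 1 then CId else CStar), Phik = Phi2 S,
                     Pik = (\<lambda>t. block_diag (\<lambda>i. Pi2_block S i t)) \<rparr>"

definition red :: "('k::finite, 'n::finite, 'r::finite) reduction \<Rightarrow> tess^'n \<Rightarrow> tess^('k \<times> 'n)" where
  "red K w = (\<chi> a. capp (blk K (fst a)) (w $ snd a))"

definition yk ::
  "('k::finite, 'n::finite, 'r::finite) reduction \<Rightarrow> ('w, 'n, 'r) dropout_system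
     \<Rightarrow> nat \<Rightarrow> 'w \<Rightarrow> tess^('r \<times> 'k \<times> 'n)" where
  "yk K S t \<omega> = (\<chi> a. red K (ym S (fst a) t \<omega>) $ snd a)"

definition Qk ::
  "('k::finite, 'n::finite, 'r::finite) reduction \<Rightarrow> ('w, 'n, 'r) dropout_system
     \<Rightarrow> nat \<Rightarrow> tess^('k \<times> 'n)^('k \<times> 'n)" where
  "Qk K S t = Gam (pspace S) (\<lambda>\<omega>. red K (un S t \<omega>)) (\<lambda>\<omega>. red K (un S t \<omega>))"

definition Sk ::
  "('k::finite, 'n::finite, 'r::finite) reduction \<Rightarrow> ('w, 'n, 'r) dropout_system
     \<Rightarrow> nat \<Rightarrow> tess^('r \<times> 'k \<times> 'n)^('k \<times> 'n)" where
  "Sk K S t =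
     block_row (\<lambda>i. Gam (pspace S) (\<lambda>\<omega>. red K (un S t \<omega>)) (\<lambda>\<omega>. red K (vn S i t \<omega>)))"

definition P0k ::
  "('k::finite, 'n::finite, 'r::finite) reduction \<Rightarrow> ('w, 'n, 'r) dropout_system
     \<Rightarrow> tess^('k \<times> 'n)^('k \<times> 'n)" where
  "P0k K S = Gam (pspace S) (\<lambda>\<omega>. red K (st S 0 \<omega>)) (\<lambda>\<omega>. red K (st S 0 \<omega>))"

text \<open>\<open>leading K\<close> is $[\mathbf I_{kn}, \mathbf 0_{kn\times(4-k)n}]$ and \<open>first_block K\<close> is
  $[\mathbf I_n, \mathbf 0_{n\times(k-1)n}]$ (for $k = 1$ the identity, up to the
  one-element factor of the column index).\<close>

definition leading ::
  "('k::finite, 'n::finite, 'r::finite) reduction \<Rightarrow> tess^(invol \<times> 'n)^('k \<times> 'n)" where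
  "leading K = (\<chi> a b. if (blk K (fst a), snd a) = b then 1 else 0)"

definition first_block ::
  "('k::finite, 'n::finite, 'r::finite) reduction \<Rightarrow> tess^('k \<times> 'n)^'n" where
  "first_block K = (\<chi> i b. if blk K (fst b) = CId \<and> snd b = i then 1 else 0)"

definition Dk ::
  "('k::finite, 'n::finite, 'r::finite) reduction \<Rightarrow> ('w, 'n, 'r) dropout_system
     \<Rightarrow> tess^('k \<times> 'n)^('k \<times> 'n)" where
  "Dk K S = leading K ** Gx S 1 ** transpose (leading K)"

definition Upsk ::
  "('k::finite, 'n::finite, 'r::finite) reduction
     \<Rightarrow> tess^('r \<times> part \<times> 'n)^('r \<times> 'k \<times> 'n)" where
  "Upsk K = kron (mat 1) (kron ((1 / 2) *\<^sub>R (\<chi> a. calA $ blk K a)) (mat 1))"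

text \<open>The functions with suffix \<open>_of\<close> take the one-step prediction $\mathbf P_k(t|t-1)$, or
  $\hat{\mathbf x}_k(t|t-1)$, as their last argument; this unties the recursion.\<close>

definition Theta_of ::
  "('k::finite, 'n::finite, 'r::finite) reduction \<Rightarrow> ('w, 'n, 'r) dropout_system \<Rightarrow> nat
     \<Rightarrow> tess^('k \<times> 'n)^('k \<times> 'n) \<Rightarrow> tess^('r \<times> 'k \<times> 'n)^('k \<times> 'n)" where
  "Theta_of K S t P =
     (if t = 1 then block_row (\<lambda>i. Dk K S) else P ** transpose ones_kron ** Pik K t)"

definition Omega_of ::
  "('k::finite, 'n::finite, 'r::finite) reduction \<Rightarrow> ('w, 'n, 'r) dropout_system \<Rightarrow> nat
     \<Rightarrow> tess^('k \<times> 'n)^('k \<times> 'n) \<Rightarrow> tess^('r \<times> 'k \<times> 'n)^('r \<times> 'k \<times> 'n)" where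
  "Omega_of K S t P =
     (if t = 1 then 0
      else Upsk K ** (Cov_g S t \<odot> (Psi1 S t - Psi2 S t - herm (Psi2 S t) + Psi3 S t))
             ** herm (Upsk K))
     + Upsk K ** (Gam_g S t \<odot> (herm Ups ** Rvec S t ** Ups)) ** herm (Upsk K)
     + Pik K t ** ones_kron ** P ** transpose ones_kron ** Pik K t"

definition Hgain_of ::
  "('k::finite, 'n::finite, 'r::finite) reduction \<Rightarrow> ('w, 'n, 'r) dropout_system \<Rightarrow> nat
     \<Rightarrow> tess^('k \<times> 'n)^('k \<times> 'n) \<Rightarrow> tess^('r \<times> 'k \<times> 'n)^('k \<times> 'n)" where
  "Hgain_of K S t P = Sk K S t ** Pik K t ** matrix_inv (Omega_of K S t P)"

definition Pfilt_of ::
  "('k::finite, 'n::finite, 'r::finite) reduction \<Rightarrow> ('w, 'n, 'r) dropout_system \<Rightarrow> nat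
     \<Rightarrow> tess^('k \<times> 'n)^('k \<times> 'n) \<Rightarrow> tess^('k \<times> 'n)^('k \<times> 'n)" where
  "Pfilt_of K S t P =
     P - Theta_of K S t P ** matrix_inv (Omega_of K S t P) ** herm (Theta_of K S t P)"

text \<open>\<open>Ppred K S t\<close> is $\mathbf P_k(t|t-1)$, for $t \ge 1$ (the value at 0 is a dummy), and
  \<open>Pfilt K S t\<close> is $\mathbf P_k(t|t)$.\<close>

fun Ppred ::
  "('k::finite, 'n::finite, 'r::finite) reduction \<Rightarrow> ('w, 'n, 'r) dropout_system \<Rightarrow> nat
     \<Rightarrow> tess^('k \<times> 'n)^('k \<times> 'n)" where
  "Ppred K S 0 = 0"
| "Ppred K S (Suc 0) = Dk K S"
| "Ppred K S (Suc (Suc s)) =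
     (let t = Suc s; P = Ppred K S t; Th = Theta_of K S t P; Om = Omega_of K S t P;
          H = Hgain_of K S t P; Phi = Phik K t
      in Phi ** Pfilt_of K S t P ** herm Phi - Phi ** Th ** herm H - H ** herm Th ** herm Phi
         - H ** Om ** herm H + Qk K S t)"

definition Omega ::
  "('k::finite, 'n::finite, 'r::finite) reduction \<Rightarrow> ('w, 'n, 'r) dropout_system \<Rightarrow> nat
     \<Rightarrow> tess^('r \<times> 'k \<times> 'n)^('r \<times> 'k \<times> 'n)" where
  "Omega K S t = Omega_of K S t (Ppred K S t)"

definition Theta ::
  "('k::finite, 'n::finite, 'r::finite) reduction \<Rightarrow> ('w, 'n, 'r) dropout_system \<Rightarrow> nat
     \<Rightarrow> tess^('r \<times> 'k \<times> 'n)^('k \<times> 'n)" where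
  "Theta K S t = Theta_of K S t (Ppred K S t)"

definition Hgain ::
  "('k::finite, 'n::finite, 'r::finite) reduction \<Rightarrow> ('w, 'n, 'r) dropout_system \<Rightarrow> nat
     \<Rightarrow> tess^('r \<times> 'k \<times> 'n)^('k \<times> 'n)" where
  "Hgain K S t = Hgain_of K S t (Ppred K S t)"

definition Lgain ::
  "('k::finite, 'n::finite, 'r::finite) reduction \<Rightarrow> ('w, 'n, 'r) dropout_system \<Rightarrow> nat
     \<Rightarrow> tess^('r \<times> 'k \<times> 'n)^('k \<times> 'n)" where
  "Lgain K S t = Theta K S t ** matrix_inv (Omega K S t)"

definition Pfilt ::
  "('k::finite, 'n::finite, 'r::finite) reduction \<Rightarrow> ('w, 'n, 'r) dropout_system \<Rightarrow> nat
     \<Rightarrow> tess^('k \<times> 'n)^('k \<times> 'n)" where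
  "Pfilt K S t = (if t = 0 then P0k K S else Pfilt_of K S t (Ppred K S t))"

definition innov_of ::
  "('k::finite, 'n::finite, 'r::finite) reduction \<Rightarrow> ('w, 'n, 'r) dropout_system \<Rightarrow> nat \<Rightarrow> 'w
     \<Rightarrow> tess^('k \<times> 'n) \<Rightarrow> tess^('r \<times> 'k \<times> 'n)" where
  "innov_of K S t \<omega> xp =
     (if t = 1 then yk K S 1 \<omega>
      else yk K S t \<omega> - Pik K t *v (ones_kron *v xp) - (mat 1 - Pik K t) *v yk K S (t - 1) \<omega>)"

text \<open>\<open>xpred K S t\<close> is $\hat{\mathbf x}_k(t|t-1)$, for $t \ge 1$ (the value at 0 is a dummy),
  and \<open>xfilt K S t\<close> is $\hat{\mathbf x}_k(t|t)$.\<close>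

fun xpred ::
  "('k::finite, 'n::finite, 'r::finite) reduction \<Rightarrow> ('w, 'n, 'r) dropout_system \<Rightarrow> nat
     \<Rightarrow> 'w \<Rightarrow> tess^('k \<times> 'n)" where
  "xpred K S 0 \<omega> = 0"
| "xpred K S (Suc 0) \<omega> = 0"
| "xpred K S (Suc (Suc s)) \<omega> =
     (let t = Suc s; xp = xpred K S t \<omega>; eps = innov_of K S t \<omega> xp
      in Phik K t *v (xp + Lgain K S t *v eps) + Hgain K S t *v eps)"

definition innov ::
  "('k::finite, 'n::finite, 'r::finite) reduction \<Rightarrow> ('w, 'n, 'r) dropout_system \<Rightarrow> nat
     \<Rightarrow> 'w \<Rightarrow> tess^('r \<times> 'k \<times> 'n)" where
  "innov K S t \<omega> = innov_of K S t \<omega> (xpred K S t \<omega>)"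

definition xfilt ::
  "('k::finite, 'n::finite, 'r::finite) reduction \<Rightarrow> ('w, 'n, 'r) dropout_system \<Rightarrow> nat
     \<Rightarrow> 'w \<Rightarrow> tess^('k \<times> 'n)" where
  "xfilt K S t \<omega> = (if t = 0 then 0 else xpred K S t \<omega> + Lgain K S t *v innov K S t \<omega>)"

end

theory Submission
  imports Defs
begin

text \<open>
  \<open>Gam M X Y\<close>, that is $E[XY^H]$, serves as an inner product with matrix values: it is additive,
  satisfies \<open>Gam (A X) Y = A ** Gam X Y\<close> and \<open>Gam Y X = herm (Gam X Y)\<close>, and \<open>Gam X X = 0\<close> forces
  \<open>X = 0\<close> almost surely, because the real part of $x x^*$ is the sum of the squares of the four
  components of $x$. These properties replace a projection theorem, which would have to cope with the
  zero divisors among the tessarines: orthogonality of the computed filter error is verified by matrix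
  algebra, and a vector that is both a combination of the observations and orthogonal to them
  vanishes, so that the LLMS estimator is unique.

  The dropouts enter through one identity. The matrix \<open>Ups\<close> is unitary, and \<open>herm Ups\<close> turns an
  augmented vector into twice its vector of real components, on which \<open>\<star>\<close> acts as a
  real diagonal matrix. Hence
  $y_t = y_{t-1} + \Upsilon\,(\gamma_t \circ \Upsilon^H (z_t - y_{t-1}))$ (\<open>yvec_eq\<close>), where
  $\gamma_t$ is independent of the sigma-algebra \<open>past t\<close> generated by all noises, the initial state
  and the earlier $\gamma_s$, and $z_t$ and $y_{t-1}$ are measurable with respect to it
  (\<open>indep_now_past\<close>). An independent diagonal factor leaves
  correlations through its mean, two of them through a Hadamard product with their second moments
  (\<open>Gam_hvec_left\<close>, \<open>Gam_hvec_hvec\<close>). This gives the recursions for $\Gamma_{\bar x\vec y}$ and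
  $\Gamma_{\vec y}$ (\<open>Gam_x_y\<close>, \<open>Gam_y_y\<close>).

  The reduction to the first $k$ blocks needs two commutation rules: the rows of $\bar\Phi$ and
  of the mean dropout matrix $\bar\Pi^{\vec\gamma}$ that belong to these blocks have no entries in
  the other columns, and their remaining entries are $\Phi_k$ and $\Pi_k$. They are the
  assumptions of the locale \<open>reduced_system\<close>; both sets of
  properness conditions imply them (\<open>T1_reduced\<close>, \<open>T2_reduced\<close>). The second rule
  splits the innovation as
  $\epsilon = \Upsilon_k((\gamma - E\gamma)\circ\Upsilon^H(z_t - y_{t-1}))
     + \Pi_k(\mathcal C_k e + v_k)$,
  with $e$ the prediction error (\<open>innov_split\<close>). The first summand is orthogonal to everything
  measurable with respect to \<open>past t\<close>, so $\epsilon$ is orthogonal to the earlier observations and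
  its correlations with itself, with $e$ and with $u_k$ are $\Omega_k$, $\Theta_k$ and $S_k\Pi_k$.
  An induction on $t$ (\<open>predictor_inv\<close>) then shows that the predictor is a combination of the
  earlier observations, that its error is orthogonal to them, and that \<open>Ppred\<close> is the
  correlation matrix of this error.
\<close>

section \<open>Tessarine algebra\<close>

lemma tess_sel [simp]:
  "tr 0 = 0" "te 0 = 0" "te1 0 = 0" "te2 0 = 0"
  "tr 1 = 1" "te 1 = 0" "te1 1 = 0" "te2 1 = 0"
  "tr (x + y) = tr x + tr y" "te (x + y) = te x + te y"
  "te1 (x + y) = te1 x + te1 y" "te2 (x + y) = te2 x + te2 y"
  "tr (x - y) = tr x - tr y" "te (x - y) = te x - te y"
  "te1 (x - y) = te1 x - te1 y" "te2 (x - y) = te2 x - te2 y"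
  "tr (- x) = - tr x" "te (- x) = - te x" "te1 (- x) = - te1 x" "te2 (- x) = - te2 x"
  "tr (r *\<^sub>R x) = r * tr x" "te (r *\<^sub>R x) = r * te x"
  "te1 (r *\<^sub>R x) = r * te1 x" "te2 (r *\<^sub>R x) = r * te2 x"
  "tr (of_real r) = r" "te (of_real r) = 0" "te1 (of_real r) = 0" "te2 (of_real r) = 0"
  by (simp_all add: zero_tess_def one_tess_def plus_tess_def minus_tess_def uminus_tess_def
      scaleR_tess_def of_real_def)

lemma tess_sel_numeral [simp]:
  "tr (numeral w) = numeral w" "te (numeral w) = 0" "te1 (numeral w) = 0" "te2 (numeral w) = 0"
  using tess_sel(25-28)[of "numeral w"] unfolding of_real_numeral by blast+

lemma tess_sel_mult:
  "tr (x * y) = tr x * tr y - te x * te y + te1 x * te1 y - te2 x * te2 y"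
  "te (x * y) = tr x * te y + te x * tr y + te1 x * te2 y + te2 x * te1 y"
  "te1 (x * y) = tr x * te1 y + te1 x * tr y - te x * te2 y - te2 x * te y"
  "te2 (x * y) = tr x * te2 y + te2 x * tr y + te x * te1 y + te1 x * te y"
  by (simp_all add: times_tess_def)

lemma tess_sel_unit [simp]:
  "tr eta = 0" "te eta = 1" "te1 eta = 0" "te2 eta = 0"
  "tr eta1 = 0" "te eta1 = 0" "te1 eta1 = 1" "te2 eta1 = 0"
  "tr eta2 = 0" "te eta2 = 0" "te1 eta2 = 0" "te2 eta2 = 1"
  by (simp_all add: eta_def eta1_def eta2_def)

lemma tess_eq_iff: "x = y \<longleftrightarrow> tr x = tr y \<and> te x = te y \<and> te1 x = te1 y \<and> te2 x = te2 y"
  by (auto intro: tess.expand)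

lemma tess_eqI: "(\<And>\<nu>. tpart \<nu> x = tpart \<nu> y) \<Longrightarrow> x = y"
  by (metis tess_eq_iff tpart.simps)

lemma tpart_linear [simp]:
  "tpart \<nu> 0 = 0" "tpart \<nu> (x + y) = tpart \<nu> x + tpart \<nu> y"
  "tpart \<nu> (x - y) = tpart \<nu> x - tpart \<nu> y" "tpart \<nu> (r *\<^sub>R x) = r * tpart \<nu> x"
  by (cases \<nu>; simp)+

lemma tpart_sum: "tpart \<nu> (sum f A) = (\<Sum>a\<in>A. tpart \<nu> (f a))"
  by (induction A rule: infinite_finite_induct) auto

lemma UNIV_part: "(UNIV :: part set) = {PR, PEta, PEta1, PEta2}"
  using part.exhaust by blast

lemma UNIV_invol: "(UNIV :: invol set) = {CId, CStar, CEta, CEta2}"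
  using invol.exhaust by blast

lemma tcnj_sel [simp]:
  "tr (tcnj x) = tr x" "te (tcnj x) = - te x" "te1 (tcnj x) = te1 x" "te2 (tcnj x) = - te2 x"
  by (simp_all add: tcnj_def)

lemma tcnj_hom [simp]:
  "tcnj 0 = 0" "tcnj 1 = 1" "tcnj (tcnj x) = x" "tcnj (x + y) = tcnj x + tcnj y"
  "tcnj (x - y) = tcnj x - tcnj y" "tcnj (- x) = - tcnj x" "tcnj (x * y) = tcnj x * tcnj y"
  "tcnj (r *\<^sub>R x) = r *\<^sub>R tcnj x" "tcnj (of_real r) = of_real r"
  by (simp_all add: tess_eq_iff tess_sel_mult)

lemma tcnj_sum: "tcnj (sum f A) = (\<Sum>a\<in>A. tcnj (f a))"
  by (induction A rule: infinite_finite_induct) auto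

lemma capp_hom [simp]:
  "capp c 0 = 0" "capp c (x + y) = capp c x + capp c y" "capp c (x - y) = capp c x - capp c y"
  "capp c (x * y) = capp c x * capp c y"
  by (cases c; simp add: tess_eq_iff tess_sel_mult teta_def teta2_def)+

lemma capp_sum: "capp c (sum f A) = (\<Sum>a\<in>A. capp c (f a))"
  by (induction A rule: infinite_finite_induct) auto

lemma capp_invol_group [simp]:
  "tcnj (teta x) = teta2 x" "tcnj (teta2 x) = teta x" "teta (tcnj x) = teta2 x"
  "teta (teta x) = x" "teta (teta2 x) = tcnj x" "teta2 (tcnj x) = teta x"
  "teta2 (teta x) = tcnj x" "teta2 (teta2 x) = x"
  by (simp_all add: tess_eq_iff teta_def teta2_def)

section \<open>Matrix algebra\<close>

lemma matrix_distrib: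
  fixes A B :: "'a::comm_ring_1^'n^'m"
  shows "(A + B) ** C = A ** C + B ** C" "(A - B) ** C = A ** C - B ** C"
    "D ** (A + B) = D ** A + D ** B" "D ** (A - B) = D ** A - D ** B"
    "(- A) ** C = - (A ** C)" "D ** (- A) = - (D ** A)"
    "0 ** C = (0 :: 'a^'q^'m)" "D ** 0 = (0 :: 'a^'n^'p)"
  by (simp_all add: matrix_matrix_mult_def vec_eq_iff algebra_simps sum.distrib sum_subtractf
      sum_negf)

lemma matrix_vector_distrib:
  fixes A B :: "'a::comm_ring_1^'n^'m"
  shows "(A + B) *v x = A *v x + B *v x" "(A - B) *v x = A *v x - B *v x"
    "A *v (x + y) = A *v x + A *v y" "A *v (x - y) = A *v x - A *v y"
    "A *v 0 = 0" "0 *v x = (0 :: 'a^'m)"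
  by (simp_all add: matrix_vector_mult_def vec_eq_iff algebra_simps sum.distrib sum_subtractf)

lemma matrix_vector_sum: "(D :: tess^'p^'q) *v (\<Sum>s\<in>I. f s) = (\<Sum>s\<in>I. D *v f s)"
  by (induction I rule: infinite_finite_induct) (simp_all add: matrix_vector_distrib)

lemma matrix_inv_mult:
  fixes A :: "'a::comm_ring_1^'n^'n"
  assumes "invertible A"
  shows "A ** matrix_inv A = mat 1" "matrix_inv A ** A = mat 1"
proof -
  have "A ** matrix_inv A = mat 1 \<and> matrix_inv A ** A = mat 1"
    unfolding matrix_inv_def using assms unfolding invertible_def by (rule someI_ex)
  then show "A ** matrix_inv A = mat 1" "matrix_inv A ** A = mat 1" by auto
qed

lemma herm_nth: "herm A $ i $ j = tcnj (A $ j $ i)"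
  by (simp add: herm_def transpose_def map_mat_def)

lemma herm_hom [simp]:
  "herm (herm A) = A" "herm (A + B) = herm A + herm B" "herm (A - B) = herm A - herm B"
  "herm 0 = 0" "herm (mat 1) = mat 1"
  by (simp_all add: vec_eq_iff herm_nth mat_def)

lemma herm_minus: "herm (- A) = - herm A"
  by (simp add: vec_eq_iff herm_nth)

lemma herm_mult: "herm (A ** B) = herm B ** herm A"
  by (simp add: vec_eq_iff herm_nth matrix_matrix_mult_def tcnj_sum mult.commute)

lemma herm_diag_mat [simp]: "herm (diag_mat v) = diag_mat v"
  by (simp add: vec_eq_iff herm_nth diag_mat_def)

lemma herm_ones_kron [simp]: "herm ones_kron = transpose ones_kron"
  by (simp add: vec_eq_iff herm_nth ones_kron_def transpose_def)

lemma sum_UNIV_prod: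
  "(\<Sum>k\<in>(UNIV :: ('a::finite \<times> 'b::finite) set). f k) = (\<Sum>a\<in>UNIV. \<Sum>b\<in>UNIV. f (a, b))"
  unfolding UNIV_Times_UNIV[symmetric] by (simp add: sum.cartesian_product)

lemma kron_mult: "kron A B ** kron C D = kron (A ** C) (B ** D)"
  by (simp add: vec_eq_iff kron_def matrix_matrix_mult_def sum_UNIV_prod sum_product mult_ac)

lemma herm_kron: "herm (kron A B) = kron (herm A) (herm B)"
  by (simp add: vec_eq_iff kron_def herm_nth)

lemma kron_mat_1 [simp]: "kron (mat 1) (mat 1) = mat 1"
  by (auto simp: vec_eq_iff kron_def mat_def)

lemma kron_mat_1_vec: "(kron (mat 1) B *v v) $ (i, p) = (B *v (\<chi> q. v $ (i, q))) $ p"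
proof -
  have "(\<Sum>a\<in>UNIV. \<Sum>b\<in>UNIV. mat 1 $ i $ a * B $ p $ b * v $ (a, b))
      = (\<Sum>b\<in>UNIV. \<Sum>a\<in>UNIV. if i = a then B $ p $ b * v $ (a, b) else 0)"
    by (subst sum.swap) (intro sum.cong refl, simp add: mat_def)
  then show ?thesis by (simp add: matrix_vector_mult_def kron_def sum_UNIV_prod)
qed

lemma kron_mat_1_right_vec: "(kron B (mat 1) *v v) $ (p, j) = (\<Sum>q\<in>UNIV. B $ p $ q * v $ (q, j))"
proof -
  have "(\<Sum>a\<in>UNIV. \<Sum>b\<in>UNIV. B $ p $ a * mat 1 $ j $ b * v $ (a, b))
      = (\<Sum>a\<in>UNIV. \<Sum>b\<in>UNIV. if j = b then B $ p $ a * v $ (a, b) else 0)"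
    by (intro sum.cong refl) (simp add: mat_def)
  then show ?thesis by (simp add: matrix_vector_mult_def kron_def sum_UNIV_prod)
qed

lemma ones_kron_vec: "(ones_kron *v x) $ (i, p) = x $ p"
  by (simp add: matrix_vector_mult_def ones_kron_def if_distrib [of "\<lambda>c. c * _"] cong: if_cong)

lemma matrix_eq_vecI:
  fixes A B :: "'a::semiring_1^'n^'m"
  shows "(\<And>x p. (A *v x) $ p = (B *v x) $ p) \<Longrightarrow> A = B"
  by (simp add: matrix_eq vec_eq_iff)

lemma diag_mat_mult_nth: "(diag_mat v ** A) $ i $ j = (v $ i) *\<^sub>R A $ i $ j"
  by (simp add: diag_mat_def matrix_matrix_mult_def scaleR_conv_of_real
      if_distrib [of "\<lambda>c. c * _"] cong: if_cong)

lemma diag_mat_ones: "diag_mat (\<chi> a. 1) = mat 1"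
  and diag_mat_diff: "diag_mat (v - w) = diag_mat v - diag_mat w"
  by (auto simp: diag_mat_def mat_def vec_eq_iff)

lemma hadamard_linear:
  "A \<odot> (B + C) = A \<odot> B + A \<odot> C" "A \<odot> (B - C) = A \<odot> B - A \<odot> C" "0 \<odot> B = 0"
  by (simp_all add: hadamard_def vec_eq_iff algebra_simps)

text \<open>Applying the same matrix at every sensor commutes with copying a vector to all sensors. This moves
  the selection of the leading blocks past $\mathcal C$, and turns it into $\mathcal C_k$.\<close>

lemma kron_mat_1_ones_kron: "kron (mat 1) B ** ones_kron = ones_kron ** B"
proof (rule matrix_eq_vecI)
  fix x p
  show "((kron (mat 1) B ** ones_kron) *v x) $ p = ((ones_kron ** B) *v x) $ p"
    by (cases p) (simp add: kron_mat_1_vec ones_kron_vec flip: matrix_vector_mul_assoc)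
qed

section \<open>Passing between augmented vectors and real components\<close>

text \<open>The columns of $\mathcal A$ are the values of the four conjugations on the basis
  $1,\eta,\eta',\eta''$.\<close>

lemma capp_expand: "capp c x = (\<Sum>\<nu>\<in>UNIV. calA_entry c \<nu> * of_real (tpart \<nu> x))"
  by (cases c) (simp_all add: UNIV_part tess_eq_iff tess_sel_mult teta_def teta2_def)

text \<open>Inversion of the previous expansion: up to the basis element of each column, $\mathcal A$ is the
  character table of the Klein four-group, so summing against a column isolates one component.\<close>

lemma tpart_expand: "(\<Sum>c\<in>UNIV. tcnj (calA_entry c \<nu>) * capp c x) = of_real (4 * tpart \<nu> x)"
  by (cases \<nu>) (simp_all add: UNIV_invol tess_eq_iff tess_sel_mult teta_def teta2_def)

lemma calA_unitary:
  "((1/2) *\<^sub>R calA) ** herm ((1/2) *\<^sub>R calA) = mat 1"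
  "herm ((1/2) *\<^sub>R calA) ** ((1/2) *\<^sub>R calA) = mat 1"
proof -
  show "((1/2) *\<^sub>R calA) ** herm ((1/2) *\<^sub>R calA) = mat 1"
    unfolding vec_eq_iff
  proof safe
    fix c d
    show "(((1/2) *\<^sub>R calA) ** herm ((1/2) *\<^sub>R calA)) $ c $ d = mat 1 $ c $ d"
      by (cases c; cases d)
        (simp_all add: matrix_matrix_mult_def herm_nth calA_def UNIV_part mat_def
          tess_eq_iff tess_sel_mult)
  qed
  show "herm ((1/2) *\<^sub>R calA) ** ((1/2) *\<^sub>R calA) = mat 1"
    unfolding vec_eq_iff
  proof safe
    fix c d
    show "(herm ((1/2) *\<^sub>R calA) ** ((1/2) *\<^sub>R calA)) $ c $ d = mat 1 $ c $ d"
      by (cases c; cases d)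
        (simp_all add: matrix_matrix_mult_def herm_nth calA_def UNIV_invol mat_def
          tess_eq_iff tess_sel_mult)
  qed
qed

lemma Ups_unitary: "Ups ** herm Ups = mat 1" "herm Ups ** Ups = mat 1"
  by (simp_all add: Ups_def calT_def herm_kron kron_mult calA_unitary)

definition stack :: "('r::finite \<Rightarrow> 'a^'p::finite) \<Rightarrow> 'a^('r \<times> 'p)" where
  "stack f = (\<chi> q. f (fst q) $ snd q)"

text \<open>The Hadamard product with a real vector, kept apart from \<open>diag_mat h *v w\<close> because \<open>h\<close>
  will be random.\<close>

definition hvec :: "real^'p \<Rightarrow> tess^'p \<Rightarrow> tess^'p" where
  "hvec h w = (\<chi> a. h $ a *\<^sub>R w $ a)"

lemma Ups_vec: "(Ups *v w) $ (i, c, j) = (1/2) *\<^sub>R (\<Sum>\<nu>\<in>UNIV. calA_entry c \<nu> * w $ (i, \<nu>, j))"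
  by (simp add: Ups_def calT_def kron_mat_1_vec kron_mat_1_right_vec calA_def scaleR_sum_right)

lemma herm_Ups_vec:
  "(herm Ups *v w) $ (i, \<nu>, j) = (1/2) *\<^sub>R (\<Sum>c\<in>UNIV. tcnj (calA_entry c \<nu>) * w $ (i, c, j))"
  by (simp add: Ups_def calT_def kron_mat_1_vec kron_mat_1_right_vec calA_def scaleR_sum_right
      herm_kron herm_nth)

lemma herm_Ups_aug:
  "(herm Ups *v stack (\<lambda>i. aug (z i))) $ (i, \<nu>, j) = of_real (2 * tpart \<nu> (z i $ j))"
  by (simp add: herm_Ups_vec stack_def aug_def tpart_expand tess_eq_iff tess_sel_mult)

text \<open>The componentwise product is a real diagonal matrix in the coordinates given by \<open>Ups\<close>: the factor
  2 that \<open>herm Ups\<close> leaves in front of the real components cancels the $\frac12$ in \<open>Ups\<close>.\<close>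

lemma Ups_hvec_aug:
  "Ups *v hvec (\<chi> a. tpart (fst (snd a)) (g (fst a) $ snd (snd a)))
            (herm Ups *v stack (\<lambda>i. aug (z i)))
   = stack (\<lambda>i. aug (\<chi> j. tstar (g i $ j) (z i $ j)))"
proof -
  have *: "tpart \<nu> (tstar x y) = tpart \<nu> x * tpart \<nu> y" for \<nu> x y
    by (cases \<nu>) (simp_all add: tstar_def)
  have "(Ups *v hvec (\<chi> a. tpart (fst (snd a)) (g (fst a) $ snd (snd a)))
            (herm Ups *v stack (\<lambda>i. aug (z i)))) $ (i, c, j)
      = stack (\<lambda>i. aug (\<chi> j. tstar (g i $ j) (z i $ j))) $ (i, c, j)" for i c j
  proof -
    have "(1/2) *\<^sub>R (a * (r *\<^sub>R of_real (2 * q))) = a * of_real (r * q)" for a :: tess and r q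
      by (simp add: tess_eq_iff tess_sel_mult)
    then show ?thesis
      by (simp only: Ups_vec hvec_def vec_lambda_beta herm_Ups_aug fst_conv snd_conv
            scaleR_sum_right)
        (simp only: stack_def aug_def vec_lambda_beta fst_conv snd_conv
            capp_expand[of c "tstar _ _"] *)
  qed
  then show ?thesis by (simp add: vec_eq_iff)
qed

lemma hvec_diag: "hvec h w = diag_mat h *v w"
  by (simp add: vec_eq_iff hvec_def diag_mat_def matrix_vector_mult_def scaleR_conv_of_real
      if_distrib [of "\<lambda>c. c * _"] cong: if_cong)

lemma hvec_linear: "hvec h (w + w') = hvec h w + hvec h w'" "hvec h (w - w') = hvec h w - hvec h w'"
  "hvec (h + h') w = hvec h w + hvec h' w" "hvec (h - h') w = hvec h w - hvec h' w"
  "hvec (\<chi> a. 1) w = w"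
  by (simp_all add: vec_eq_iff hvec_def algebra_simps)

section \<open>Square-integrable vectors and their correlations\<close>

lemma integrable_mult_square_integrable:
  fixes f g :: "'w \<Rightarrow> real"
  assumes [measurable]: "f \<in> borel_measurable M" "g \<in> borel_measurable M"
    and "integrable M (\<lambda>\<omega>. (f \<omega>)\<^sup>2)" "integrable M (\<lambda>\<omega>. (g \<omega>)\<^sup>2)"
  shows "integrable M (\<lambda>\<omega>. f \<omega> * g \<omega>)"
proof (rule Bochner_Integration.integrable_bound)
  show "integrable M (\<lambda>\<omega>. (f \<omega>)\<^sup>2 + (g \<omega>)\<^sup>2)" using assms by simp
  show "AE \<omega> in M. norm (f \<omega> * g \<omega>) \<le> norm ((f \<omega>)\<^sup>2 + (g \<omega>)\<^sup>2)"
  proof (rule AE_I2)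
    fix \<omega>
    have "2 * \<bar>f \<omega>\<bar> * \<bar>g \<omega>\<bar> \<le> (f \<omega>)\<^sup>2 + (g \<omega>)\<^sup>2"
      using sum_squares_bound[of "\<bar>f \<omega>\<bar>" "\<bar>g \<omega>\<bar>"] by simp
    moreover have "0 \<le> \<bar>f \<omega>\<bar> * \<bar>g \<omega>\<bar>" by simp
    ultimately have "\<bar>f \<omega>\<bar> * \<bar>g \<omega>\<bar> \<le> (f \<omega>)\<^sup>2 + (g \<omega>)\<^sup>2" by linarith
    then show "norm (f \<omega> * g \<omega>) \<le> norm ((f \<omega>)\<^sup>2 + (g \<omega>)\<^sup>2)"
      by (simp add: abs_mult)
  qed
qed measurable

definition tess_integrable :: "'w measure \<Rightarrow> ('w \<Rightarrow> tess) \<Rightarrow> bool" where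
  "tess_integrable M X \<longleftrightarrow> (\<forall>\<nu>. integrable M (\<lambda>\<omega>. tpart \<nu> (X \<omega>)))"

definition tess_L2 :: "'w measure \<Rightarrow> ('w \<Rightarrow> tess) \<Rightarrow> bool" where
  "tess_L2 M X \<longleftrightarrow> (\<forall>\<nu>. (\<lambda>\<omega>. tpart \<nu> (X \<omega>)) \<in> borel_measurable M \<and>
      integrable M (\<lambda>\<omega>. (tpart \<nu> (X \<omega>))\<^sup>2))"

definition meas_vec :: "'w measure \<Rightarrow> ('w \<Rightarrow> tess^'n) \<Rightarrow> bool" where
  "meas_vec N X \<longleftrightarrow> (\<forall>j \<nu>. (\<lambda>\<omega>. tpart \<nu> (X \<omega> $ j)) \<in> borel_measurable N)"

lemma square_integrable_vec_iff: "square_integrable_vec M X \<longleftrightarrow> (\<forall>j. tess_L2 M (\<lambda>\<omega>. X \<omega> $ j))"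
  by (simp add: square_integrable_vec_def tess_L2_def)

lemma all_part: "(\<forall>\<nu>. P \<nu>) \<longleftrightarrow> P PR \<and> P PEta \<and> P PEta1 \<and> P PEta2"
  by (metis part.exhaust)

lemma texp_part: "tpart \<nu> (texp M X) = (\<integral>\<omega>. tpart \<nu> (X \<omega>) \<partial>M)"
  by (cases \<nu>) (simp_all add: texp_def)

lemma texp_zero [simp]: "texp M (\<lambda>\<omega>. 0) = 0"
  by (simp add: texp_def zero_tess_def)

lemma tess_integrable_cmult:
  "tess_integrable M X \<Longrightarrow> tess_integrable M (\<lambda>\<omega>. c * X \<omega>)"
  by (simp add: tess_integrable_def all_part tess_sel_mult)

lemma texp_cmult:
  "tess_integrable M X \<Longrightarrow> texp M (\<lambda>\<omega>. c * X \<omega>) = c * texp M X"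
  by (simp add: tess_integrable_def all_part tess_sel_mult tess_eq_iff texp_def)

lemma texp_add:
  "tess_integrable M X \<Longrightarrow> tess_integrable M Y \<Longrightarrow>
   texp M (\<lambda>\<omega>. X \<omega> + Y \<omega>) = texp M X + texp M Y"
  by (simp add: tess_integrable_def all_part tess_eq_iff texp_def)

lemma texp_diff:
  "tess_integrable M X \<Longrightarrow> tess_integrable M Y \<Longrightarrow>
   texp M (\<lambda>\<omega>. X \<omega> - Y \<omega>) = texp M X - texp M Y"
  by (simp add: tess_integrable_def all_part tess_eq_iff texp_def)

lemma texp_sum:
  "(\<And>a. a \<in> A \<Longrightarrow> tess_integrable M (X a)) \<Longrightarrow>
   texp M (\<lambda>\<omega>. \<Sum>a\<in>A. X a \<omega>) = (\<Sum>a\<in>A. texp M (X a))"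
  by (intro tess_eqI) (simp add: texp_part tpart_sum tess_integrable_def Bochner_Integration.integral_sum)

lemma texp_tcnj: "texp M (\<lambda>\<omega>. tcnj (X \<omega>)) = tcnj (texp M X)"
  by (simp add: tess_eq_iff texp_def)

lemma texp_cong: "(\<And>\<omega>. \<omega> \<in> space M \<Longrightarrow> X \<omega> = Y \<omega>) \<Longrightarrow> texp M X = texp M Y"
  by (intro tess_eqI) (simp add: texp_part cong: Bochner_Integration.integral_cong)

lemma tess_L2_mult_integrable:
  assumes "tess_L2 M X" "tess_L2 M Y"
  shows "tess_integrable M (\<lambda>\<omega>. X \<omega> * tcnj (Y \<omega>))"
proof -
  have "\<forall>\<mu> \<nu>. integrable M (\<lambda>\<omega>. tpart \<mu> (X \<omega>) * tpart \<nu> (Y \<omega>))"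
    using assms by (intro allI integrable_mult_square_integrable) (auto simp: tess_L2_def)
  then show ?thesis
    unfolding tess_integrable_def all_part by (simp add: tess_sel_mult)
qed

lemma tess_L2_add:
  assumes "tess_L2 M X" "tess_L2 M Y"
  shows "tess_L2 M (\<lambda>\<omega>. X \<omega> + Y \<omega>)"
  unfolding tess_L2_def
proof safe
  fix \<nu>
  have *: "(\<lambda>\<omega>. tpart \<nu> (X \<omega>)) \<in> borel_measurable M" "(\<lambda>\<omega>. tpart \<nu> (Y \<omega>)) \<in> borel_measurable M"
    "integrable M (\<lambda>\<omega>. (tpart \<nu> (X \<omega>))\<^sup>2)" "integrable M (\<lambda>\<omega>. (tpart \<nu> (Y \<omega>))\<^sup>2)"
    using assms by (auto simp: tess_L2_def)
  then show "(\<lambda>\<omega>. tpart \<nu> (X \<omega> + Y \<omega>)) \<in> borel_measurable M" by simp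
  show "integrable M (\<lambda>\<omega>. (tpart \<nu> (X \<omega> + Y \<omega>))\<^sup>2)"
    using * integrable_mult_square_integrable[OF *]
    by (simp add: power2_sum mult.assoc)
qed

text \<open>Each component of $cx$ is a real linear form in the components of $x$, so its square is a
  combination of their pairwise products; the coefficients are read off from the products of $c$ with
  the basis.\<close>

lemma tess_L2_cmult:
  assumes "tess_L2 M X" shows "tess_L2 M (\<lambda>\<omega>. c * X \<omega>)"
proof -
  have *: "integrable M (\<lambda>\<omega>. tpart \<mu> (X \<omega>) * tpart \<nu> (X \<omega>))" for \<mu> \<nu>
    using assms by (intro integrable_mult_square_integrable) (auto simp: tess_L2_def)
  have **: "(\<lambda>\<omega>. tpart \<mu> (X \<omega>)) \<in> borel_measurable M" for \<mu>
    using assms by (auto simp: tess_L2_def)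
  have "\<exists>a. \<forall>x. tpart \<nu> (c * x) = (\<Sum>\<mu>\<in>UNIV. a \<mu> * tpart \<mu> x)" for \<nu>
  proof
    show "\<forall>x. tpart \<nu> (c * x) = (\<Sum>\<mu>\<in>UNIV. tpart \<nu> (c * (case \<mu> of PR \<Rightarrow> 1 | PEta \<Rightarrow> eta
        | PEta1 \<Rightarrow> eta1 | PEta2 \<Rightarrow> eta2)) * tpart \<mu> x)"
      by (cases \<nu>) (simp_all add: UNIV_part tess_sel_mult)
  qed
  then obtain a where a: "\<And>\<nu> x. tpart \<nu> (c * x) = (\<Sum>\<mu>\<in>UNIV. a \<nu> \<mu> * tpart \<mu> x)" by metis
  have "(tpart \<nu> (c * x))\<^sup>2
      = (\<Sum>\<mu>\<in>UNIV. \<Sum>\<mu>'\<in>UNIV. (a \<nu> \<mu> * a \<nu> \<mu>') * (tpart \<mu> x * tpart \<mu>' x))" for \<nu> x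
    by (simp add: a power2_eq_square sum_product mult_ac)
  then show ?thesis
    unfolding tess_L2_def
    by (auto simp: a intro!: borel_measurable_sum Bochner_Integration.integrable_sum * **
        borel_measurable_times integrable_mult_right)
qed

lemma tess_L2_zero: "tess_L2 M (\<lambda>\<omega>. 0)"
  by (simp add: tess_L2_def)

lemma tess_L2_sum: "(\<And>a. a \<in> A \<Longrightarrow> tess_L2 M (X a)) \<Longrightarrow> tess_L2 M (\<lambda>\<omega>. \<Sum>a\<in>A. X a \<omega>)"
  by (induction A rule: infinite_finite_induct) (auto intro: tess_L2_add simp: tess_L2_zero)

lemma tess_L2_capp:
  assumes "tess_L2 M X" shows "tess_L2 M (\<lambda>\<omega>. capp c (X \<omega>))"
  using assms unfolding tess_L2_def all_part
  by (cases c) (simp_all add: teta_def teta2_def)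

lemma square_integrable_vec_add:
  "square_integrable_vec M X \<Longrightarrow> square_integrable_vec M Y \<Longrightarrow>
   square_integrable_vec M (\<lambda>\<omega>. X \<omega> + Y \<omega>)"
  by (simp add: square_integrable_vec_iff tess_L2_add)

lemma square_integrable_vec_mult:
  "square_integrable_vec M X \<Longrightarrow> square_integrable_vec M (\<lambda>\<omega>. A *v X \<omega>)"
  by (simp add: square_integrable_vec_iff matrix_vector_mult_def tess_L2_sum tess_L2_cmult)

lemma square_integrable_vec_diff:
  assumes "square_integrable_vec M X" "square_integrable_vec M Y"
  shows "square_integrable_vec M (\<lambda>\<omega>. X \<omega> - Y \<omega>)"
proof -
  have "tess_L2 M (\<lambda>\<omega>. X \<omega> $ j + (- 1) * Y \<omega> $ j)" for j
    using assms by (intro tess_L2_add tess_L2_cmult) (auto simp: square_integrable_vec_iff)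
  then show ?thesis by (simp add: square_integrable_vec_iff)
qed

lemma square_integrable_vec_zero: "square_integrable_vec M (\<lambda>\<omega>. 0)"
  by (simp add: square_integrable_vec_iff tess_L2_zero)

lemma square_integrable_vec_sum:
  "(\<And>a. a \<in> A \<Longrightarrow> square_integrable_vec M (X a)) \<Longrightarrow>
   square_integrable_vec M (\<lambda>\<omega>. \<Sum>a\<in>A. X a \<omega>)"
  by (simp add: square_integrable_vec_iff tess_L2_sum)

lemma square_integrable_vec_aug:
  "square_integrable_vec M X \<Longrightarrow> square_integrable_vec M (\<lambda>\<omega>. aug (X \<omega>))"
  by (simp add: square_integrable_vec_iff aug_def tess_L2_capp)

lemma square_integrable_vec_stack:
  "(\<And>i. square_integrable_vec M (X i)) \<Longrightarrow> square_integrable_vec M (\<lambda>\<omega>. stack (\<lambda>i. X i \<omega>))"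
  by (simp add: square_integrable_vec_iff stack_def)

lemma square_integrable_vec_cong:
  "(\<And>\<omega>. \<omega> \<in> space M \<Longrightarrow> X \<omega> = Y \<omega>) \<Longrightarrow> square_integrable_vec M X \<longleftrightarrow> square_integrable_vec M Y"
  unfolding square_integrable_vec_def
  by (simp cong: measurable_cong Bochner_Integration.integrable_cong)

lemmas square_integrable_vec_intros =
  square_integrable_vec_add square_integrable_vec_diff square_integrable_vec_mult
  square_integrable_vec_aug square_integrable_vec_stack square_integrable_vec_sum

lemma meas_vec_sel:
  assumes "meas_vec N X"
  shows "(\<lambda>\<omega>. tr (X \<omega> $ j)) \<in> borel_measurable N" "(\<lambda>\<omega>. te (X \<omega> $ j)) \<in> borel_measurable N"
    "(\<lambda>\<omega>. te1 (X \<omega> $ j)) \<in> borel_measurable N" "(\<lambda>\<omega>. te2 (X \<omega> $ j)) \<in> borel_measurable N"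
  using assms by (simp_all add: meas_vec_def all_part)

lemma meas_vec_mult: "meas_vec N X \<Longrightarrow> meas_vec N (\<lambda>\<omega>. A *v X \<omega>)"
proof -
  assume X: "meas_vec N X"
  note [measurable] = meas_vec_sel[OF X]
  have "(\<lambda>\<omega>. tpart \<nu> (c * X \<omega> $ j)) \<in> borel_measurable N" for \<nu> c j
    by (cases \<nu>; simp add: tess_sel_mult; measurable)
  then show ?thesis
    by (auto simp: meas_vec_def matrix_vector_mult_def tpart_sum)
qed

lemma meas_vec_aug: "meas_vec N X \<Longrightarrow> meas_vec N (\<lambda>\<omega>. aug (X \<omega>))"
proof -
  assume X: "meas_vec N X"
  note [measurable] = meas_vec_sel[OF X]
  have "(\<lambda>\<omega>. tpart \<nu> (capp c (X \<omega> $ j))) \<in> borel_measurable N" for \<nu> c j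
    by (cases \<nu>; cases c; simp add: teta_def teta2_def; measurable)
  then show ?thesis by (simp add: meas_vec_def aug_def)
qed

lemma meas_vec_intros:
  "meas_vec N X \<Longrightarrow> meas_vec N Y \<Longrightarrow> meas_vec N (\<lambda>\<omega>. X \<omega> + Y \<omega>)"
  "meas_vec N X \<Longrightarrow> meas_vec N Y \<Longrightarrow> meas_vec N (\<lambda>\<omega>. X \<omega> - Y \<omega>)"
  "meas_vec N X \<Longrightarrow> meas_vec N (\<lambda>\<omega>. A *v X \<omega>)"
  "meas_vec N X \<Longrightarrow> meas_vec N (\<lambda>\<omega>. aug (X \<omega>))"
  "(\<And>i. meas_vec N (Z i)) \<Longrightarrow> meas_vec N (\<lambda>\<omega>. stack (\<lambda>i. Z i \<omega>))"
  "meas_vec N (\<lambda>\<omega>. 0)"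
  by (auto simp: meas_vec_mult meas_vec_aug) (auto simp: meas_vec_def stack_def intro: borel_measurable_add borel_measurable_diff)

lemma meas_vec_cong:
  "(\<And>\<omega>. \<omega> \<in> space N \<Longrightarrow> X \<omega> = Y \<omega>) \<Longrightarrow> meas_vec N X \<longleftrightarrow> meas_vec N Y"
  unfolding meas_vec_def by (simp cong: measurable_cong)

lemma Gam_cong:
  "(\<And>\<omega>. \<omega> \<in> space M \<Longrightarrow> X \<omega> = X' \<omega>) \<Longrightarrow> (\<And>\<omega>. \<omega> \<in> space M \<Longrightarrow> Y \<omega> = Y' \<omega>) \<Longrightarrow>
   Gam M X Y = Gam M X' Y'"
  by (simp add: Gam_def vec_eq_iff cong: texp_cong)

lemma Gam_herm: "Gam M Y X = herm (Gam M X Y)"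
  by (simp add: vec_eq_iff Gam_def herm_nth mult.commute flip: texp_tcnj)

lemma Gam_integrable:
  "square_integrable_vec M X \<Longrightarrow> square_integrable_vec M Y \<Longrightarrow>
   tess_integrable M (\<lambda>\<omega>. X \<omega> $ i * tcnj (Y \<omega> $ j))"
  by (simp add: square_integrable_vec_iff tess_L2_mult_integrable)

lemma Gam_left:
  assumes "square_integrable_vec M X" "square_integrable_vec M Y"
  shows "square_integrable_vec M Z \<Longrightarrow> Gam M (\<lambda>\<omega>. X \<omega> + Z \<omega>) Y = Gam M X Y + Gam M Z Y"
    and "square_integrable_vec M Z \<Longrightarrow> Gam M (\<lambda>\<omega>. X \<omega> - Z \<omega>) Y = Gam M X Y - Gam M Z Y"
    and "Gam M (\<lambda>\<omega>. A *v X \<omega>) Y = A ** Gam M X Y"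
proof -
  note * = Gam_integrable[OF assms]
  assume Z: "square_integrable_vec M Z"
  note ** = Gam_integrable[OF Z assms(2)]
  show "Gam M (\<lambda>\<omega>. X \<omega> + Z \<omega>) Y = Gam M X Y + Gam M Z Y"
    by (simp add: Gam_def vec_eq_iff distrib_right texp_add * **)
  show "Gam M (\<lambda>\<omega>. X \<omega> - Z \<omega>) Y = Gam M X Y - Gam M Z Y"
    by (simp add: Gam_def vec_eq_iff left_diff_distrib texp_diff * **)
next
  note * = Gam_integrable[OF assms]
  show "Gam M (\<lambda>\<omega>. A *v X \<omega>) Y = A ** Gam M X Y"
    by (simp add: Gam_def vec_eq_iff matrix_vector_mult_def matrix_matrix_mult_def
        sum_distrib_right mult.assoc texp_sum texp_cmult tess_integrable_cmult *)
qed

lemma Gam_right: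
  assumes "square_integrable_vec M X" "square_integrable_vec M Y"
  shows "square_integrable_vec M Z \<Longrightarrow> Gam M Y (\<lambda>\<omega>. X \<omega> + Z \<omega>) = Gam M Y X + Gam M Y Z"
    and "square_integrable_vec M Z \<Longrightarrow> Gam M Y (\<lambda>\<omega>. X \<omega> - Z \<omega>) = Gam M Y X - Gam M Y Z"
    and "Gam M Y (\<lambda>\<omega>. A *v X \<omega>) = Gam M Y X ** herm A"
  by (simp_all add: Gam_herm[of M Y] herm_mult Gam_left[OF assms])

lemma Gam_zero [simp]: "Gam M (\<lambda>\<omega>. 0) Y = 0" "Gam M X (\<lambda>\<omega>. 0) = 0"
  by (simp_all add: Gam_def vec_eq_iff)

lemma Gam_sum_right_eq_0:
  assumes "square_integrable_vec M X" "\<And>s. s \<in> A \<Longrightarrow> square_integrable_vec M (Y s)"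
    and "\<And>s. s \<in> A \<Longrightarrow> Gam M X (Y s) = 0"
  shows "Gam M X (\<lambda>\<omega>. \<Sum>s\<in>A. K s *v Y s \<omega>) = 0"
  using assms(2,3)
proof (induction A rule: infinite_finite_induct)
  case (insert a A)
  then show ?case
    by (simp add: Gam_right assms(1) square_integrable_vec_intros matrix_distrib)
qed auto

text \<open>Definiteness: the real part of a diagonal entry of \<open>Gam M X X\<close> is the expected sum of
  squares of all four components.\<close>

lemma Gam_self_eq_0_imp_AE:
  assumes X: "square_integrable_vec M X" and 0: "Gam M X X = 0"
  shows "AE \<omega> in M. X \<omega> = 0"
proof -
  have "AE \<omega> in M. tpart \<nu> (X \<omega> $ j) = 0" for j \<nu>
  proof -
    have i: "integrable M (\<lambda>\<omega>. (tpart \<mu> (X \<omega> $ j))\<^sup>2)" for \<mu>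
      using X by (simp add: square_integrable_vec_def)
    have "tr (Gam M X X $ j $ j) = 0" using 0 by simp
    then have "(\<integral>\<omega>. (\<Sum>\<mu>\<in>UNIV. (tpart \<mu> (X \<omega> $ j))\<^sup>2) \<partial>M) = 0"
      by (simp add: Gam_def texp_def tess_sel_mult UNIV_part power2_eq_square add.assoc)
    moreover have "integrable M (\<lambda>\<omega>. \<Sum>\<mu>\<in>UNIV. (tpart \<mu> (X \<omega> $ j))\<^sup>2)"
      using i by (intro Bochner_Integration.integrable_sum) auto
    ultimately have "AE \<omega> in M. (\<Sum>\<mu>\<in>UNIV. (tpart \<mu> (X \<omega> $ j))\<^sup>2) = 0"
      by (subst (asm) integral_nonneg_eq_0_iff_AE) (auto intro!: AE_I2 sum_nonneg)
    then show ?thesis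
      by eventually_elim (auto simp: sum_nonneg_eq_0_iff)
  qed
  then have "AE \<omega> in M. \<forall>j\<in>UNIV. \<forall>\<nu>\<in>UNIV. tpart \<nu> (X \<omega> $ j) = 0"
    by (intro AE_finite_allI) auto
  then show ?thesis
    by eventually_elim (auto simp: vec_eq_iff intro: tess_eqI)
qed

lemma Gam_AE_cong:
  assumes "square_integrable_vec M X" "square_integrable_vec M Y" "AE \<omega> in M. X \<omega> = Y \<omega>"
  shows "Gam M X X = Gam M Y Y"
proof -
  have "texp M (\<lambda>\<omega>. X \<omega> $ i * tcnj (X \<omega> $ j)) = texp M (\<lambda>\<omega>. Y \<omega> $ i * tcnj (Y \<omega> $ j))" for i j
  proof (rule tess_eqI)
    fix \<nu>
    show "tpart \<nu> (texp M (\<lambda>\<omega>. X \<omega> $ i * tcnj (X \<omega> $ j)))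
        = tpart \<nu> (texp M (\<lambda>\<omega>. Y \<omega> $ i * tcnj (Y \<omega> $ j)))"
      unfolding texp_part
    proof (rule integral_cong_AE)
      show "AE \<omega> in M. tpart \<nu> (X \<omega> $ i * tcnj (X \<omega> $ j)) = tpart \<nu> (Y \<omega> $ i * tcnj (Y \<omega> $ j))"
        using assms(3) by eventually_elim simp
    qed (use Gam_integrable[OF assms(1,1)] Gam_integrable[OF assms(2,2)] in
        \<open>auto simp: tess_integrable_def intro!: borel_measurable_integrable\<close>)
  qed
  then show ?thesis by (simp add: Gam_def)
qed

section \<open>Random diagonal factors independent of the past\<close>

lemma (in prob_space) indep_set_integral_mult:
  fixes f g :: "'a \<Rightarrow> real"
  assumes indep: "indep_set (sets N1) (sets N2)"
    and sp: "space N1 = space M" "space N2 = space M"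
    and f: "f \<in> borel_measurable N1" "integrable M f"
    and g: "g \<in> borel_measurable N2" "integrable M g"
  shows "integrable M (\<lambda>\<omega>. f \<omega> * g \<omega>)" "(\<integral>\<omega>. f \<omega> * g \<omega> \<partial>M) = (\<integral>\<omega>. f \<omega> \<partial>M) * (\<integral>\<omega>. g \<omega> \<partial>M)"
proof -
  have "{f -` A \<inter> space M |A. A \<in> sets borel} \<subseteq> sets N1"
    "{g -` A \<inter> space M |A. A \<in> sets borel} \<subseteq> sets N2"
    using measurable_sets[OF f(1)] measurable_sets[OF g(1)] sp by auto
  then have "sigma_sets (space M) {f -` A \<inter> space M |A. A \<in> sets borel} \<subseteq> sets N1"
    "sigma_sets (space M) {g -` A \<inter> space M |A. A \<in> sets borel} \<subseteq> sets N2"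
    using sets.sigma_sets_subset[of _ N1] sets.sigma_sets_subset[of _ N2] sp by auto
  then have "indep_set (sigma_sets (space M) {f -` A \<inter> space M |A. A \<in> sets borel})
      (sigma_sets (space M) {g -` A \<inter> space M |A. A \<in> sets borel})"
    using indep unfolding indep_sets2_eq by blast
  then have fg: "indep_var borel f borel g"
    unfolding indep_var_eq using f(2) g(2) by (simp add: borel_measurable_integrable)
  show "integrable M (\<lambda>\<omega>. f \<omega> * g \<omega>)"
    by (rule indep_var_integrable[OF fg f(2) g(2)])
  show "(\<integral>\<omega>. f \<omega> * g \<omega> \<partial>M) = (\<integral>\<omega>. f \<omega> \<partial>M) * (\<integral>\<omega>. g \<omega> \<partial>M)"
    by (rule indep_var_lebesgue_integral[OF fg f(2) g(2)])
qed

lemma (in prob_space) texp_scaleR_indep: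
  assumes "indep_set (sets N1) (sets N2)" "space N1 = space M" "space N2 = space M"
    and "f \<in> borel_measurable N1" "integrable M f"
    and "\<And>\<nu>. (\<lambda>\<omega>. tpart \<nu> (Z \<omega>)) \<in> borel_measurable N2" "tess_integrable M Z"
  shows "texp M (\<lambda>\<omega>. f \<omega> *\<^sub>R Z \<omega>) = (\<integral>\<omega>. f \<omega> \<partial>M) *\<^sub>R texp M Z"
  using assms
  by (intro tess_eqI) (simp add: texp_part tess_integrable_def indep_set_integral_mult(2))

text \<open>Random diagonals: measurable with respect to the sigma-algebra \<open>N\<close> of the current dropouts, and
  almost surely bounded, so that they preserve square-integrability.\<close>

definition bounded_rv :: "'w measure \<Rightarrow> 'w measure \<Rightarrow> ('w \<Rightarrow> real^'p) \<Rightarrow> bool" where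
  "bounded_rv M N h \<longleftrightarrow> (\<forall>a. (\<lambda>\<omega>. h \<omega> $ a) \<in> borel_measurable M \<and>
     (\<lambda>\<omega>. h \<omega> $ a) \<in> borel_measurable N \<and> (\<exists>c. AE \<omega> in M. \<bar>h \<omega> $ a\<bar> \<le> c))"

lemma square_integrable_vec_hvec:
  assumes h: "bounded_rv M N h" and W: "square_integrable_vec M W"
  shows "square_integrable_vec M (\<lambda>\<omega>. hvec (h \<omega>) (W \<omega>))"
  unfolding square_integrable_vec_def
proof safe
  fix a \<nu>
  have [measurable]: "(\<lambda>\<omega>. h \<omega> $ a) \<in> borel_measurable M"
      "(\<lambda>\<omega>. tpart \<nu> (W \<omega> $ a)) \<in> borel_measurable M"
    and i: "integrable M (\<lambda>\<omega>. (tpart \<nu> (W \<omega> $ a))\<^sup>2)"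
    using h W by (auto simp: bounded_rv_def square_integrable_vec_def)
  obtain c where c: "AE \<omega> in M. \<bar>h \<omega> $ a\<bar> \<le> c" using h by (auto simp: bounded_rv_def)
  show "(\<lambda>\<omega>. tpart \<nu> (hvec (h \<omega>) (W \<omega>) $ a)) \<in> borel_measurable M"
    by (simp add: hvec_def)
  show "integrable M (\<lambda>\<omega>. (tpart \<nu> (hvec (h \<omega>) (W \<omega>) $ a))\<^sup>2)"
  proof (rule Bochner_Integration.integrable_bound)
    show "integrable M (\<lambda>\<omega>. c\<^sup>2 * (tpart \<nu> (W \<omega> $ a))\<^sup>2)" using i by simp
    show "(\<lambda>\<omega>. (tpart \<nu> (hvec (h \<omega>) (W \<omega>) $ a))\<^sup>2) \<in> borel_measurable M"
      by (simp add: hvec_def)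
    show "AE \<omega> in M. norm ((tpart \<nu> (hvec (h \<omega>) (W \<omega>) $ a))\<^sup>2)
        \<le> norm (c\<^sup>2 * (tpart \<nu> (W \<omega> $ a))\<^sup>2)"
      using c
    proof eventually_elim
      case (elim \<omega>)
      then have "(h \<omega> $ a)\<^sup>2 \<le> c\<^sup>2" by (metis abs_ge_zero power2_abs power_mono)
      then show ?case by (simp add: hvec_def power_mult_distrib mult_right_mono)
    qed
  qed
qed

lemma (in prob_space) bounded_rv_integrable:
  assumes h: "bounded_rv M N h" and h': "bounded_rv M N h'"
  shows "integrable M (\<lambda>\<omega>. h \<omega> $ a)" "integrable M (\<lambda>\<omega>. h \<omega> $ a * h' \<omega> $ b)"
proof -
  obtain c where c: "AE \<omega> in M. \<bar>h \<omega> $ a\<bar> \<le> c" using h by (auto simp: bounded_rv_def)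
  obtain d where d: "AE \<omega> in M. \<bar>h' \<omega> $ b\<bar> \<le> d" using h' by (auto simp: bounded_rv_def)
  have [measurable]: "(\<lambda>\<omega>. h \<omega> $ a) \<in> borel_measurable M" "(\<lambda>\<omega>. h' \<omega> $ b) \<in> borel_measurable M"
    using h h' by (auto simp: bounded_rv_def)
  show "integrable M (\<lambda>\<omega>. h \<omega> $ a)"
    by (rule integrable_const_bound[of _ c]) (use c in auto)
  show "integrable M (\<lambda>\<omega>. h \<omega> $ a * h' \<omega> $ b)"
  proof (rule integrable_const_bound[of _ "c * d"])
    show "AE \<omega> in M. norm (h \<omega> $ a * h' \<omega> $ b) \<le> c * d"
      using c d by eventually_elim (auto simp: abs_mult intro!: mult_mono)
  qed simp
qed

context prob_space
begin

context
  fixes N1 N2 :: "'a measure"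
  assumes indep: "indep_set (sets N1) (sets N2)"
    and sp: "space N1 = space M" "space N2 = space M"
begin

lemma meas_vec_mult_tcnj:
  assumes "meas_vec N W" "meas_vec N X"
  shows "(\<lambda>\<omega>. tpart \<nu> (W \<omega> $ i * tcnj (X \<omega> $ j))) \<in> borel_measurable N"
proof -
  note [measurable] = meas_vec_sel[OF assms(1)] meas_vec_sel[OF assms(2)]
  show ?thesis by (cases \<nu>; simp add: tess_sel_mult; measurable)
qed

lemma Gam_hvec_left:
  assumes h: "bounded_rv M N1 h"
    and W: "square_integrable_vec M W" "meas_vec N2 W"
    and X: "square_integrable_vec M X" "meas_vec N2 X"
  shows "Gam M (\<lambda>\<omega>. hvec (h \<omega>) (W \<omega>)) X = diag_mat (\<chi> a. \<integral>\<omega>. h \<omega> $ a \<partial>M) ** Gam M W X"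
proof -
  have "texp M (\<lambda>\<omega>. (h \<omega> $ i) *\<^sub>R (W \<omega> $ i * tcnj (X \<omega> $ j)))
      = (\<integral>\<omega>. h \<omega> $ i \<partial>M) *\<^sub>R texp M (\<lambda>\<omega>. W \<omega> $ i * tcnj (X \<omega> $ j))" for i j
    using h by (intro texp_scaleR_indep[OF indep sp] bounded_rv_integrable(1)[OF h h]
        meas_vec_mult_tcnj W X Gam_integrable) (simp add: bounded_rv_def)
  then show ?thesis
    by (simp add: vec_eq_iff Gam_def hvec_def diag_mat_mult_nth)
qed

lemma Gam_hvec_hvec:
  assumes h: "bounded_rv M N1 h" and h': "bounded_rv M N1 h'"
    and W: "square_integrable_vec M W" "meas_vec N2 W"
    and X: "square_integrable_vec M X" "meas_vec N2 X"
  shows "Gam M (\<lambda>\<omega>. hvec (h \<omega>) (W \<omega>)) (\<lambda>\<omega>. hvec (h' \<omega>) (X \<omega>)) = rGam M h h' \<odot> Gam M W X"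
proof -
  have "texp M (\<lambda>\<omega>. (h \<omega> $ i * h' \<omega> $ j) *\<^sub>R (W \<omega> $ i * tcnj (X \<omega> $ j)))
      = (\<integral>\<omega>. h \<omega> $ i * h' \<omega> $ j \<partial>M) *\<^sub>R texp M (\<lambda>\<omega>. W \<omega> $ i * tcnj (X \<omega> $ j))" for i j
    using h h' by (intro texp_scaleR_indep[OF indep sp] bounded_rv_integrable(2)[OF h h']
        meas_vec_mult_tcnj W X Gam_integrable borel_measurable_times) (simp_all add: bounded_rv_def)
  then show ?thesis
    by (simp add: vec_eq_iff Gam_def hvec_def rGam_def hadamard_def
        mult.commute[of "h' _ $ _" "h _ $ _"])
qed

end

end

text \<open>If the $X_k$ are mutually independent and jointly independent of \<open>N\<close>, then all of them together
  with \<open>N\<close> form one independent family (the index \<open>None\<close> stands for \<open>N\<close>), and disjoint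
  subfamilies generate independent sigma-algebras. This is what allows a function of some $X_k$ to be
  separated from functions of other $X_k$ and of \<open>N\<close> jointly.\<close>

lemma (in prob_space) indep_set_disjoint_join:
  fixes X :: "'i \<Rightarrow> 'a \<Rightarrow> real"
  defines "E \<equiv> \<lambda>k. {X k -` A \<inter> space M |A. A \<in> sets borel}"
  assumes X: "indep_vars (\<lambda>_. borel) X I"
    and C: "indep_set (sets (vimage_algebra (space M) (\<lambda>\<omega>. \<lambda>k\<in>I. X k \<omega>) (\<Pi>\<^sub>M k\<in>I. borel))) (sets N)"
    and JK: "J \<subseteq> I" "K \<subseteq> I" "J \<inter> K = {}"
  shows "indep_set (sigma_sets (space M) (\<Union>k\<in>J. E k)) (sigma_sets (space M) ((\<Union>k\<in>K. E k) \<union> sets N))"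
proof -
  let ?V = "vimage_algebra (space M) (\<lambda>\<omega>. \<lambda>k\<in>I. X k \<omega>) (\<Pi>\<^sub>M k\<in>I. borel)"
  define F where "F = (\<lambda>k. case k of None \<Rightarrow> sets N | Some k \<Rightarrow> E k)"
  have E_ev: "E k \<subseteq> events" if "k \<in> I" for k
    using X that unfolding E_def indep_vars_def by (auto intro: measurable_sets)
  have N_ev: "sets N \<subseteq> events" using C by (simp add: indep_sets2_eq)
  have E_V: "E k \<subseteq> sets ?V" if k: "k \<in> I" for k
  proof -
    have "(\<lambda>\<omega>. (\<lambda>k\<in>I. X k \<omega>)) \<in> measurable ?V (\<Pi>\<^sub>M k\<in>I. borel)"
      by (rule measurable_vimage_algebra1) (auto simp: space_PiM)
    from measurable_compose[OF this measurable_component_singleton[OF k]]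
    have "X k \<in> borel_measurable ?V" using k by simp
    then show ?thesis by (auto simp: E_def dest: measurable_sets)
  qed
  have indE: "indep_sets E I" using X unfolding indep_vars_def2 E_def by auto
  have indF: "indep_sets F (insert None (Some ` I))"
  proof (rule indep_setsI)
    fix i assume "i \<in> insert None (Some ` I)"
    then show "F i \<subseteq> events" using N_ev by (auto simp: F_def intro: subsetD[OF E_ev])
  next
    fix A L assume L: "L \<noteq> {}" "L \<subseteq> insert None (Some ` I)" "finite L" "\<forall>j\<in>L. A j \<in> F j"
    define L' where "L' = {k. Some k \<in> L}"
    have L': "L' \<subseteq> I" "finite L'" "\<And>k. k \<in> L' \<Longrightarrow> A (Some k) \<in> E k"
      using L by (auto simp: L'_def F_def intro: finite_vimageI[of L Some, unfolded vimage_def])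
    have L_eq: "L = Some ` L' \<or> L = insert None (Some ` L')"
      using L(2) by (auto simp: L'_def)
    have P': "prob (\<Inter>k\<in>L'. A (Some k)) = (\<Prod>k\<in>L'. prob (A (Some k)))" if "L' \<noteq> {}"
      using indep_setsD[OF indE L'(1) that L'(2)] L'(3) by auto
    show "prob (\<Inter>j\<in>L. A j) = (\<Prod>j\<in>L. prob (A j))"
    proof (cases "None \<in> L")
      case False
      with L_eq have "L = Some ` L'" by auto
      with L(1) P' show ?thesis by (auto simp: prod.reindex)
    next
      case True
      with L_eq have L_None: "L = insert None (Some ` L')" by auto
      show ?thesis
      proof (cases "L' = {}")
        case False
        have "(\<Inter>k\<in>L'. A (Some k)) \<in> sets ?V"
          using L' E_V False by (intro sets.finite_INT) auto
        moreover have "A None \<in> sets N" using L(4) True by (auto simp: F_def)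
        ultimately have "prob ((\<Inter>k\<in>L'. A (Some k)) \<inter> A None)
            = prob (\<Inter>k\<in>L'. A (Some k)) * prob (A None)"
          using indep_setD[OF C] by blast
        with P' False L'(2) show ?thesis
          by (simp add: L_None prod.reindex Int_commute mult.commute)
      qed (simp add: L_None)
    qed
  qed
  let ?I = "\<lambda>b. if b then Some ` J else insert None (Some ` K)"
  have "indep_sets (\<lambda>b. sigma_sets (space M) (\<Union>i\<in>?I b. F i)) (UNIV :: bool set)"
  proof (rule indep_sets_collect_sigma)
    show "indep_sets F (\<Union>b\<in>UNIV. ?I b)"
      by (rule indep_sets_mono_index[OF _ indF]) (use JK in \<open>auto simp: UNIV_bool\<close>)
    show "Int_stable (F i)" for i
    proof (cases i)
      case None then show ?thesis by (auto simp: F_def Int_stable_def)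
    next
      case (Some k)
      have "X k -` A \<inter> space M \<inter> (X k -` B \<inter> space M) \<in> E k"
        if "A \<in> sets borel" "B \<in> sets borel" for A B
        unfolding E_def using that by (auto intro!: exI[of _ "A \<inter> B"])
      then have "Int_stable (E k)" by (auto simp: Int_stable_def E_def)
      then show ?thesis using Some by (simp add: F_def)
    qed
    show "disjoint_family_on ?I UNIV"
      using JK by (auto simp: disjoint_family_on_def)
  qed
  moreover have "(\<lambda>b. sigma_sets (space M) (\<Union>i\<in>?I b. F i))
     = case_bool (sigma_sets (space M) (\<Union>k\<in>J. E k)) (sigma_sets (space M) ((\<Union>k\<in>K. E k) \<union> sets N))"
    by (auto simp: fun_eq_iff F_def Un_commute split: bool.split)
  ultimately show ?thesis by (simp add: indep_set_def)
qed

section \<open>The augmented system\<close>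

lemma capp_matrix_vector: "capp c ((A *v x) $ j) = (map_mat (capp c) A *v map_vec (capp c) x) $ j"
  by (simp add: matrix_vector_mult_def map_mat_def map_vec_def capp_sum)

lemma block_mat_vec:
  fixes B :: "'a::finite \<Rightarrow> 'b::finite \<Rightarrow> 'c::semiring_1^'n::finite^'m::finite"
  shows "(block_mat B *v v) $ (a, i) = (\<Sum>b\<in>UNIV. (B a b *v (\<chi> j. v $ (b, j))) $ i)"
  by (simp add: block_mat_def matrix_vector_mult_def sum_UNIV_prod)

lemma aug_add: "aug (x + y) = aug x + aug y" and aug_diff: "aug (x - y) = aug x - aug y"
  by (simp_all add: aug_def vec_eq_iff)

lemma stack_aug_add: "stack (\<lambda>i. aug (f i + g i)) = stack (\<lambda>i. aug (f i)) + stack (\<lambda>i. aug (g i))"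
  and stack_aug_diff: "stack (\<lambda>i. aug (f i - g i)) = stack (\<lambda>i. aug (f i)) - stack (\<lambda>i. aug (g i))"
  by (simp_all add: stack_def aug_add aug_diff vec_eq_iff)

lemma ones_kron_stack: "ones_kron *v x = stack (\<lambda>_. x)"
  by (simp add: vec_eq_iff ones_kron_vec stack_def)

text \<open>The conjugations form a Klein four-group; applying one of them to the state equation permutes the
  four conjugates of the state, and \<open>Phibar\<close> records this permutation.\<close>

lemma aug_state_step:
  "aug (F1 S t *v x + F2 S t *v map_vec tcnj x + F3 S t *v map_vec teta x
      + F4 S t *v map_vec teta2 x) = Phibar S t *v aug x"
proof -
  have m: "map_vec f (map_vec g x) = map_vec (\<lambda>a. f (g a)) x" for f g
    by (simp add: map_vec_def vec_eq_iff)
  have "(\<chi> j. aug x $ (c, j)) = map_vec (capp c) x" for c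
    by (simp add: aug_def map_vec_def)
  moreover have [simp]: "capp CId = (\<lambda>x. x)" "capp CStar = tcnj" "capp CEta = teta" "capp CEta2 = teta2"
    by (simp_all add: fun_eq_iff)
  moreover have [simp]: "map_mat (\<lambda>x. x) A = A" "map_vec (\<lambda>x. x) v = v" for A v
    by (simp_all add: map_mat_def map_vec_def)
  ultimately have "aug (F1 S t *v x + F2 S t *v map_vec tcnj x + F3 S t *v map_vec teta x
      + F4 S t *v map_vec teta2 x) $ (c, j) = (Phibar S t *v aug x) $ (c, j)" for c j
    by (cases c) (simp_all add: aug_def[of "_ + _"] Phibar_def block_mat_vec UNIV_invol
        capp_matrix_vector m del: capp.simps)
  then show ?thesis by (simp add: vec_eq_iff)
qed

lemma Gam_stack_left: "Gam M (\<lambda>\<omega>. stack (\<lambda>i. X i \<omega>)) Y $ (i, p) = Gam M (X i) Y $ p"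
  by (simp add: Gam_def stack_def vec_eq_iff)

lemma Gam_stack_right: "Gam M X (\<lambda>\<omega>. stack (\<lambda>i. Y i \<omega>)) $ p $ (i, q) = Gam M X (Y i) $ p $ q"
  by (simp add: Gam_def stack_def)

lemma meas_vec_hvec:
  assumes "\<And>a. (\<lambda>\<omega>. h \<omega> $ a) \<in> borel_measurable N" "meas_vec N W"
  shows "meas_vec N (\<lambda>\<omega>. hvec (h \<omega>) (W \<omega>))"
  using assms by (simp add: meas_vec_def hvec_def borel_measurable_times)

lemma tpart_capp: "\<exists>e. \<forall>x. tpart \<nu> (capp c x) = e * tpart \<nu> x"
proof -
  have "tpart \<nu> (capp c x) = tpart \<nu> (capp c (Tess 1 1 1 1)) * tpart \<nu> x" for x
    by (cases c; cases \<nu>) (simp_all add: tcnj_def teta_def teta2_def)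
  then show ?thesis by blast
qed

context tessarine_system
begin

abbreviation "M \<equiv> pspace S"

definition xbar :: "nat \<Rightarrow> 'w \<Rightarrow> tess^(invol \<times> 'n)" where "xbar t \<omega> = aug (st S t \<omega>)"
definition ubar :: "nat \<Rightarrow> 'w \<Rightarrow> tess^(invol \<times> 'n)" where "ubar t \<omega> = aug (un S t \<omega>)"
definition vvec :: "nat \<Rightarrow> 'w \<Rightarrow> tess^('r \<times> invol \<times> 'n)" where
  "vvec t \<omega> = stack (\<lambda>i. aug (vn S i t \<omega>))"
definition zvec :: "nat \<Rightarrow> 'w \<Rightarrow> tess^('r \<times> invol \<times> 'n)" where
  "zvec t \<omega> = ones_kron *v xbar t \<omega> + vvec t \<omega>"
text \<open>The value 0 at time 0 makes time 1 an instance of the general measurement equation: since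
  $\gamma(1)$ is identically 1, nothing of $y(0)$ is retained.\<close>

definition yvec :: "nat \<Rightarrow> 'w \<Rightarrow> tess^('r \<times> invol \<times> 'n)" where
  "yvec t \<omega> = (if t = 0 then 0 else stack (\<lambda>i. aug (ym S i t \<omega>)))"

definition dvec :: "nat \<Rightarrow> 'w \<Rightarrow> tess^('r \<times> part \<times> 'n)" where
  "dvec t \<omega> = herm Ups *v (zvec t \<omega> - yvec (t - 1) \<omega>)"

lemma yvec_0: "yvec 0 = (\<lambda>\<omega>. 0)"
  by (simp add: yvec_def fun_eq_iff)

lemma xbar_Suc: "\<omega> \<in> space M \<Longrightarrow> xbar (Suc t) \<omega> = Phibar S t *v xbar t \<omega> + ubar t \<omega>"
  by (simp add: xbar_def ubar_def state_eq aug_add flip: aug_state_step)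

lemma zvec_eq: "zvec t \<omega> = stack (\<lambda>i. aug (zm S i t \<omega>))"
  by (simp add: zvec_def ones_kron_stack xbar_def vvec_def zm_def stack_aug_add)

lemma yvec_1: "\<omega> \<in> space M \<Longrightarrow> yvec 1 \<omega> = zvec 1 \<omega>"
  using meas_1 by (simp add: yvec_def zvec_eq)

lemma gvec_1: "\<omega> \<in> space M \<Longrightarrow> gvec S 1 \<omega> = (\<chi> a. 1)"
  by (simp add: gvec_def gam_1 del: One_nat_def)

text \<open>Written as a correction of the previous measurement, the dropout equation contains the random
  factor only once.\<close>

lemma yvec_eq:
  assumes t: "1 \<le> t" and \<omega>: "\<omega> \<in> space M"
  shows "yvec t \<omega> = yvec (t - 1) \<omega> + Ups *v hvec (gvec S t \<omega>) (dvec t \<omega>)"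
proof (cases "t = 1")
  case True
  then show ?thesis
    using \<omega> meas_1[OF \<omega>] by (simp add: yvec_def dvec_def gvec_1[unfolded One_nat_def] hvec_linear zvec_eq
        matrix_vector_mul_assoc Ups_unitary)
next
  case False
  then have t2: "2 \<le> t" using t by simp
  have "tstar g z + tstar (tones - g) y = y + tstar g (z - y)" for g z y
    by (simp add: tess_eq_iff tstar_def tones_def algebra_simps)
  then have "yvec t \<omega> = stack (\<lambda>i. aug (ym S i (t - 1) \<omega>
      + (\<chi> j. tstar (gam S i t \<omega> $ j) ((zm S i t \<omega> - ym S i (t - 1) \<omega>) $ j))))"
    using t2 \<omega> by (simp add: yvec_def meas_eq stack_def vec_eq_iff aug_def)
  also have "\<dots> = yvec (t - 1) \<omega> + Ups *v hvec (gvec S t \<omega>) (dvec t \<omega>)"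
    using t2 by (simp add: stack_aug_add yvec_def gvec_def dvec_def zvec_eq
        Ups_hvec_aug[of "\<lambda>i. gam S i t \<omega>"]
        flip: stack_aug_diff)
  finally show ?thesis .
qed

section \<open>Measurability and independence\<close>

definition gam_events :: "'r \<times> nat \<times> 'n \<times> part \<Rightarrow> 'w set set" where
  "gam_events k = {gam_part S k -` A \<inter> space M |A. A \<in> sets borel}"

definition now :: "nat \<Rightarrow> 'w measure" where
  "now t = sigma (space M) (\<Union>k\<in>{(i, s, j, \<nu>). s = t}. gam_events k)"

definition src :: "'w measure" where
  "src = vimage_algebra (space M) (\<lambda>\<omega> k. source_part S k \<omega>) (\<Pi>\<^sub>M k\<in>UNIV. borel)"

definition past :: "nat \<Rightarrow> 'w measure" where
  "past t = sigma (space M) ((\<Union>k\<in>{(i, s, j, \<nu>). 1 \<le> s \<and> s < t}. gam_events k) \<union> sets src)"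

lemma sets_src: "sets src \<subseteq> Pow (space M)"
  using sets.space_closed[of src] by (simp add: src_def)

lemma space_now [simp]: "space (now t) = space M" and space_past [simp]: "space (past t) = space M"
  by (simp_all add: now_def past_def space_measure_of_conv)

lemma gam_events_space: "gam_events k \<subseteq> Pow (space M)"
  by (auto simp: gam_events_def)

lemma sets_now: "sets (now t) = sigma_sets (space M) (\<Union>k\<in>{(i, s, j, \<nu>). s = t}. gam_events k)"
  unfolding now_def by (rule sets_measure_of) (use gam_events_space in blast)

lemma sets_past: "sets (past t) = sigma_sets (space M)
    ((\<Union>k\<in>{(i, s, j, \<nu>). 1 \<le> s \<and> s < t}. gam_events k) \<union> sets src)"
  unfolding past_def by (rule sets_measure_of) (use gam_events_space sets_src in blast)

text \<open>The events of \<open>now t\<close> depend on the dropouts at time $t$ only, those of \<open>past t\<close> on earlier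
  dropouts, the initial state and the noises of all times. Letting the noises of all times in is harmless, as they
  are independent of all dropouts, and spares every question about which noises a signal contains.\<close>

lemma indep_now_past:
  assumes "1 \<le> t" shows "indep_set (sets (now t)) (sets (past t))"
  unfolding sets_now sets_past gam_events_def
  by (rule indep_set_disjoint_join[OF gam_indep gam_indep_sources[folded src_def]])
    (use assms in \<open>auto simp: gam_index_def\<close>)

lemma gam_part_now: "(\<lambda>\<omega>. gam_part S (i, t, j, \<nu>) \<omega>) \<in> borel_measurable (now t)"
  by (rule measurableI) (auto simp: sets_now gam_events_def intro!: sigma_sets.Basic)

lemma gam_part_past:
  "1 \<le> s \<Longrightarrow> s < t \<Longrightarrow> (\<lambda>\<omega>. gam_part S (i, s, j, \<nu>) \<omega>) \<in> borel_measurable (past t)"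
  by (rule measurableI) (auto simp: sets_past gam_events_def intro!: sigma_sets.Basic)

lemma source_past: "meas_vec (past t) (source_vec S a)"
  unfolding meas_vec_def
proof safe
  fix j \<nu>
  have "(\<lambda>\<omega> k. source_part S k \<omega>) \<in> measurable src (\<Pi>\<^sub>M k\<in>UNIV. borel)"
    unfolding src_def by (rule measurable_vimage_algebra1) (auto simp: space_PiM)
  from measurable_compose[OF this measurable_component_singleton[of "(a, j, \<nu>)"]]
  have "(\<lambda>\<omega>. tpart \<nu> (source_vec S a \<omega> $ j)) \<in> borel_measurable src"
    by (simp add: source_part_def)
  moreover have "sets src \<subseteq> sets (past t)" by (auto simp: sets_past intro: sigma_sets.Basic)
  moreover have "space src = space (past t)" by (simp add: src_def)
  ultimately show "(\<lambda>\<omega>. tpart \<nu> (source_vec S a \<omega> $ j)) \<in> borel_measurable (past t)"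
    by (auto simp: measurable_def)
qed

lemma un_past: "meas_vec (past t) (ubar s)"
  using meas_vec_intros(4)[OF source_past[of t "SrcU s"]] by (simp add: ubar_def[abs_def])

lemma vn_past: "meas_vec (past t) (vvec s)"
  using source_past[of t "SrcV _ s"] by (auto simp: vvec_def[abs_def] intro!: meas_vec_intros)

lemma xbar_past: "meas_vec (past t) (xbar s)"
proof (induction s)
  case 0
  then show ?case
    using meas_vec_intros(4)[OF source_past[of t SrcX0]] by (simp add: xbar_def[abs_def])
next
  case (Suc s)
  have "meas_vec (past t) (\<lambda>\<omega>. Phibar S s *v xbar s \<omega> + ubar s \<omega>)"
    by (intro meas_vec_intros Suc un_past)
  then show ?case by (subst meas_vec_cong[OF xbar_Suc]) auto
qed

lemma zvec_past: "meas_vec (past t) (zvec s)"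
  unfolding zvec_def[abs_def] by (intro meas_vec_intros xbar_past vn_past)

lemma yvec_past: "s < t \<Longrightarrow> meas_vec (past t) (yvec s)"
proof (induction s)
  case 0
  then show ?case by (simp add: yvec_def[abs_def] meas_vec_intros)
next
  case (Suc s)
  have "meas_vec (past t) (\<lambda>\<omega>. yvec s \<omega> + Ups *v hvec (gvec S (Suc s) \<omega>) (dvec (Suc s) \<omega>))"
    using Suc gam_part_past[of "Suc s" t] unfolding dvec_def[abs_def]
    by (intro meas_vec_intros meas_vec_hvec zvec_past) (auto simp: gvec_def gam_part_def)
  then show ?case by (subst meas_vec_cong[of _ _ "\<lambda>\<omega>. yvec s \<omega> + _ \<omega>"]) (auto simp: yvec_eq[of "Suc s"])
qed

lemma dvec_past: "1 \<le> t \<Longrightarrow> meas_vec (past t) (dvec t)"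
  unfolding dvec_def[abs_def] by (intro meas_vec_intros zvec_past yvec_past) simp

lemma bounded_gvec: "1 \<le> t \<Longrightarrow> bounded_rv M (now t) (gvec S t)"
  unfolding bounded_rv_def
proof safe
  fix a :: "'r \<times> part \<times> 'n"
  assume t: "1 \<le> t"
  show "(\<lambda>\<omega>. gvec S t \<omega> $ a) \<in> borel_measurable M"
    using gam_measurable[OF t] by (simp add: gvec_def)
  show "(\<lambda>\<omega>. gvec S t \<omega> $ a) \<in> borel_measurable (now t)"
    using gam_part_now by (simp add: gvec_def gam_part_def)
  have "AE \<omega> in M. \<bar>gvec S t \<omega> $ a\<bar> \<le> 1"
    using gam_01[OF t, of "fst (snd a)" "fst a" "snd (snd a)"]
    by eventually_elim (auto simp: gvec_def)
  then show "\<exists>c. AE \<omega> in M. \<bar>gvec S t \<omega> $ a\<bar> \<le> c" by blast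
qed

lemma bounded_const_diff:
  assumes "bounded_rv M N h" shows "bounded_rv M N (\<lambda>\<omega>. h \<omega> - d)" "bounded_rv M N (\<lambda>\<omega>. d - h \<omega>)"
proof -
  have "\<exists>c. AE \<omega> in M. \<bar>h \<omega> $ a - d $ a\<bar> \<le> c" for a
  proof -
    obtain c where "AE \<omega> in M. \<bar>h \<omega> $ a\<bar> \<le> c" using assms by (auto simp: bounded_rv_def)
    then have "AE \<omega> in M. \<bar>h \<omega> $ a - d $ a\<bar> \<le> c + \<bar>d $ a\<bar>" by eventually_elim linarith
    then show ?thesis by blast
  qed
  then show "bounded_rv M N (\<lambda>\<omega>. h \<omega> - d)" "bounded_rv M N (\<lambda>\<omega>. d - h \<omega>)"
    using assms by (auto simp: bounded_rv_def abs_minus_commute intro!: borel_measurable_diff)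
qed

lemmas bounded_gvec_diff = bounded_gvec[THEN bounded_const_diff(1)] bounded_gvec[THEN bounded_const_diff(2)]

lemma sq_ubar: "square_integrable_vec M (ubar t)"
  unfolding ubar_def[abs_def] by (intro square_integrable_vec_intros u_square_integrable)

lemma sq_vvec: "square_integrable_vec M (vvec t)"
  unfolding vvec_def[abs_def] by (intro square_integrable_vec_intros v_square_integrable)

lemma sq_xbar: "square_integrable_vec M (xbar t)"
proof (induction t)
  case 0
  show ?case unfolding xbar_def[abs_def] by (intro square_integrable_vec_intros x0_square_integrable)
next
  case (Suc t)
  have "square_integrable_vec M (\<lambda>\<omega>. Phibar S t *v xbar t \<omega> + ubar t \<omega>)"
    by (intro square_integrable_vec_intros Suc sq_ubar)
  then show ?case by (subst square_integrable_vec_cong[OF xbar_Suc]) auto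
qed

lemma sq_zvec: "square_integrable_vec M (zvec t)"
  unfolding zvec_def[abs_def] by (intro square_integrable_vec_intros sq_xbar sq_vvec)

lemma sq_yvec: "square_integrable_vec M (yvec t)"
proof (induction t)
  case 0
  then show ?case by (simp add: yvec_def[abs_def] square_integrable_vec_zero)
next
  case (Suc t)
  have "square_integrable_vec M (\<lambda>\<omega>. yvec t \<omega> + Ups *v hvec (gvec S (Suc t) \<omega>) (dvec (Suc t) \<omega>))"
    unfolding dvec_def[abs_def] using Suc
    by (intro square_integrable_vec_intros square_integrable_vec_hvec[OF bounded_gvec] sq_zvec) auto
  then show ?case
    by (subst square_integrable_vec_cong[of _ _ "\<lambda>\<omega>. yvec t \<omega> + _ \<omega>"]) (auto simp: yvec_eq[of "Suc t"])
qed

lemma sq_dvec: "square_integrable_vec M (dvec t)"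
  unfolding dvec_def[abs_def] by (intro square_integrable_vec_intros sq_zvec sq_yvec)

lemmas sq = sq_xbar sq_ubar sq_vvec sq_zvec sq_yvec sq_dvec square_integrable_vec_intros

lemmas Gam_hvec_left' = Gam_hvec_left[OF indep_now_past space_now space_past]
lemmas Gam_hvec_hvec' = Gam_hvec_hvec[OF indep_now_past space_now space_past]

section \<open>Second-order recursions\<close>

lemma Gam_u_u: "Gam M (ubar t) (ubar s) = (if t = s then Qbar S t else 0)"
  using u_white[of t s] by (simp add: ubar_def[abs_def])

lemma Gam_u_x: "s \<le> t \<Longrightarrow> Gam M (ubar t) (xbar s) = 0"
proof (induction s)
  case 0
  have "Gam M (xbar 0) (ubar t) = 0"
    using x0_u_uncorr[of t] by (simp add: ubar_def[abs_def] xbar_def[abs_def])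
  then show ?case by (subst Gam_herm) simp
next
  case (Suc s)
  have "Gam M (ubar t) (xbar (Suc s)) = Gam M (ubar t) (\<lambda>\<omega>. Phibar S s *v xbar s \<omega> + ubar s \<omega>)"
    by (intro Gam_cong xbar_Suc) auto
  then show ?case
    using Suc by (simp add: Gam_right sq matrix_distrib Gam_u_u)
qed

text \<open>Different sensors: independence and zero mean kill the expectation of every product of real
  components, and each conjugation only changes signs of components.\<close>

lemma Gam_v_v: "Gam M (vvec t) (vvec s) = (if t = s then Rvec S t else 0)"
proof -
  have 0: "Gam M (\<lambda>\<omega>. aug (vn S i t \<omega>)) (\<lambda>\<omega>. aug (vn S l s \<omega>)) = 0" if il: "i \<noteq> l" for i l
  proof -
    have int: "integrable M (\<lambda>\<omega>. tpart \<mu> (vn S i t \<omega> $ j))" for i t \<mu> j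
      using v_square_integrable[of i t] square_integrable_imp_integrable
      by (auto simp: square_integrable_vec_def)
    have mean: "(\<integral>\<omega>. tpart \<mu> (vn S i t \<omega> $ j) \<partial>M) = 0" for i t \<mu> j
      using v_zero_mean[of i t] by (simp add: zero_mean_def flip: texp_part)
    have prod0: "(\<integral>\<omega>. tpart \<mu> (vn S i t \<omega> $ j) * tpart \<nu> (vn S l s \<omega> $ k) \<partial>M) = 0" for \<mu> \<nu> j k
    proof -
      have "indep_var borel ((\<lambda>f. f (t, j, \<mu>)) \<circ> (\<lambda>\<omega> (t, j, \<nu>). tpart \<nu> (vn S i t \<omega> $ j)))
          borel ((\<lambda>f. f (s, k, \<nu>)) \<circ> (\<lambda>\<omega> (t, j, \<nu>). tpart \<nu> (vn S l t \<omega> $ j)))"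
        by (rule indep_var_compose[OF v_indep[OF il]]) (auto intro: measurable_component_singleton)
      then have "indep_var borel (\<lambda>\<omega>. tpart \<mu> (vn S i t \<omega> $ j)) borel (\<lambda>\<omega>. tpart \<nu> (vn S l s \<omega> $ k))"
        by (simp add: comp_def)
      from indep_var_lebesgue_integral[OF this int int] show ?thesis by (simp add: mean)
    qed
    have "texp M (\<lambda>\<omega>. capp c (vn S i t \<omega> $ j) * tcnj (capp d (vn S l s \<omega> $ k))) = 0" for c d j k
    proof -
      let ?X = "\<lambda>\<omega>. capp c (vn S i t \<omega> $ j)" and ?Y = "\<lambda>\<omega>. capp d (vn S l s \<omega> $ k)"
      have L2: "tess_L2 M ?X" "tess_L2 M ?Y"
        using v_square_integrable by (auto simp: square_integrable_vec_iff intro: tess_L2_capp)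
      have p: "\<forall>\<mu> \<nu>. (\<integral>\<omega>. tpart \<mu> (?X \<omega>) * tpart \<nu> (?Y \<omega>) \<partial>M) = 0"
      proof safe
        fix \<mu> \<nu>
        obtain e e' where "\<forall>x. tpart \<mu> (capp c x) = e * tpart \<mu> x" "\<forall>x. tpart \<nu> (capp d x) = e' * tpart \<nu> x"
          using tpart_capp by metis
        then have "(\<lambda>\<omega>. tpart \<mu> (?X \<omega>) * tpart \<nu> (?Y \<omega>))
            = (\<lambda>\<omega>. (e * e') * (tpart \<mu> (vn S i t \<omega> $ j) * tpart \<nu> (vn S l s \<omega> $ k)))"
          by (simp add: fun_eq_iff)
        then show "(\<integral>\<omega>. tpart \<mu> (?X \<omega>) * tpart \<nu> (?Y \<omega>) \<partial>M) = 0" by (simp add: prod0)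
      qed
      have q: "\<forall>\<mu> \<nu>. integrable M (\<lambda>\<omega>. tpart \<mu> (?X \<omega>) * tpart \<nu> (?Y \<omega>))"
        using L2 by (intro allI integrable_mult_square_integrable) (auto simp: tess_L2_def)
      show ?thesis
        using p q unfolding all_part by (simp add: tess_eq_iff texp_def tess_sel_mult)
    qed
    then show ?thesis by (simp add: Gam_def aug_def vec_eq_iff)
  qed
  have "Gam M (vvec t) (vvec s) $ (i, p) $ (l, q) = (if t = s then Rvec S t else 0) $ (i, p) $ (l, q)"
    for i p l q
    using 0[of i l] v_white[of i t s]
    by (cases "i = l") (simp_all add: vvec_def[abs_def] Gam_stack_left Gam_stack_right Rvec_def
        block_diag_def block_mat_def)
  then show ?thesis by (simp add: vec_eq_iff)
qed

lemma Gam_u_v: "Gam M (ubar t) (vvec s) = (if t = s then Svec S t else 0)"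
proof -
  have "Gam M (ubar t) (vvec s) $ p $ (l, q) = (if t = s then Svec S t else 0) $ p $ (l, q)" for p l q
    using u_v_corr[of t l s]
    by (simp add: ubar_def[abs_def] vvec_def[abs_def] Gam_stack_right Svec_def block_row_def)
  then show ?thesis by (simp add: vec_eq_iff)
qed

lemma Gam_x_v: "s \<le> t \<Longrightarrow> Gam M (xbar s) (vvec t) = 0"
proof (induction s)
  case 0
  have "Gam M (xbar 0) (vvec t) $ p $ (l, q) = 0" for p l q
    using x0_v_uncorr[of l t] by (simp add: xbar_def[abs_def] vvec_def[abs_def] Gam_stack_right)
  then show ?case by (simp add: vec_eq_iff)
next
  case (Suc s)
  have "Gam M (xbar (Suc s)) (vvec t) = Gam M (\<lambda>\<omega>. Phibar S s *v xbar s \<omega> + ubar s \<omega>) (vvec t)"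
    by (intro Gam_cong xbar_Suc) auto
  then show ?case
    using Suc by (simp add: Gam_left sq matrix_distrib Gam_u_v)
qed

lemma Gam_v_x: "s \<le> t \<Longrightarrow> Gam M (vvec t) (xbar s) = 0"
  by (subst Gam_herm) (simp add: Gam_x_v)

lemma Gam_x_u: "s \<le> t \<Longrightarrow> Gam M (xbar s) (ubar t) = 0"
  by (subst Gam_herm) (simp add: Gam_u_x)

lemma Gam_v_u: "Gam M (vvec s) (ubar t) = (if t = s then herm (Svec S t) else 0)"
  by (subst Gam_herm) (simp add: Gam_u_v)

lemma Gam_x_x: "Gam M (xbar t) (xbar t) = Gx S t"
proof (induction t)
  case 0
  show ?case by (simp add: xbar_def[abs_def] P0bar_def)
next
  case (Suc t)
  have "Gam M (xbar (Suc t)) (xbar (Suc t)) = Gam M (\<lambda>\<omega>. Phibar S t *v xbar t \<omega> + ubar t \<omega>)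
      (\<lambda>\<omega>. Phibar S t *v xbar t \<omega> + ubar t \<omega>)"
    by (intro Gam_cong xbar_Suc) auto
  also have "\<dots> = Phibar S t ** Gx S t ** herm (Phibar S t) + Qbar S t"
    by (simp add: Gam_left Gam_right sq Suc Gam_u_x Gam_x_u Gam_u_u matrix_distrib
        matrix_mul_assoc)
  finally show ?case by simp
qed

text \<open>The mean of the dropout equation. Correlations of the measurements with signals and noises, which
  are all measurable with respect to \<open>past t\<close>, follow from it by induction on time.\<close>

lemma Gam_y_left:
  assumes t: "1 \<le> t" and X: "square_integrable_vec M X" "meas_vec (past t) X"
  shows "Gam M (yvec t) X
    = Gam M (yvec (t - 1)) X + Pibar_g S t ** (Gam M (zvec t) X - Gam M (yvec (t - 1)) X)"
proof -
  note sqh = square_integrable_vec_hvec[OF bounded_gvec[OF t] sq_dvec]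
  have "Gam M (yvec t) X
      = Gam M (\<lambda>\<omega>. yvec (t - 1) \<omega> + Ups *v hvec (gvec S t \<omega>) (dvec t \<omega>)) X"
    by (intro Gam_cong yvec_eq t) auto
  also have "\<dots> = Gam M (yvec (t - 1)) X + Ups ** Gam M (\<lambda>\<omega>. hvec (gvec S t \<omega>) (dvec t \<omega>)) X"
    by (simp add: Gam_left sq sqh X)
  also have "Gam M (\<lambda>\<omega>. hvec (gvec S t \<omega>) (dvec t \<omega>)) X = diag_mat (Eg S t) ** Gam M (dvec t) X"
    unfolding Eg_def by (intro Gam_hvec_left'[OF t] X sq_dvec dvec_past bounded_gvec[OF t] t)
  also have "Gam M (dvec t) X = herm Ups ** (Gam M (zvec t) X - Gam M (yvec (t - 1)) X)"
    unfolding dvec_def[abs_def] by (simp add: Gam_left sq X)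
  finally show ?thesis by (simp add: Pibar_g_def matrix_mul_assoc)
qed

text \<open>By \<open>Gam_y_left\<close>, vanishing correlation propagates from $z_1,\dots,z_s$ to the measurements, as
  the dropouts only mix these vectors.\<close>

lemma Gam_noise_y_eq_0:
  assumes X: "square_integrable_vec M X" "\<And>r. meas_vec (past r) X"
    and z: "\<And>r. 1 \<le> r \<Longrightarrow> r \<le> s \<Longrightarrow> Gam M (zvec r) X = 0"
  shows "Gam M (yvec s) X = 0"
  using z
proof (induction s)
  case 0 show ?case by (simp add: yvec_def[abs_def])
next
  case (Suc s)
  then show ?case by (subst Gam_y_left) (simp_all add: X matrix_distrib)
qed

lemma Gam_z_u: "s \<le> t \<Longrightarrow> Gam M (zvec s) (ubar t) = (if s = t then herm (Svec S t) else 0)"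
  unfolding zvec_def[abs_def] by (simp add: Gam_left sq Gam_x_u Gam_v_u matrix_distrib)

lemma Gam_y_u: "s < t \<Longrightarrow> Gam M (yvec s) (ubar t) = 0"
  by (rule Gam_noise_y_eq_0) (auto simp: sq un_past Gam_z_u)

lemma Gam_y_v: "s < t \<Longrightarrow> Gam M (yvec s) (vvec t) = 0"
  by (rule Gam_noise_y_eq_0)
    (auto simp: sq vn_past zvec_def[abs_def] Gam_left Gam_x_v Gam_v_v matrix_distrib)

lemma herm_Pibar_g [simp]: "herm (Pibar_g S t) = Pibar_g S t"
  by (simp add: Pibar_g_def herm_mult matrix_mul_assoc)

text \<open>The state noise at time $t$ sees $y(t)$ only through the simultaneous sensor noises that were
  actually received.\<close>

lemma Gam_u_y: "1 \<le> t \<Longrightarrow> Gam M (ubar t) (yvec t) = Svec S t ** Pibar_g S t"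
  by (subst Gam_herm, subst Gam_y_left)
    (auto simp: sq un_past Gam_z_u Gam_y_u matrix_distrib herm_mult)

lemma Gam_x_y_prev:
  assumes "1 \<le> t"
  shows "Gam M (xbar (Suc t)) (yvec t)
    = Phibar S t ** Gam M (xbar t) (yvec t) + Svec S t ** Pibar_g S t"
proof -
  have "Gam M (xbar (Suc t)) (yvec t) = Gam M (\<lambda>\<omega>. Phibar S t *v xbar t \<omega> + ubar t \<omega>) (yvec t)"
    by (intro Gam_cong xbar_Suc) auto
  then show ?thesis using assms by (simp add: Gam_left sq Gam_u_y)
qed

lemma Pibar_1g_eq: "Pibar_1g S t = mat 1 - Pibar_g S t"
  by (simp add: Pibar_1g_def Pibar_g_def diag_mat_diff diag_mat_ones matrix_distrib Ups_unitary)

lemma Eg_1: "Eg S 1 = (\<chi> a. 1)"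
proof -
  have "(\<integral>\<omega>. gvec S 1 \<omega> $ a \<partial>M) = (\<integral>\<omega>. 1 \<partial>M)" for a
    by (intro Bochner_Integration.integral_cong) (simp_all add: gvec_1 del: One_nat_def)
  then show ?thesis by (simp add: Eg_def prob_space del: One_nat_def)
qed

lemma Pibar_g_1: "Pibar_g S 1 = mat 1"
  by (simp add: Pibar_g_def Eg_1 diag_mat_ones Ups_unitary del: One_nat_def)

lemma Gam_x_y: "1 \<le> t \<Longrightarrow> Gam M (xbar t) (yvec t) = Gxy S t"
proof (induction t rule: nat_induct_at_least)
  case base
  have "Gam M (zvec 1) (xbar 1) = ones_kron ** Gx S 1"
    unfolding zvec_def[abs_def] by (simp add: Gam_left sq Gam_v_x Gam_x_x del: Gx.simps One_nat_def)
  moreover have "herm (Gx S 1) = Gx S 1" using Gam_herm Gam_x_x by metis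
  moreover have "Gam M (yvec 1) (xbar 1) = Gam M (zvec 1) (xbar 1)"
    by (intro Gam_cong yvec_1) auto
  ultimately have "herm (Gam M (yvec 1) (xbar 1)) = Gx S 1 ** transpose ones_kron"
    by (simp add: herm_mult del: Gx.simps One_nat_def)
  then show ?case by (subst Gam_herm) (simp del: Gx.simps)
next
  case (Suc t)
  obtain t' where t': "t = Suc t'" using Suc.hyps by (cases t) auto
  let ?T = "Suc t"
  have "Gam M (zvec ?T) (xbar ?T) = ones_kron ** Gx S ?T"
    unfolding zvec_def[abs_def] by (simp add: Gam_left sq Gam_v_x Gam_x_x del: Gx.simps)
  moreover have "herm (Gx S ?T) = Gx S ?T" using Gam_herm Gam_x_x by metis
  moreover have "Gam M (yvec t) (xbar ?T)
      = herm (Phibar S t ** Gxy S t + Svec S t ** Pibar_g S t)"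
    by (subst Gam_herm) (use Suc Gam_x_y_prev[of t] in simp)
  ultimately have "herm (Gam M (yvec ?T) (xbar ?T)) = Gx S ?T ** transpose ones_kron ** Pibar_g S ?T
     + (Phibar S t ** Gxy S t + Svec S t ** Pibar_g S t) ** Pibar_1g S ?T"
    by (subst Gam_y_left) (simp_all add: sq xbar_past herm_mult matrix_distrib Pibar_1g_eq
        matrix_mul_assoc algebra_simps del: Gx.simps)
  then show ?case by (subst Gam_herm) (simp add: t' del: Gx.simps)
qed

lemma Gam_x_y_prev': "2 \<le> t \<Longrightarrow> Gam M (xbar t) (yvec (t - 1))
    = Phibar S (t - 1) ** Gxy S (t - 1) + Svec S (t - 1) ** Pibar_g S (t - 1)"
  using Gam_x_y_prev[of "t - 1"] Gam_x_y[of "t - 1"] by (simp add: Suc_diff_le numeral_2_eq_2)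

lemma Gam_z_z: "Gam M (zvec t) (zvec t) = ones_kron ** Gx S t ** transpose ones_kron + Rvec S t"
  unfolding zvec_def[abs_def]
  by (simp add: Gam_left Gam_right sq Gam_v_x Gam_x_v Gam_x_x Gam_v_v matrix_distrib matrix_mul_assoc)

lemma Gam_z_y_prev: "2 \<le> t \<Longrightarrow> herm Ups ** Gam M (zvec t) (yvec (t - 1)) ** Ups = Psi2 S t"
proof -
  assume t: "2 \<le> t"
  have "Gam M (vvec t) (yvec (t - 1)) = 0" using t by (subst Gam_herm) (simp add: Gam_y_v)
  then have "Gam M (zvec t) (yvec (t - 1)) = ones_kron ** Gam M (xbar t) (yvec (t - 1))"
    unfolding zvec_def[abs_def] by (simp add: Gam_left sq)
  then show ?thesis by (simp add: Psi2_def Gam_x_y_prev'[OF t] matrix_mul_assoc del: One_nat_def)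
qed

text \<open>Here $y_t = \Upsilon(\gamma\circ\Upsilon^H z_t + (1-\gamma)\circ\Upsilon^H y_{t-1})$ is the
  convenient form: the four products of its two summands are the four Hadamard terms of the
  recursion.\<close>

lemma Gam_y_y: "1 \<le> t \<Longrightarrow> Gam M (yvec t) (yvec t) = Gy S t"
proof (induction t rule: nat_induct_at_least)
  case base
  have "Gam M (yvec 1) (yvec 1) = Gam M (zvec 1) (zvec 1)"
    by (intro Gam_cong yvec_1) auto
  then show ?case by (simp add: Gam_z_z)
next
  case (Suc t)
  obtain t' where t': "t = Suc t'" using Suc.hyps by (cases t) auto
  let ?T = "Suc t"
  have T: "1 \<le> ?T" "2 \<le> ?T" using Suc.hyps by auto
  define A where "A = (\<lambda>\<omega>. hvec (gvec S ?T \<omega>) (herm Ups *v zvec ?T \<omega>))"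
  define B where "B = (\<lambda>\<omega>. hvec ((\<chi> a. 1) - gvec S ?T \<omega>) (herm Ups *v yvec t \<omega>))"
  have bB: "bounded_rv M (now ?T) (\<lambda>\<omega>. (\<chi> a. 1) - gvec S ?T \<omega>)" by (rule bounded_gvec_diff(2)) simp
  have sqW: "square_integrable_vec M (\<lambda>\<omega>. herm Ups *v zvec ?T \<omega>)"
    "square_integrable_vec M (\<lambda>\<omega>. herm Ups *v yvec t \<omega>)" by (auto simp: sq)
  have pW: "meas_vec (past ?T) (\<lambda>\<omega>. herm Ups *v zvec ?T \<omega>)"
    "meas_vec (past ?T) (\<lambda>\<omega>. herm Ups *v yvec t \<omega>)"
    by (auto intro!: meas_vec_intros zvec_past yvec_past)
  have sqAB: "square_integrable_vec M A" "square_integrable_vec M B"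
    unfolding A_def B_def
    by (auto intro!: square_integrable_vec_hvec[OF bounded_gvec] square_integrable_vec_hvec[OF bB] sqW)
  have "Gam M (yvec ?T) (yvec ?T) = Gam M (\<lambda>\<omega>. Ups *v (A \<omega> + B \<omega>)) (\<lambda>\<omega>. Ups *v (A \<omega> + B \<omega>))"
  proof -
    have "yvec ?T \<omega> = Ups *v (A \<omega> + B \<omega>)" if "\<omega> \<in> space M" for \<omega>
    proof -
      have "yvec t \<omega> = Ups *v (herm Ups *v yvec t \<omega>)"
        by (simp add: matrix_vector_mul_assoc Ups_unitary)
      then show ?thesis
        using that by (subst yvec_eq) (simp_all add: A_def B_def dvec_def matrix_vector_distrib hvec_linear)
    qed
    then show ?thesis by (intro Gam_cong) auto
  qed
  also have "\<dots> = Ups ** (Gam M A A + Gam M A B + Gam M B A + Gam M B B) ** herm Ups"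
    by (simp add: Gam_left Gam_right sqAB sq matrix_distrib matrix_mul_assoc)
  also have "Gam M A A = Gam_g S ?T \<odot> (Psi1 S ?T + herm Ups ** Rvec S ?T ** Ups)"
    unfolding A_def Gam_g_def
    by (subst Gam_hvec_hvec'[OF T(1)]) (simp_all add: bounded_gvec sqW pW Gam_left Gam_right sq Gam_z_z Psi1_def
        matrix_distrib matrix_mul_assoc del: Gx.simps)
  also have "Gam M A B = Gam_g1 S ?T \<odot> Psi2 S ?T"
    unfolding A_def B_def Gam_g1_def
    using Gam_z_y_prev[OF T(2)]
    by (subst Gam_hvec_hvec'[OF T(1)]) (simp_all add: bounded_gvec bB sqW pW Gam_left Gam_right sq
        matrix_mul_assoc)
  also have "Gam M B A = transpose (Gam_g1 S ?T) \<odot> herm (Psi2 S ?T)"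
  proof -
    have "rGam M (\<lambda>\<omega>. (\<chi> a. 1) - gvec S ?T \<omega>) (gvec S ?T) = transpose (Gam_g1 S ?T)"
      by (simp add: rGam_def Gam_g1_def transpose_def vec_eq_iff mult.commute)
    moreover have "herm Ups ** Gam M (yvec t) (zvec ?T) ** Ups = herm (Psi2 S ?T)"
      unfolding Gam_z_y_prev[OF T(2), symmetric]
      by (subst Gam_herm) (simp add: herm_mult matrix_mul_assoc)
    ultimately show ?thesis
      unfolding A_def B_def
      by (subst Gam_hvec_hvec'[OF T(1)]) (simp_all add: bounded_gvec bB sqW pW Gam_left Gam_right sq
          matrix_mul_assoc)
  qed
  also have "Gam M B B = Gam_11 S ?T \<odot> (herm Ups ** Gy S t ** Ups)"
    unfolding B_def Gam_11_def
    by (subst Gam_hvec_hvec'[OF T(1)]) (simp_all add: bB sqW pW Gam_left Gam_right sq Suc matrix_mul_assoc)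
  finally show ?case by (simp add: t' Let_def del: Gx.simps)
qed

end

section \<open>The innovations argument for a reduced system\<close>

text \<open>The reduction of a vector stacked over the sensors.\<close>

definition sel_lead ::
  "('k::finite, 'n::finite, 'r::finite) reduction \<Rightarrow> tess^('r \<times> invol \<times> 'n)^('r \<times> 'k \<times> 'n)" where
  "sel_lead K = kron (mat 1) (leading K)"

lemma leading_kron:
  "leading K = kron (\<chi> a c. if blk K a = c then 1 else 0) (mat 1)"
  by (auto simp: vec_eq_iff leading_def kron_def mat_def)

lemma leading_vec: "(leading K *v v) $ (a, j) = v $ (blk K a, j)"
  by (simp add: leading_kron kron_mat_1_right_vec if_distrib [of "\<lambda>c. c * _"] cong: if_cong)

lemma red_eq: "red K w = leading K *v aug w"
proof -
  have "red K w $ (a, j) = (leading K *v aug w) $ (a, j)" for a j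
    by (simp add: red_def leading_vec aug_def)
  then show ?thesis by (simp add: vec_eq_iff)
qed

text \<open>The rows of $\mathcal A$ kept in $\mathcal B_k$ are those of the selected blocks.\<close>

lemma Upsk_eq: "Upsk K = sel_lead K ** Ups"
proof -
  have "(\<chi> a c. if blk K a = c then 1 else 0) ** ((1 / 2) *\<^sub>R calA)
      = (1 / 2) *\<^sub>R (\<chi> a. calA $ blk K a)"
    by (simp add: vec_eq_iff matrix_matrix_mult_def if_distrib [of "\<lambda>c. c * _"]
        scaleR_sum_right[symmetric] cong: if_cong)
  then show ?thesis
    by (simp add: Upsk_def sel_lead_def Ups_def calT_def leading_kron kron_mult)
qed

lemma herm_leading [simp]: "herm (leading K) = transpose (leading K)"
  by (simp add: vec_eq_iff herm_nth leading_def transpose_def)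

lemma herm_first_block [simp]: "herm (first_block K) = transpose (first_block K)"
  by (simp add: vec_eq_iff herm_nth first_block_def transpose_def)

lemma sel_lead_ones_kron: "sel_lead K ** ones_kron = ones_kron ** leading K"
  by (simp add: sel_lead_def kron_mat_1_ones_kron)

lemma leading_leading:
  assumes "inj (blk K)" shows "leading K ** herm (leading K) = mat 1"
proof -
  let ?R = "(\<chi> a c. if blk K a = c then 1 else 0) :: tess^invol^'a"
  have "?R ** herm ?R = mat 1"
    using assms by (auto simp: vec_eq_iff matrix_matrix_mult_def herm_nth mat_def inj_eq
        if_distrib [of "\<lambda>c. c * _"] cong: if_cong)
  then show ?thesis by (simp add: leading_kron herm_kron kron_mult)
qed

lemma sel_lead_sel_lead: "inj (blk K) \<Longrightarrow> sel_lead K ** herm (sel_lead K) = mat 1"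
  by (simp only: sel_lead_def herm_kron kron_mult leading_leading herm_hom matrix_mul_lid kron_mat_1)

text \<open>The two commutation rules say that the selected blocks evolve, and on average drop out,
  without reference to the other blocks. The state itself is read off from the reduced state because
  \<open>CId\<close> is among the selected blocks.\<close>

locale reduced_system = tessarine_system S
  for S :: "('w, 'n::finite, 'r::finite) dropout_system" +
  fixes K :: "('k::finite, 'n, 'r) reduction"
  assumes inj_blk: "inj (blk K)"
    and CId_blk: "CId \<in> range (blk K)"
    and leading_Phibar: "\<And>t. leading K ** Phibar S t = Phik K t ** leading K"
    and sel_lead_Pibar: "\<And>t. 1 \<le> t \<Longrightarrow> sel_lead K ** Pibar_g S t = Pik K t ** sel_lead K"
begin

definition xk :: "nat \<Rightarrow> 'w \<Rightarrow> tess^('k \<times> 'n)" where "xk t \<omega> = leading K *v xbar t \<omega>"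
definition uk :: "nat \<Rightarrow> 'w \<Rightarrow> tess^('k \<times> 'n)" where "uk t \<omega> = leading K *v ubar t \<omega>"
definition vk :: "nat \<Rightarrow> 'w \<Rightarrow> tess^('r \<times> 'k \<times> 'n)" where "vk t \<omega> = sel_lead K *v vvec t \<omega>"

lemma sel_lead_stack: "sel_lead K *v stack (\<lambda>i. aug (w i)) = stack (\<lambda>i. red K (w i))"
proof -
  have "(sel_lead K *v stack (\<lambda>i. aug (w i))) $ (i, p) = stack (\<lambda>i. red K (w i)) $ (i, p)" for i p
    by (simp add: sel_lead_def kron_mat_1_vec red_eq stack_def)
  then show ?thesis by (simp add: vec_eq_iff)
qed

lemma yk_eq: "1 \<le> t \<Longrightarrow> yk K S t \<omega> = sel_lead K *v yvec t \<omega>"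
  by (simp add: yvec_def sel_lead_stack) (simp add: yk_def stack_def)

lemma Pik_eq: "1 \<le> t \<Longrightarrow> Pik K t = sel_lead K ** Pibar_g S t ** herm (sel_lead K)"
  by (simp add: sel_lead_Pibar sel_lead_sel_lead inj_blk flip: matrix_mul_assoc)

text \<open>Being a principal submatrix of the Hermitian mean dropout matrix, $\Pi_k$ is Hermitian; the
  algorithm therefore writes no adjoint on it.\<close>

lemma herm_Pik: "1 \<le> t \<Longrightarrow> herm (Pik K t) = Pik K t"
  by (simp add: Pik_eq herm_mult matrix_mul_assoc)

lemma Pik_1: "Pik K 1 = mat 1"
  using Pik_eq[of 1] Pibar_g_1 by (simp add: sel_lead_sel_lead inj_blk)

lemma xk_Suc: "\<omega> \<in> space M \<Longrightarrow> xk (Suc t) \<omega> = Phik K t *v xk t \<omega> + uk t \<omega>"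
  by (simp add: xk_def uk_def xbar_Suc matrix_vector_distrib matrix_vector_mul_assoc leading_Phibar)

lemma st_eq_first_block: "st S t \<omega> = first_block K *v xk t \<omega>"
proof -
  obtain a where a: "blk K a = CId" using CId_blk by (metis rangeE)
  have "blk K b = CId \<longleftrightarrow> b = a" for b using a inj_blk by (metis injD)
  then have "first_block K $ i $ b = (if b = (a, i) then 1 else 0)" for i b
    by (cases b) (simp add: first_block_def)
  then have "(first_block K *v xk t \<omega>) $ i = xk t \<omega> $ (a, i)" for i
    by (simp add: matrix_vector_mult_def if_distrib [of "\<lambda>c. c * _"] cong: if_cong)
  then show ?thesis by (simp add: vec_eq_iff xk_def leading_vec xbar_def aug_def a)
qed

lemma sq_xk: "square_integrable_vec M (xk t)" and sq_uk: "square_integrable_vec M (uk t)"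
  and sq_vk: "square_integrable_vec M (vk t)"
  unfolding xk_def[abs_def] uk_def[abs_def] vk_def[abs_def] by (intro sq)+

lemma xk_past: "meas_vec (past t) (xk s)" and vk_past: "meas_vec (past t) (vk s)"
  and uk_past: "meas_vec (past t) (uk s)"
  unfolding xk_def[abs_def] uk_def[abs_def] vk_def[abs_def]
  by (intro meas_vec_intros xbar_past un_past vn_past)+

lemma yk_eq': "1 \<le> t \<Longrightarrow> yk K S t = (\<lambda>\<omega>. sel_lead K *v yvec t \<omega>)"
  using yk_eq by auto

lemma sq_yk: "1 \<le> t \<Longrightarrow> square_integrable_vec M (yk K S t)"
  by (simp add: yk_eq' sq)

lemma yk_past: "1 \<le> s \<Longrightarrow> s < t \<Longrightarrow> meas_vec (past t) (yk K S s)"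
  by (simp add: yk_eq' meas_vec_intros yvec_past)

text \<open>The combinations of $y_k(1),\dots,y_k(t-1)$, as functions on the whole sample space, and the
  vectors orthogonal to these observations. With \<open>Suc t\<close> in place of $t$ the two conditions are
  those defining an LLMS estimator from the observations up to time $t$.\<close>

definition lin_past :: "nat \<Rightarrow> ('w \<Rightarrow> tess^'m) \<Rightarrow> bool" where
  "lin_past t X \<longleftrightarrow> (\<exists>A. X = (\<lambda>\<omega>. \<Sum>s\<in>{1..<t}. A s *v yk K S s \<omega>))"

definition orth_past :: "nat \<Rightarrow> ('w \<Rightarrow> tess^'m) \<Rightarrow> bool" where
  "orth_past t X \<longleftrightarrow> (\<forall>s\<in>{1..<t}. Gam M X (yk K S s) = 0)"

lemma lin_past_yk: "1 \<le> s \<Longrightarrow> s < t \<Longrightarrow> lin_past t (yk K S s)"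
  unfolding lin_past_def
  by (intro exI[of _ "\<lambda>r. if r = s then mat 1 else 0"])
    (auto simp: if_distrib[of "\<lambda>A. A *v _"] matrix_vector_distrib cong: if_cong)

lemma lin_past_zero: "lin_past t (\<lambda>\<omega>. 0)"
  unfolding lin_past_def by (intro exI[of _ "\<lambda>r. 0"]) (simp add: matrix_vector_distrib)

lemma lin_past_add: "lin_past t X \<Longrightarrow> lin_past t Y \<Longrightarrow> lin_past t (\<lambda>\<omega>. X \<omega> + Y \<omega>)"
  unfolding lin_past_def
proof safe
  fix A B :: "nat \<Rightarrow> tess^('r \<times> 'k \<times> 'n)^'m"
  show "\<exists>C. (\<lambda>\<omega>. (\<Sum>s\<in>{1..<t}. A s *v yk K S s \<omega>) + (\<Sum>s\<in>{1..<t}. B s *v yk K S s \<omega>))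
      = (\<lambda>\<omega>. \<Sum>s\<in>{1..<t}. C s *v yk K S s \<omega>)"
    by (intro exI[of _ "\<lambda>s. A s + B s"]) (simp add: matrix_vector_distrib sum.distrib)
qed

lemma lin_past_diff: "lin_past t X \<Longrightarrow> lin_past t Y \<Longrightarrow> lin_past t (\<lambda>\<omega>. X \<omega> - Y \<omega>)"
  unfolding lin_past_def
proof safe
  fix A B :: "nat \<Rightarrow> tess^('r \<times> 'k \<times> 'n)^'m"
  show "\<exists>C. (\<lambda>\<omega>. (\<Sum>s\<in>{1..<t}. A s *v yk K S s \<omega>) - (\<Sum>s\<in>{1..<t}. B s *v yk K S s \<omega>))
      = (\<lambda>\<omega>. \<Sum>s\<in>{1..<t}. C s *v yk K S s \<omega>)"
    by (intro exI[of _ "\<lambda>s. A s - B s"]) (simp add: matrix_vector_distrib sum_subtractf)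
qed

lemma lin_past_mult:
  fixes D :: "tess^'m^'q"
  shows "lin_past t X \<Longrightarrow> lin_past t (\<lambda>\<omega>. D *v X \<omega>)"
  unfolding lin_past_def
proof safe
  fix A :: "nat \<Rightarrow> tess^('r \<times> 'k \<times> 'n)^'m"
  show "\<exists>C. (\<lambda>\<omega>. D *v (\<Sum>s\<in>{1..<t}. A s *v yk K S s \<omega>)) = (\<lambda>\<omega>. \<Sum>s\<in>{1..<t}. C s *v yk K S s \<omega>)"
    by (intro exI[of _ "\<lambda>s. D ** A s"]) (simp add: matrix_vector_sum matrix_vector_mul_assoc)
qed

lemma lin_past_mono:
  assumes "lin_past t X" "t \<le> t'" shows "lin_past t' X"
proof -
  obtain A where A: "X = (\<lambda>\<omega>. \<Sum>s\<in>{1..<t}. A s *v yk K S s \<omega>)" using assms by (auto simp: lin_past_def)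
  have "(\<Sum>s\<in>{1..<t}. A s *v yk K S s \<omega>)
      = (\<Sum>s\<in>{1..<t'}. (if s < t then A s else 0) *v yk K S s \<omega>)" for \<omega>
    using assms(2) by (intro sum.mono_neutral_cong_left) (auto simp: matrix_vector_distrib)
  then show ?thesis unfolding lin_past_def A by (intro exI) auto
qed

lemmas lin_past_intros = lin_past_add lin_past_diff lin_past_mult

lemma sq_lin_past: "lin_past t X \<Longrightarrow> square_integrable_vec M X"
  by (auto simp: lin_past_def intro!: sq sq_yk)

lemma meas_lin_past: "lin_past t X \<Longrightarrow> meas_vec (past t) X"
proof -
  assume "lin_past t X"
  then obtain A where A: "X = (\<lambda>\<omega>. \<Sum>s\<in>{1..<t}. A s *v yk K S s \<omega>)" by (auto simp: lin_past_def)
  have "meas_vec (past t) (\<lambda>\<omega>. \<Sum>s\<in>I. A s *v yk K S s \<omega>)" if "I \<subseteq> {1..<t}" for I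
    using that by (induction I rule: infinite_finite_induct) (auto intro!: meas_vec_intros yk_past)
  then show ?thesis unfolding A by simp
qed

lemma orth_lin_past:
  assumes "orth_past t X" "lin_past t Y" "square_integrable_vec M X"
  shows "Gam M X Y = 0"
proof -
  obtain A where A: "Y = (\<lambda>\<omega>. \<Sum>s\<in>{1..<t}. A s *v yk K S s \<omega>)" using assms by (auto simp: lin_past_def)
  show ?thesis unfolding A
    using assms by (intro Gam_sum_right_eq_0) (auto simp: orth_past_def intro: sq_yk)
qed

lemma orth_past_noise:
  "orth_past t (uk t)" "orth_past t (vk t)"
proof -
  have *: "s < t \<Longrightarrow> Gam M (ubar t) (yvec s) = 0" "s < t \<Longrightarrow> Gam M (vvec t) (yvec s) = 0" for s
    by (subst Gam_herm, simp add: Gam_y_u Gam_y_v)+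
  show "orth_past t (uk t)" "orth_past t (vk t)"
    unfolding orth_past_def uk_def[abs_def] vk_def[abs_def]
    by (simp_all add: yk_eq' Gam_left Gam_right sq * matrix_distrib)
qed

definition err :: "nat \<Rightarrow> 'w \<Rightarrow> tess^('k \<times> 'n)" where "err t \<omega> = xk t \<omega> - xpred K S t \<omega>"

definition ferr :: "nat \<Rightarrow> 'w \<Rightarrow> tess^('k \<times> 'n)" where "ferr t \<omega> = xk t \<omega> - xfilt K S t \<omega>"

text \<open>Time 1 is covered too: there $\Pi_k = I$ and $P_k(1|0) = D_k(1)$.\<close>

lemma Theta_eq: "1 \<le> t \<Longrightarrow> Theta K S t = Ppred K S t ** transpose ones_kron ** Pik K t"
proof -
  have "block_row (\<lambda>i. D) = D ** transpose (ones_kron :: tess^('k \<times> 'n)^('r \<times> 'k \<times> 'n))" for D :: "tess^('k \<times> 'n)^('k \<times> 'n)"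
    by (simp add: vec_eq_iff block_row_def matrix_matrix_mult_def transpose_def ones_kron_def
        if_distrib [of "\<lambda>c. _ * c"] cong: if_cong)
  then show ?thesis using Pik_1 by (simp add: Theta_def Theta_of_def)
qed

lemma innov_eq:
  assumes "1 \<le> t"
  shows "innov K S t \<omega> = yk K S t \<omega> - Pik K t *v (ones_kron *v xpred K S t \<omega>)
     - (mat 1 - Pik K t) *v (sel_lead K *v yvec (t - 1) \<omega>)"
proof (cases "t = 1")
  case True
  then show ?thesis by (simp add: innov_def innov_of_def matrix_vector_distrib yvec_0)
next
  case False
  then show ?thesis using assms by (simp add: innov_def innov_of_def yk_eq)
qed

text \<open>The part of the innovation due to the randomness of the dropouts.\<close>

definition wvec :: "nat \<Rightarrow> 'w \<Rightarrow> tess^('r \<times> part \<times> 'n)" where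
  "wvec t \<omega> = hvec (gvec S t \<omega> - Eg S t) (dvec t \<omega>)"

text \<open>Replacing $\gamma$ by its mean in the dropout equation and selecting blocks turns the mean dropout matrix
  into $\Pi_k$. What the algorithm subtracts from $y_k(t)$ is then exactly the predictable part, and
  the remainder is the fluctuation \<open>wvec\<close> plus the error of predicting $z_k(t)$.\<close>

lemma innov_split:
  assumes t: "1 \<le> t" and \<omega>: "\<omega> \<in> space M"
  shows "innov K S t \<omega> = Upsk K *v wvec t \<omega> + Pik K t *v (ones_kron *v err t \<omega> + vk t \<omega>)"
proof -
  have "sel_lead K *v (Ups *v hvec (Eg S t) (dvec t \<omega>))
      = Pik K t *v (sel_lead K *v (zvec t \<omega> - yvec (t - 1) \<omega>))"
    by (simp add: hvec_diag dvec_def matrix_vector_mul_assoc matrix_mul_assoc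
        flip: sel_lead_Pibar[OF t]) (simp add: Pibar_g_def matrix_mul_assoc)
  moreover have "sel_lead K *v zvec t \<omega> = ones_kron *v xk t \<omega> + vk t \<omega>"
    by (simp add: zvec_def xk_def vk_def matrix_vector_distrib matrix_vector_mul_assoc sel_lead_ones_kron)
  moreover have "yk K S t \<omega> = sel_lead K *v yvec (t - 1) \<omega> + Upsk K *v wvec t \<omega>
      + sel_lead K *v (Ups *v hvec (Eg S t) (dvec t \<omega>))"
    by (simp add: yk_eq[OF t] yvec_eq[OF t \<omega>] wvec_def hvec_linear matrix_vector_distrib Upsk_eq
        flip: matrix_vector_mul_assoc)
  ultimately show ?thesis
    by (simp add: innov_eq[OF t] err_def matrix_vector_distrib algebra_simps)
qed

lemma sq_wvec: "1 \<le> t \<Longrightarrow> square_integrable_vec M (wvec t)"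
  unfolding wvec_def[abs_def] by (intro square_integrable_vec_hvec[OF bounded_gvec_diff(1)] sq_dvec)

text \<open>The factor $\gamma - E\gamma$ has mean zero and is independent of \<open>past t\<close>.\<close>

lemma Gam_wvec:
  assumes t: "1 \<le> t" and X: "square_integrable_vec M X" "meas_vec (past t) X"
  shows "Gam M (wvec t) X = 0" "Gam M X (wvec t) = 0"
proof -
  have "(\<integral>\<omega>. (gvec S t \<omega> - Eg S t) $ a \<partial>M) = 0" for a
    using bounded_rv_integrable(1)[OF bounded_gvec[OF t] bounded_gvec[OF t]]
    by (simp add: Eg_def prob_space)
  then have "diag_mat (\<chi> a. \<integral>\<omega>. (gvec S t \<omega> - Eg S t) $ a \<partial>M) = 0"
    by (simp add: diag_mat_def vec_eq_iff)
  then show "Gam M (wvec t) X = 0"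
    unfolding wvec_def[abs_def]
    by (subst Gam_hvec_left'[OF t bounded_gvec_diff(1)[OF t] sq_dvec dvec_past[OF t] X])
      (simp add: matrix_distrib)
  then show "Gam M X (wvec t) = 0" by (subst Gam_herm) simp
qed

lemma Gam_dvec: "2 \<le> t \<Longrightarrow> Gam M (dvec t) (dvec t)
    = Psi1 S t + herm Ups ** Rvec S t ** Ups - Psi2 S t - herm (Psi2 S t) + Psi3 S t"
proof -
  assume t: "2 \<le> t"
  have "herm Ups ** Gam M (yvec (t - 1)) (zvec t) ** Ups = herm (Psi2 S t)"
    unfolding Gam_z_y_prev[OF t, symmetric] by (subst Gam_herm) (simp add: herm_mult matrix_mul_assoc)
  moreover have "herm Ups ** Gam M (yvec (t - 1)) (yvec (t - 1)) ** Ups = Psi3 S t"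
    using t Gam_y_y[of "t - 1"] by (simp add: Psi3_def)
  moreover have "herm Ups ** Gam M (zvec t) (zvec t) ** Ups = Psi1 S t + herm Ups ** Rvec S t ** Ups"
    by (simp add: Gam_z_z Psi1_def matrix_distrib matrix_mul_assoc)
  moreover note Gam_z_y_prev[OF t]
  ultimately show ?thesis
    unfolding dvec_def[abs_def]
    by (simp add: Gam_left Gam_right sq matrix_distrib matrix_mul_assoc algebra_simps)
qed

text \<open>$E[\gamma\gamma^T] = \mathrm{Cov}(\gamma) + E[\gamma]E[\gamma]^T$, and the Hadamard product with
  a matrix of rank one is a product with two diagonal matrices.\<close>

lemma Cov_g_eq:
  assumes t: "1 \<le> t"
  shows "Gam_g S t \<odot> Q = Cov_g S t \<odot> Q + diag_mat (Eg S t) ** Q ** diag_mat (Eg S t)"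
proof -
  note i = bounded_rv_integrable[OF bounded_gvec[OF t] bounded_gvec[OF t]]
  have c: "Cov_g S t $ a $ b = Gam_g S t $ a $ b - Eg S t $ a * Eg S t $ b" for a b
    using i by (simp add: Cov_g_def Gam_g_def rGam_def Eg_def algebra_simps prob_space)
  have "(A ** diag_mat v) $ a $ b = (v $ b) *\<^sub>R A $ a $ b" for A :: "tess^('r \<times> part \<times> 'n)^('r \<times> part \<times> 'n)" and v a b
    by (simp add: diag_mat_def matrix_matrix_mult_def scaleR_conv_of_real
      if_distrib [of "\<lambda>c. _ * c"] mult.commute cong: if_cong)
  then show ?thesis
    by (simp add: vec_eq_iff hadamard_def diag_mat_mult_nth c algebra_simps)
qed

lemma Cov_g_1: "Cov_g S 1 = 0"
proof -
  have "(\<integral>\<omega>. (gvec S 1 \<omega> $ a - 1) * (gvec S 1 \<omega> $ b - 1) \<partial>M) = (\<integral>\<omega>. 0 \<partial>M)" for a b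
    by (intro Bochner_Integration.integral_cong) (simp_all add: gvec_1 del: One_nat_def)
  then show ?thesis by (simp add: Cov_g_def rGam_def Eg_1 vec_eq_iff del: One_nat_def)
qed

lemma Gam_vk_vk: "Gam M (vk t) (vk t) = sel_lead K ** Rvec S t ** herm (sel_lead K)"
  unfolding vk_def[abs_def] by (simp add: Gam_left Gam_right sq Gam_v_v matrix_mul_assoc)

text \<open>The formula of the algorithm distributes the sensor noise over two terms. By \<open>Cov_g_eq\<close> its
  term $\Gamma_{\vec\gamma^r} \circ (\Upsilon^H\vec R\Upsilon)$ consists of the missing summand of
  \<open>Gam M (dvec t) (dvec t)\<close> and of the received part of the correlation matrix of $v_k$. At time 1
  the covariance of $\gamma$ vanishes, in agreement with the value 0 taken there for the first
  term.\<close>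

lemma Omega_eq:
  assumes t: "1 \<le> t"
  shows "Omega K S t = Upsk K ** (Cov_g S t \<odot> Gam M (dvec t) (dvec t)) ** herm (Upsk K)
     + Pik K t ** (ones_kron ** Ppred K S t ** transpose ones_kron + Gam M (vk t) (vk t)) ** Pik K t"
proof -
  let ?U = "herm Ups ** Rvec S t ** Ups"
  have P: "Upsk K ** diag_mat (Eg S t) ** herm Ups = Pik K t ** sel_lead K"
    by (simp add: sel_lead_Pibar[OF t, symmetric] Upsk_eq Pibar_g_def matrix_mul_assoc)
  have P': "Ups ** diag_mat (Eg S t) ** herm (Upsk K) = herm (sel_lead K) ** Pik K t"
    using arg_cong[OF P, of herm] by (simp add: herm_mult matrix_mul_assoc herm_Pik[OF t])
  have "Upsk K ** (diag_mat (Eg S t) ** ?U ** diag_mat (Eg S t)) ** herm (Upsk K)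
      = (Upsk K ** diag_mat (Eg S t) ** herm Ups) ** Rvec S t ** (Ups ** diag_mat (Eg S t) ** herm (Upsk K))"
    by (simp only: matrix_mul_assoc)
  also have "\<dots> = Pik K t ** Gam M (vk t) (vk t) ** Pik K t"
    by (simp only: P P' Gam_vk_vk matrix_mul_assoc)
  finally have R: "Upsk K ** (Gam_g S t \<odot> ?U) ** herm (Upsk K)
      = Upsk K ** (Cov_g S t \<odot> ?U) ** herm (Upsk K) + Pik K t ** Gam M (vk t) (vk t) ** Pik K t"
    by (simp add: Cov_g_eq[OF t] matrix_distrib)
  show ?thesis
  proof (cases "t = 1")
    case True
    then show ?thesis
      unfolding Omega_def Omega_of_def R
      by (simp add: matrix_distrib matrix_mul_assoc Cov_g_1[unfolded One_nat_def] hadamard_linear)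
  next
    case False
    then have "2 \<le> t" using t by simp
    with False show ?thesis
      unfolding Omega_def Omega_of_def R
      by (simp add: matrix_distrib matrix_mul_assoc Gam_dvec hadamard_linear)
  qed
qed

lemma Gam_uk_vk: "Gam M (uk t) (vk t) = Sk K S t"
proof -
  have "Gam M (uk t) (vk t) = Gam M (\<lambda>\<omega>. red K (un S t \<omega>)) (\<lambda>\<omega>. stack (\<lambda>i. red K (vn S i t \<omega>)))"
    by (simp add: uk_def[abs_def] vk_def[abs_def] ubar_def vvec_def sel_lead_stack red_eq)
  moreover have "\<dots> $ p $ (i, q) = Sk K S t $ p $ (i, q)" for p i q
    by (simp add: Gam_stack_right Sk_def block_row_def)
  ultimately show ?thesis by (simp add: vec_eq_iff)
qed

lemma Gam_uk_uk: "Gam M (uk t) (uk t) = Qk K S t"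
  by (simp add: Qk_def uk_def[abs_def] ubar_def red_eq)

text \<open>The induction hypothesis: the algorithm's one-step prediction is the LLMS predictor of $x_k(t)$, and
  \<open>Ppred\<close> is the correlation matrix of its error.\<close>

definition predictor_inv :: "nat \<Rightarrow> bool" where
  "predictor_inv t \<longleftrightarrow> lin_past t (xpred K S t) \<and> orth_past t (err t)
     \<and> Gam M (err t) (err t) = Ppred K S t"

lemma predictor_inv_1: "predictor_inv 1"
  unfolding predictor_inv_def
proof (intro conjI)
  have 0: "xpred K S 1 = (\<lambda>\<omega>. 0)" by auto
  show "lin_past 1 (xpred K S 1)" by (simp only: 0 lin_past_zero)
  show "orth_past 1 (err 1)" by (simp add: orth_past_def)
  have "err 1 = (\<lambda>\<omega>. leading K *v xbar 1 \<omega>)" by (simp add: err_def[abs_def] xk_def)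
  then show "Gam M (err 1) (err 1) = Ppred K S 1"
    by (simp add: Gam_left Gam_right sq Gam_x_x Dk_def matrix_mul_assoc del: Gx.simps)
qed

context
  fixes t :: nat
  assumes t: "1 \<le> t" and inv: "predictor_inv t"
begin

lemma sq_err: "square_integrable_vec M (err t)" and err_past: "meas_vec (past t) (err t)"
  and lin_xpred: "lin_past t (xpred K S t)" and orth_err: "orth_past t (err t)"
  and Gam_err_err: "Gam M (err t) (err t) = Ppred K S t"
  using inv sq_lin_past meas_lin_past unfolding predictor_inv_def err_def[abs_def]
  by (auto intro!: sq_xk sq xk_past meas_vec_intros)

lemma sq_innov: "square_integrable_vec M (innov K S t)"
  by (subst square_integrable_vec_cong[OF innov_split[OF t]], assumption)
    (intro sq sq_wvec[OF t] sq_err sq_vk)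

lemma lin_yprev: "lin_past t (\<lambda>\<omega>. sel_lead K *v yvec (t - 1) \<omega>)"
proof (cases "t = 1")
  case True
  then show ?thesis by (simp add: yvec_0 matrix_vector_distrib lin_past_zero)
next
  case False
  then show ?thesis using t lin_past_yk[of "t - 1" t] by (simp add: yk_eq')
qed

text \<open>The innovation differs from the new observation by a combination of old ones, so testing
  orthogonality against either of them is the same for vectors orthogonal to the old ones.\<close>

lemma lin_yk_innov: "lin_past t (\<lambda>\<omega>. yk K S t \<omega> - innov K S t \<omega>)"
proof -
  have "(\<lambda>\<omega>. yk K S t \<omega> - innov K S t \<omega>) = (\<lambda>\<omega>. Pik K t *v (ones_kron *v xpred K S t \<omega>)
     + (mat 1 - Pik K t) *v (sel_lead K *v yvec (t - 1) \<omega>))"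
    by (simp add: fun_eq_iff innov_eq[OF t])
  then show ?thesis by (simp only:) (intro lin_past_intros lin_xpred lin_yprev)
qed

lemma lin_innov: "lin_past (Suc t) (innov K S t)"
proof -
  have "lin_past (Suc t) (\<lambda>\<omega>. yk K S t \<omega> - (yk K S t \<omega> - innov K S t \<omega>))"
    by (intro lin_past_intros lin_past_yk t lin_past_mono[OF lin_yk_innov]) auto
  then show ?thesis by simp
qed

lemma orth_past_SucI:
  assumes "orth_past t X" "Gam M X (innov K S t) = 0" "square_integrable_vec M X"
  shows "orth_past (Suc t) X"
proof -
  have "Gam M X (\<lambda>\<omega>. yk K S t \<omega> - innov K S t \<omega>) = 0"
    by (rule orth_lin_past[OF assms(1) lin_yk_innov assms(3)])
  then have "Gam M X (yk K S t) = 0"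
    using assms by (simp add: Gam_right sq_yk[OF t] sq_innov)
  then show ?thesis using assms(1) by (auto simp: orth_past_def less_Suc_eq)
qed

text \<open>Against \<open>past t\<close> only the second part of \<open>innov_split\<close> is visible.\<close>

lemma Gam_innov_left:
  assumes X: "square_integrable_vec M X" "meas_vec (past t) X"
  shows "Gam M X (innov K S t) = (Gam M X (err t) ** transpose ones_kron + Gam M X (vk t)) ** Pik K t"
proof -
  have "Gam M X (innov K S t)
      = Gam M X (\<lambda>\<omega>. Upsk K *v wvec t \<omega> + Pik K t *v (ones_kron *v err t \<omega> + vk t \<omega>))"
    by (intro Gam_cong innov_split t) auto
  then show ?thesis
    by (simp add: Gam_right X sq sq_wvec[OF t] sq_err sq_vk Gam_wvec[OF t X] herm_Pik[OF t]
        matrix_distrib)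
qed

lemma Gam_err_vk: "Gam M (err t) (vk t) = 0"
proof -
  have "Gam M (xk t) (vk t) = 0"
    unfolding xk_def[abs_def] vk_def[abs_def] by (simp add: Gam_left Gam_right sq Gam_x_v matrix_distrib)
  moreover have "Gam M (vk t) (xpred K S t) = 0"
    by (rule orth_lin_past[OF orth_past_noise(2) lin_xpred sq_vk])
  then have "Gam M (xpred K S t) (vk t) = 0" by (subst Gam_herm) simp
  ultimately show ?thesis
    unfolding err_def[abs_def] by (simp add: Gam_left sq_xk sq_vk sq_lin_past[OF lin_xpred])
qed

lemma Gam_err_innov: "Gam M (err t) (innov K S t) = Theta K S t"
  by (simp add: Gam_innov_left sq_err err_past Gam_err_err Gam_err_vk Theta_eq[OF t])

lemma Gam_uk_err: "Gam M (uk t) (err t) = 0"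
proof -
  have "Gam M (uk t) (xk t) = 0"
    unfolding xk_def[abs_def] uk_def[abs_def] by (simp add: Gam_left Gam_right sq Gam_u_x matrix_distrib)
  moreover have "Gam M (uk t) (xpred K S t) = 0"
    by (rule orth_lin_past[OF orth_past_noise(1) lin_xpred sq_uk])
  ultimately show ?thesis
    unfolding err_def[abs_def] by (simp add: Gam_right sq_xk sq_uk sq_lin_past[OF lin_xpred])
qed

lemma Gam_uk_innov: "Gam M (uk t) (innov K S t) = Sk K S t ** Pik K t"
  by (simp add: Gam_innov_left sq_uk uk_past Gam_uk_vk Gam_uk_err matrix_distrib)

lemma orth_innov: "orth_past t (innov K S t)"
  unfolding orth_past_def
proof
  fix s assume s: "s \<in> {1..<t}"
  then have Y: "square_integrable_vec M (yk K S s)" "meas_vec (past t) (yk K S s)"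
    using sq_yk yk_past by auto
  have "Gam M (yk K S s) (err t) = 0" "Gam M (yk K S s) (vk t) = 0"
    using orth_err orth_past_noise(2)[of t] s by (subst Gam_herm, simp add: orth_past_def)+
  then show "Gam M (innov K S t) (yk K S s) = 0"
    by (subst Gam_herm) (simp add: Gam_innov_left Y matrix_distrib)
qed

lemma Gam_innov_innov: "Gam M (innov K S t) (innov K S t) = Omega K S t"
proof -
  define N where "N = (\<lambda>\<omega>. ones_kron *v err t \<omega> + vk t \<omega>)"
  define A where "A = (\<lambda>\<omega>. Upsk K *v wvec t \<omega>)"
  define B where "B = (\<lambda>\<omega>. Pik K t *v N \<omega>)"
  note sqW = sq_wvec[OF t]
  have N: "square_integrable_vec M N" "meas_vec (past t) N"
    unfolding N_def by (intro sq sq_err sq_vk) (intro meas_vec_intros err_past vk_past)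
  have sqAB: "square_integrable_vec M A" "square_integrable_vec M B"
    unfolding A_def B_def by (intro sq sqW N(1))+
  have "Gam M (vk t) (err t) = 0" by (subst Gam_herm) (simp add: Gam_err_vk)
  then have NN: "Gam M N N
      = ones_kron ** Ppred K S t ** transpose ones_kron + Gam M (vk t) (vk t)"
    unfolding N_def
    by (simp add: Gam_left Gam_right sq sq_err sq_vk Gam_err_vk Gam_err_err matrix_distrib
        matrix_mul_assoc)
  have WW: "Gam M (wvec t) (wvec t) = Cov_g S t \<odot> Gam M (dvec t) (dvec t)"
    unfolding wvec_def[abs_def] Cov_g_def
    by (intro Gam_hvec_hvec'[OF t] bounded_gvec_diff(1)[OF t] sq_dvec dvec_past[OF t])
  have AB: "Gam M A B = 0" "Gam M B A = 0"
    unfolding A_def B_def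
    by (simp_all add: Gam_left Gam_right sq sqW N(1) Gam_wvec[OF t N] matrix_distrib)
  have "Gam M (innov K S t) (innov K S t) = Gam M (\<lambda>\<omega>. A \<omega> + B \<omega>) (\<lambda>\<omega>. A \<omega> + B \<omega>)"
    unfolding A_def B_def N_def by (intro Gam_cong innov_split t)
  also have "\<dots> = Gam M A A + Gam M B B"
    by (simp add: Gam_left Gam_right sq sqAB AB)
  also have "Gam M A A = Upsk K ** (Cov_g S t \<odot> Gam M (dvec t) (dvec t)) ** herm (Upsk K)"
    unfolding A_def by (simp add: Gam_left Gam_right sq sqW WW matrix_mul_assoc)
  also have "Gam M B B = Pik K t ** Gam M N N ** Pik K t"
    unfolding B_def by (simp add: Gam_left Gam_right sq N(1) herm_Pik[OF t] matrix_mul_assoc)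
  finally show ?thesis by (simp add: NN Omega_eq[OF t])
qed

lemma herm_Omega: "herm (Omega K S t) = Omega K S t"
  using Gam_herm Gam_innov_innov by metis

context
  assumes inv_Omega: "invertible (Omega K S t)"
begin

lemma xfilt_eq: "xfilt K S t \<omega> = xpred K S t \<omega> + Lgain K S t *v innov K S t \<omega>"
  using t by (simp add: xfilt_def)

lemma ferr_eq: "ferr t = (\<lambda>\<omega>. err t \<omega> - Lgain K S t *v innov K S t \<omega>)"
  by (simp add: ferr_def[abs_def] xfilt_eq err_def algebra_simps)

lemma Lgain_Omega: "Lgain K S t ** Omega K S t = Theta K S t"
  by (simp add: Lgain_def matrix_inv_mult[OF inv_Omega] flip: matrix_mul_assoc)

lemma Hgain_Omega: "Hgain K S t ** Omega K S t = Sk K S t ** Pik K t"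
  by (simp add: Hgain_def Hgain_of_def matrix_inv_mult[OF inv_Omega] Omega_def[symmetric]
      flip: matrix_mul_assoc)

lemma lin_xfilt: "lin_past (Suc t) (xfilt K S t)"
  unfolding xfilt_eq[abs_def]
  by (intro lin_past_intros lin_innov lin_past_mono[OF lin_xpred]) auto

lemma sq_ferr: "square_integrable_vec M (ferr t)"
  unfolding ferr_eq by (intro sq sq_err sq_innov)

text \<open>The gain is chosen for this identity: $\Theta_k - L_k\Omega_k = 0$.\<close>

lemma Gam_ferr_innov: "Gam M (ferr t) (innov K S t) = 0"
  unfolding ferr_eq
  by (simp add: Gam_left sq sq_err sq_innov Gam_err_innov Gam_innov_innov Lgain_Omega)

lemma orth_ferr: "orth_past (Suc t) (ferr t)"
proof (rule orth_past_SucI[OF _ Gam_ferr_innov sq_ferr])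
  show "orth_past t (ferr t)"
    using orth_err orth_innov unfolding orth_past_def ferr_eq
    by (simp add: Gam_left sq sq_err sq_innov sq_yk matrix_distrib)
qed

lemma Gam_ferr_ferr: "Gam M (ferr t) (ferr t) = Pfilt K S t"
proof -
  have "Gam M (ferr t) (ferr t) = Gam M (ferr t) (\<lambda>\<omega>. err t \<omega> - Lgain K S t *v innov K S t \<omega>)"
    by (simp add: ferr_eq)
  also have "\<dots> = Gam M (ferr t) (err t)"
    by (simp add: Gam_right sq sq_err sq_innov sq_ferr Gam_ferr_innov matrix_distrib)
  also have "\<dots> = Ppred K S t - Lgain K S t ** Gam M (innov K S t) (err t)"
    unfolding ferr_eq by (simp add: Gam_left sq sq_err sq_innov Gam_err_err)
  also have "Gam M (innov K S t) (err t) = herm (Theta K S t)"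
    by (subst Gam_herm) (simp add: Gam_err_innov)
  finally show ?thesis
    using t by (simp add: Pfilt_def Pfilt_of_def Lgain_def Theta_def Omega_def)
qed

text \<open>The next prediction error is $\Phi_k$ applied to the filtering error plus $N = u_k - H_k\epsilon_k$. The
  gain $H_k$ makes $N$ orthogonal to the innovation, and $N$ correlates with the filtering error only
  through the correction $L_k\epsilon_k$, whence the mixed terms of the recursion for
  \<open>Ppred\<close>.\<close>

lemma predictor_inv_Suc: "predictor_inv (Suc t)"
  unfolding predictor_inv_def
proof (intro conjI)
  let ?Phi = "Phik K t" and ?H = "Hgain K S t" and ?e = "innov K S t"
  obtain t' where t': "t = Suc t'" using t by (cases t) auto
  have xp: "xpred K S (Suc t) = (\<lambda>\<omega>. ?Phi *v xfilt K S t \<omega> + ?H *v ?e \<omega>)"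
    by (simp add: t' fun_eq_iff Let_def xfilt_def innov_def)
  show "lin_past (Suc t) (xpred K S (Suc t))"
    unfolding xp by (intro lin_past_intros lin_xfilt lin_innov)
  define N where "N = (\<lambda>\<omega>. uk t \<omega> - ?H *v ?e \<omega>)"
  define E where "E = (\<lambda>\<omega>. ?Phi *v ferr t \<omega> + N \<omega>)"
  have err: "err (Suc t) \<omega> = E \<omega>" if "\<omega> \<in> space M" for \<omega>
    using that by (simp add: err_def E_def N_def xk_Suc xp ferr_def matrix_vector_distrib algebra_simps)
  have sqN: "square_integrable_vec M N" unfolding N_def by (intro sq sq_uk sq_innov)
  have sqE: "square_integrable_vec M E" unfolding E_def by (intro sq sqN sq_ferr)
  have Ne: "Gam M N ?e = 0"
    unfolding N_def
    by (simp add: Gam_left sq sq_uk sq_innov Gam_uk_innov Gam_innov_innov Hgain_Omega)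
  have oN: "orth_past t N"
    using orth_innov orth_past_noise(1)[of t] unfolding orth_past_def N_def
    by (simp add: Gam_left sq sq_uk sq_innov sq_yk matrix_distrib)
  have "orth_past (Suc t) N"
    by (rule orth_past_SucI[OF oN Ne sqN])
  then have "orth_past (Suc t) E"
    using orth_ferr unfolding orth_past_def E_def
    by (simp add: Gam_left sq sqN sq_ferr sq_yk matrix_distrib)
  moreover have "Gam M (err (Suc t)) Y = Gam M E Y" for Y :: "'w \<Rightarrow> tess^('r \<times> 'k \<times> 'n)"
    by (intro Gam_cong err refl)
  ultimately show "orth_past (Suc t) (err (Suc t))" by (simp add: orth_past_def)
  have ue: "Gam M (uk t) ?e = ?H ** Omega K S t" by (simp add: Gam_uk_innov Hgain_Omega)
  have eu: "Gam M ?e (uk t) = Omega K S t ** herm ?H"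
    by (subst Gam_herm) (simp add: ue herm_mult herm_Omega)
  have NN: "Gam M N N = Qk K S t - ?H ** Omega K S t ** herm ?H"
  proof -
    have "Gam M N N = Gam M N (\<lambda>\<omega>. uk t \<omega> - ?H *v ?e \<omega>)" by (simp add: N_def)
    also have "\<dots> = Gam M N (uk t)"
      by (simp add: Gam_right sq sq_uk sq_innov sqN Ne matrix_distrib)
    also have "\<dots> = Qk K S t - ?H ** Omega K S t ** herm ?H"
      unfolding N_def by (simp add: Gam_left sq sq_uk sq_innov eu Gam_uk_uk matrix_mul_assoc)
    finally show ?thesis .
  qed
  have fN: "Gam M (ferr t) N = - (Theta K S t ** herm ?H)"
  proof -
    have eN: "Gam M ?e N = 0" by (subst Gam_herm) (simp add: Ne)
    have "Gam M (err t) (uk t) = 0" by (subst Gam_herm) (simp add: Gam_uk_err)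
    then have "Gam M (err t) N = - (Theta K S t ** herm ?H)"
      unfolding N_def by (simp add: Gam_right sq sq_uk sq_innov sq_err Gam_err_innov)
    then show ?thesis
      unfolding ferr_eq by (simp add: Gam_left sq sq_err sq_innov sqN eN matrix_distrib)
  qed
  have Nf: "Gam M N (ferr t) = - (?H ** herm (Theta K S t))"
    by (subst Gam_herm) (simp add: fN herm_mult herm_minus)
  have "Gam M (err (Suc t)) (err (Suc t)) = Gam M E E" by (intro Gam_cong err)
  also have "\<dots> = ?Phi ** Pfilt K S t ** herm ?Phi - ?Phi ** Theta K S t ** herm ?H
      - ?H ** herm (Theta K S t) ** herm ?Phi + Gam M N N"
    unfolding E_def
    by (simp add: Gam_left Gam_right sq sqN sq_ferr Gam_ferr_ferr fN Nf matrix_distrib matrix_mul_assoc)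
  also have "\<dots> = Ppred K S (Suc t)"
    unfolding NN by (simp add: t' Let_def Pfilt_def Theta_def Omega_def Hgain_def)
  finally show "Gam M (err (Suc t)) (err (Suc t)) = Ppred K S (Suc t)" .
qed

end

end

text \<open>Any other LLMS estimator differs from the computed one by a vector that is a combination of
  the observations and orthogonal to each of them, hence to itself.\<close>

theorem filter_correct:
  assumes t: "1 \<le> t" and \<Omega>: "\<forall>s\<in>{1..t}. invertible (Omega K S s)"
  shows "LLMS_estimator M (st S t) (yk K S) t (\<lambda>\<omega>. first_block K *v xfilt K S t \<omega>) \<and>
     (\<forall>xhat. LLMS_estimator M (st S t) (yk K S) t xhat \<longrightarrow>
        (AE \<omega> in M. xhat \<omega> = first_block K *v xfilt K S t \<omega>) \<and>
        Gam M (\<lambda>\<omega>. st S t \<omega> - xhat \<omega>) (\<lambda>\<omega>. st S t \<omega> - xhat \<omega>) =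
          first_block K ** Pfilt K S t ** transpose (first_block K))"
proof -
  have "predictor_inv t" using t \<Omega>
  proof (induction t rule: nat_induct_at_least)
    case base show ?case by (rule predictor_inv_1)
  next
    case (Suc t) then show ?case by (intro predictor_inv_Suc) auto
  qed
  note inv = this
  have \<Omega>t: "invertible (Omega K S t)" using t \<Omega> by auto
  note a = t inv
  let ?F = "first_block K" and ?x = "\<lambda>\<omega>. first_block K *v xfilt K S t \<omega>"
  let ?f = "\<lambda>\<omega>. xk t \<omega> - xfilt K S t \<omega>"
  have f_def: "?f = ferr t" by (simp add: ferr_def[abs_def])
  have e: "(\<lambda>\<omega>. st S t \<omega> - ?x \<omega>) = (\<lambda>\<omega>. ?F *v ferr t \<omega>)"
    by (simp add: st_eq_first_block matrix_vector_distrib flip: f_def)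
  note sqf = sq_ferr[OF a \<Omega>t]
  have lin_x: "lin_past (Suc t) ?x" by (intro lin_past_intros lin_xfilt a \<Omega>t)
  have orth: "orth_past (Suc t) (\<lambda>\<omega>. st S t \<omega> - ?x \<omega>)"
    using orth_ferr[OF a \<Omega>t] unfolding e orth_past_def by (simp add: Gam_left sqf sq_yk matrix_distrib)
  have LLMS_iff: "LLMS_estimator M (st S t) (yk K S) t xh \<longleftrightarrow>
     lin_past (Suc t) xh \<and> orth_past (Suc t) (\<lambda>\<omega>. st S t \<omega> - xh \<omega>)" for xh
    by (simp add: LLMS_estimator_def lin_past_def orth_past_def atLeastLessThanSuc_atLeastAtMost)
  have sq_st: "square_integrable_vec M (st S t)"
    unfolding st_eq_first_block[abs_def] by (intro sq sq_xk)
  have sqx: "square_integrable_vec M ?x" by (rule sq_lin_past[OF lin_x])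
  show ?thesis
  proof (intro conjI allI impI)
    show "LLMS_estimator M (st S t) (yk K S) t ?x"
      using LLMS_iff lin_x orth by blast
  next
    fix xh assume "LLMS_estimator M (st S t) (yk K S) t xh"
    then have xh: "lin_past (Suc t) xh" "orth_past (Suc t) (\<lambda>\<omega>. st S t \<omega> - xh \<omega>)"
      using LLMS_iff by auto
    let ?d = "\<lambda>\<omega>. xh \<omega> - ?x \<omega>"
    have sqh: "square_integrable_vec M xh" by (rule sq_lin_past[OF xh(1)])
    have lin_d: "lin_past (Suc t) ?d" by (intro lin_past_intros xh lin_xfilt a \<Omega>t)
    have "orth_past (Suc t) ?d"
      using orth xh(2) unfolding orth_past_def
      by (simp add: Gam_left sq_st sqh sqx sq_yk)
    then have "Gam M ?d ?d = 0" by (rule orth_lin_past[OF _ lin_d sq_lin_past[OF lin_d]])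
    then have "AE \<omega> in M. ?d \<omega> = 0"
      by (rule Gam_self_eq_0_imp_AE[OF sq_lin_past[OF lin_d]])
    then show AE: "AE \<omega> in M. xh \<omega> = ?x \<omega>" by eventually_elim simp
    have "Gam M (\<lambda>\<omega>. st S t \<omega> - xh \<omega>) (\<lambda>\<omega>. st S t \<omega> - xh \<omega>)
        = Gam M (\<lambda>\<omega>. st S t \<omega> - ?x \<omega>) (\<lambda>\<omega>. st S t \<omega> - ?x \<omega>)"
    proof (rule Gam_AE_cong)
      show "AE \<omega> in M. st S t \<omega> - xh \<omega> = st S t \<omega> - ?x \<omega>" using AE by eventually_elim simp
    qed (intro square_integrable_vec_diff sq_st sqh sqx)+
    also have "\<dots> = ?F ** Pfilt K S t ** transpose ?F"
      unfolding e by (simp add: Gam_left Gam_right sq sqf Gam_ferr_ferr[OF a \<Omega>t] matrix_mul_assoc)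
    finally show "Gam M (\<lambda>\<omega>. st S t \<omega> - xh \<omega>) (\<lambda>\<omega>. st S t \<omega> - xh \<omega>)
        = ?F ** Pfilt K S t ** transpose ?F" .
  qed
qed

end

section \<open>The two properness classes\<close>

lemma matrix_nth_eqI:
  fixes A B :: "'a^('b::finite \<times> 'n::finite)^('c::finite \<times> 'm::finite)"
  shows "(\<And>a j b k. A $ (a, j) $ (b, k) = B $ (a, j) $ (b, k)) \<Longrightarrow> A = B"
  by (simp add: vec_eq_iff)

lemma leading_mult_nth: "(leading K ** A) $ (a, j) $ q = A $ (blk K a, j) $ q"
proof -
  have "(leading K ** A) $ (a, j) $ q = (leading K *v (\<chi> p. A $ p $ q)) $ (a, j)"
    by (simp add: matrix_matrix_mult_def matrix_vector_mult_def)
  then show ?thesis by (simp add: leading_vec)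
qed

lemma mult_leading_nth:
  "(A ** leading K) $ p $ (c, j) = (\<Sum>b\<in>UNIV. if blk K b = c then A $ p $ (b, j) else 0)"
proof -
  have "(\<Sum>k\<in>UNIV. A $ p $ k * leading K $ k $ (c, j))
      = (\<Sum>b\<in>UNIV. \<Sum>l\<in>UNIV. if l = j then (if blk K b = c then A $ p $ (b, l) else 0) else 0)"
    by (simp add: sum_UNIV_prod leading_def if_distrib [of "\<lambda>c. _ * c"] cong: if_cong)
      (intro sum.cong refl, auto)
  then show ?thesis by (simp add: matrix_matrix_mult_def)
qed

lemma sel_lead_mult_nth: "(sel_lead K ** A) $ (i, a, j) $ q = A $ (i, blk K a, j) $ q"
proof -
  have "(sel_lead K ** A) $ (i, a, j) $ q = (sel_lead K *v (\<chi> p. A $ p $ q)) $ (i, a, j)"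
    by (simp add: matrix_matrix_mult_def matrix_vector_mult_def)
  then show ?thesis by (simp add: sel_lead_def kron_mat_1_vec leading_vec)
qed

lemma block_diag_kron_nth:
  fixes B :: "tess^'q::finite^'p::finite"
  shows "(block_diag A ** kron (mat 1) B) $ (i, p) $ (l, q) = (if i = l then (A i ** B) $ p $ q else 0)"
proof -
  have "(\<Sum>k\<in>UNIV. block_diag A $ (i, p) $ k * kron (mat 1) B $ k $ (l, q))
      = (\<Sum>m\<in>UNIV. if m = l then (if i = l then (\<Sum>s\<in>UNIV. A i $ p $ s * B $ s $ q) else 0) else 0)"
    unfolding sum_UNIV_prod
    by (intro sum.cong refl) (auto simp: block_diag_def block_mat_def kron_def mat_def)
  then show ?thesis by (simp add: matrix_matrix_mult_def)
qed

context tessarine_system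
begin

text \<open>The Bernoulli variables take the values 0 and 1 only up to a null set, so the expectation is compared
  with that of an indicator almost everywhere.\<close>

lemma Eg_eq_pr:
  assumes t: "1 \<le> t" shows "Eg S t $ (i, \<nu>, j) = pr S i t j \<nu>"
proof -
  let ?g = "\<lambda>\<omega>. tpart \<nu> (gam S i t \<omega> $ j)"
  have [measurable]: "?g \<in> borel_measurable M" by (rule gam_measurable[OF t])
  have "(\<integral>\<omega>. ?g \<omega> \<partial>M) = (\<integral>\<omega>. indicator {\<omega> \<in> space M. ?g \<omega> = 1} \<omega> \<partial>M)"
  proof (rule integral_cong_AE)
    show "AE \<omega> in M. ?g \<omega> = indicator {\<omega> \<in> space M. ?g \<omega> = 1} \<omega>"
      using gam_01[OF t, of \<nu> i j] AE_space by eventually_elim (auto simp: indicator_def)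
  qed measurable
  also have "\<dots> = pr S i t j \<nu>" using gam_prob[OF t, of \<nu> i j] by simp
  finally show ?thesis by (simp add: Eg_def gvec_def)
qed

lemma Pibar_g_nth:
  assumes t: "1 \<le> t"
  shows "Pibar_g S t $ (i, c, j) $ (l, d, k) = (if i = l \<and> j = k then
     (1/4) *\<^sub>R (\<Sum>\<nu>\<in>UNIV. pr S i t j \<nu> *\<^sub>R (calA_entry c \<nu> * tcnj (calA_entry d \<nu>))) else 0)"
proof -
  have U: "Ups $ (i, c, j) $ (m, \<nu>, s) = (if i = m \<and> j = s then (1/2) *\<^sub>R calA_entry c \<nu> else 0)"
    for i :: 'r and c and j :: 'n and m \<nu> s
    by (simp add: Ups_def calT_def kron_def mat_def calA_def)
  have "Pibar_g S t $ (i, c, j) $ (l, d, k)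
      = (Ups *v (diag_mat (Eg S t) *v (\<chi> q. herm Ups $ q $ (l, d, k)))) $ (i, c, j)"
    unfolding Pibar_g_def matrix_mul_assoc[symmetric]
    by (simp add: matrix_matrix_mult_def matrix_vector_mult_def)
  also have "\<dots> = (1/2) *\<^sub>R (\<Sum>\<nu>\<in>UNIV. calA_entry c \<nu> *
      (pr S i t j \<nu> *\<^sub>R (if l = i \<and> k = j then (1/2) *\<^sub>R tcnj (calA_entry d \<nu>) else 0)))"
    unfolding hvec_diag[symmetric] Ups_vec
    by (simp add: hvec_def herm_nth U Eg_eq_pr[OF t] if_distrib [of tcnj] cong: if_cong)
  also have "\<dots> = (if i = l \<and> j = k then
     (1/4) *\<^sub>R (\<Sum>\<nu>\<in>UNIV. pr S i t j \<nu> *\<^sub>R (calA_entry c \<nu> * tcnj (calA_entry d \<nu>))) else 0)"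
    by (auto simp: scaleR_sum_right)
  finally show ?thesis .
qed

text \<open>Different sensors and different coordinates do not interact in the mean dropout matrix, so the rule
  for $\Pi_k$ concerns the selected rows of one $4\times4$ matrix for each sensor and coordinate.\<close>

lemma sel_lead_Pibar_block:
  assumes t: "1 \<le> t"
    and B: "\<And>i a c j k. (B i ** leading K) $ (a, j) $ (c, k) = (if j = k then
       (1/4) *\<^sub>R (\<Sum>\<nu>\<in>UNIV. pr S i t j \<nu> *\<^sub>R (calA_entry (blk K a) \<nu> * tcnj (calA_entry c \<nu>))) else 0)"
  shows "sel_lead K ** Pibar_g S t = block_diag B ** sel_lead K"
proof -
  have "(sel_lead K ** Pibar_g S t) $ (i, a, j) $ (l, c, k)
      = (block_diag B ** sel_lead K) $ (i, a, j) $ (l, c, k)" for i a j l c k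
    unfolding sel_lead_mult_nth Pibar_g_nth[OF t] unfolding sel_lead_def block_diag_kron_nth B by auto
  then show ?thesis by (simp add: vec_eq_iff)
qed

text \<open>With equal parameters the entries of the mean dropout matrix are $p\,\frac14$ times inner products of
  rows of $\mathcal A$, which are orthogonal.\<close>

lemma T1_reduced:
  assumes T1: "T1_conditions S"
  shows "reduced_system S (T1_reduction S)"
proof (unfold_locales)
  have p: "pr S i t j PEta = pr S i t j PR" "pr S i t j PEta1 = pr S i t j PR"
    "pr S i t j PEta2 = pr S i t j PR" if "1 \<le> t" for i t j
    using T1 that unfolding T1_conditions_def by auto
  show "inj (blk (T1_reduction S))" by (simp add: inj_def)
  show "CId \<in> range (blk (T1_reduction S))" by (simp add: T1_reduction_def)
  show "leading (T1_reduction S) ** Phibar S t = Phik (T1_reduction S) t ** leading (T1_reduction S)" for t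
  proof (rule matrix_nth_eqI)
    fix a j c k
    have "Phibar S t = block_diag (\<lambda>c. map_mat (capp c) (F1 S t))"
      using T1 by (simp add: T1_conditions_def)
    then show "(leading (T1_reduction S) ** Phibar S t) $ (a, j) $ (c, k)
        = (Phik (T1_reduction S) t ** leading (T1_reduction S)) $ (a, j) $ (c, k)"
      by (simp add: leading_mult_nth mult_leading_nth T1_reduction_def block_diag_def block_mat_def
          Phi1_def map_mat_def)
  qed
  show "sel_lead (T1_reduction S) ** Pibar_g S t = Pik (T1_reduction S) t ** sel_lead (T1_reduction S)"
    if t: "1 \<le> t" for t
  proof -
    have "(Pi1_block S i t ** leading (T1_reduction S)) $ (a, j) $ (c, k) = (if j = k then
       (1/4) *\<^sub>R (\<Sum>\<nu>\<in>UNIV. pr S i t j \<nu> *\<^sub>R (calA_entry (blk (T1_reduction S) a) \<nu> * tcnj (calA_entry c \<nu>))) else 0)"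
      for i a c j k
      by (cases c) (simp_all add: mult_leading_nth T1_reduction_def Pi1_block_def block_mat_def
          diag_mat_def UNIV_part p[OF t] tess_eq_iff tess_sel_mult)
    from sel_lead_Pibar_block[OF t this] show ?thesis by (simp add: T1_reduction_def)
  qed
qed

text \<open>The entries of the mean dropout matrix in the row of $x$ and the columns of $x^\eta$ and
  $x^{\eta''}$ are
  $\frac14(p_r + p_\eta - p_{\eta'} - p_{\eta''})$ and
  $\frac14(p_r - p_\eta - p_{\eta'} + p_{\eta''})$. They vanish when $p_r = p_{\eta'}$ and
  $p_\eta = p_{\eta''}$, and so do those in the row of $x^*$.\<close>

lemma T2_reduced:
  assumes T2: "T2_conditions S"
  shows "reduced_system S (T2_reduction S)"
proof (unfold_locales)
  have p: "pr S i t j PEta1 = pr S i t j PR" "pr S i t j PEta2 = pr S i t j PEta" if "1 \<le> t" for i t j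
    using T2 that unfolding T2_conditions_def by auto
  have two: "a = 1 \<or> a = 2" for a :: 2 using exhaust_2 by blast
  have blk: "blk (T2_reduction S) a = (if a = 1 then CId else CStar)" for a
    by (simp add: T2_reduction_def)
  show "inj (blk (T2_reduction S))"
    unfolding inj_def blk using two by (metis invol.distinct(1))
  show "CId \<in> range (blk (T2_reduction S))" by (rule range_eqI[of _ _ 1]) (simp add: blk)
  show "leading (T2_reduction S) ** Phibar S t = Phik (T2_reduction S) t ** leading (T2_reduction S)" for t
  proof (rule matrix_nth_eqI)
    fix a j c k
    have "Phibar S t = diag_halves (Phi2 S t) (map_mat teta (Phi2 S t))"
      using T2 by (simp add: T2_conditions_def)
    then show "(leading (T2_reduction S) ** Phibar S t) $ (a, j) $ (c, k)
        = (Phik (T2_reduction S) t ** leading (T2_reduction S)) $ (a, j) $ (c, k)"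
      using two[of a]
      by (cases c) (auto simp: leading_mult_nth mult_leading_nth blk diag_halves_def upper_half_def
          half_pos_def sum_2 T2_reduction_def)
  qed
  show "sel_lead (T2_reduction S) ** Pibar_g S t = Pik (T2_reduction S) t ** sel_lead (T2_reduction S)"
    if t: "1 \<le> t" for t
  proof -
    have "(Pi2_block S i t ** leading (T2_reduction S)) $ (a, j) $ (c, k) = (if j = k then
       (1/4) *\<^sub>R (\<Sum>\<nu>\<in>UNIV. pr S i t j \<nu> *\<^sub>R (calA_entry (blk (T2_reduction S) a) \<nu> * tcnj (calA_entry c \<nu>))) else 0)"
      for i a c j k
      using two[of a]
      by (cases c) (auto simp: mult_leading_nth blk Pi2_block_def block_mat_def sum_2
          diag_mat_def UNIV_part p[OF t] tess_eq_iff tess_sel_mult)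
    from sel_lead_Pibar_block[OF t this] show ?thesis by (simp add: T2_reduction_def)
  qed
qed

end

theorem theorem1:
  fixes S :: "('w, 'n::finite, 'r::finite) dropout_system"
  assumes "tessarine_system S"
  shows "(T1_conditions S \<longrightarrow>
           (\<forall>t\<ge>1. (\<forall>s\<in>{1..t}. invertible (Omega (T1_reduction S) S s)) \<longrightarrow>
             LLMS_estimator (pspace S) (st S t) (yk (T1_reduction S) S) t
               (\<lambda>\<omega>. first_block (T1_reduction S) *v xfilt (T1_reduction S) S t \<omega>) \<and>
             (\<forall>xhat. LLMS_estimator (pspace S) (st S t) (yk (T1_reduction S) S) t xhat \<longrightarrow>
               (AE \<omega> in pspace S.
                  xhat \<omega> = first_block (T1_reduction S) *v xfilt (T1_reduction S) S t \<omega>) \<and>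
               Gam (pspace S) (\<lambda>\<omega>. st S t \<omega> - xhat \<omega>) (\<lambda>\<omega>. st S t \<omega> - xhat \<omega>) =
                 first_block (T1_reduction S) ** Pfilt (T1_reduction S) S t
                   ** transpose (first_block (T1_reduction S))))) \<and>
         (T2_conditions S \<longrightarrow>
           (\<forall>t\<ge>1. (\<forall>s\<in>{1..t}. invertible (Omega (T2_reduction S) S s)) \<longrightarrow>
             LLMS_estimator (pspace S) (st S t) (yk (T2_reduction S) S) t
               (\<lambda>\<omega>. first_block (T2_reduction S) *v xfilt (T2_reduction S) S t \<omega>) \<and>
             (\<forall>xhat. LLMS_estimator (pspace S) (st S t) (yk (T2_reduction S) S) t xhat \<longrightarrow>
               (AE \<omega> in pspace S.
                  xhat \<omega> = first_block (T2_reduction S) *v xfilt (T2_reduction S) S t \<omega>) \<and>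
               Gam (pspace S) (\<lambda>\<omega>. st S t \<omega> - xhat \<omega>) (\<lambda>\<omega>. st S t \<omega> - xhat \<omega>) =
                 first_block (T2_reduction S) ** Pfilt (T2_reduction S) S t
                   ** transpose (first_block (T2_reduction S)))))"
proof -
  interpret tessarine_system S by fact
  show ?thesis
    using reduced_system.filter_correct[OF T1_reduced] reduced_system.filter_correct[OF T2_reduced]
    by blast
qed

end
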